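(* Let $P\in\mathbb{R}[X_1,\dots,X_n]$ be elliptic and homogeneous of degree $d\ge1$ and $Q\in\mathbb{R}[X_1,\dots,X_n]$ homogeneous of degree $q\ge0$. Let $Z(P,Q;s)$ be the meromorphic continuation to $\mathbb{C}$ of $\sum_{\mathbf m\in\mathbb{N}^n}Q(\mathbf m)P(\mathbf m)^{-s}$ (convergent for $\Re s>(n+q)/d$). Then for every $N\in\mathbb{N}_0$, $s=-N$ is not a pole of $Z(P,Q;s)$ and $$Z(P,Q;-N)=\sum_{\substack{\boldsymbol\beta\in\mathbb{N}_0^n\\|\boldsymbol\beta|\le q}}\sum_{\boldsymbol\alpha\in I_N(\boldsymbol\beta)}\sum_{\mathbf u\in V(\boldsymbol\alpha)}\frac{(-1)^{|\boldsymbol\alpha|-N}(|\boldsymbol\alpha|-1-N)!\,N!}{d\,\boldsymbol\alpha!\,\boldsymbol\beta!}\Big(\sum_{i=1}^nK_i(P;Q;N;\boldsymbol\alpha,\mathbf u,\boldsymbol\beta)\Big)\prod_{i=1}^n\widetilde B_{g_i(\mathbf u)+\beta_i}.$$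
   Context: $P$ elliptic means $P(\mathbf x)\ne0$ for $\mathbf x\in\mathbb{R}^n\setminus\{0\}$; $P$ is taken positive there so the powers are defined. The meromorphic continuation of $Z(P,Q;s)$ (with at most simple poles in $\{(n+q-k)/d:k\in\mathbb{N}_0\}\setminus(-\mathbb{N}_0)$) is due to Mahler. Multi-index notation: $|\mathbf a|=\sum a_i$, $\mathbf a!=\prod a_i!$, $\partial^{\boldsymbol\gamma}=\partial_1^{\gamma_1}\cdots\partial_n^{\gamma_n}$. $B_k$ are Bernoulli numbers ($X/(e^X-1)=\sum B_kX^k/k!$), $\widetilde B_k=B_k$ for $k\ne1$, $\widetilde B_1=1/2$. $I_N(\boldsymbol\beta)=\{\boldsymbol\alpha\in\mathbb{N}_0^d:\sum_{k=1}^dk\alpha_k+|\boldsymbol\beta|=dN+q+n\}$. $\Delta_k^n=\{\boldsymbol\gamma\in\mathbb{N}_0^n:|\boldsymbol\gamma|=k\}$. For $\boldsymbol\alpha\in\mathbb{N}_0^d$, $V(\boldsymbol\alpha)$ is the set of $\mathbf u=(\mathbf u_1,\dots,\mathbf u_d)$, $\mathbf u_k=(u_{k,\boldsymbol\gamma})_{\boldsymbol\gamma\in\Delta_k^n}$ with nonnegative integer entries summing to $\alpha_k$; $\mathbf u_k!=\prod_{\boldsymbol\gamma}u_{k,\boldsymbol\gamma}!$. $g_i(\mathbf u)=\sum_{k=1}^d\sum_{\boldsymbol\gamma\in\Delta_k^n}u_{k,\boldsymbol\gamma}\gamma_i$. $\hat{\mathbf y}(i)=(y_1,\dots,y_{i-1},1,y_{i+1},\dots,y_n)$.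 $P^i_{\boldsymbol\alpha,\mathbf u}(\hat{\mathbf y}(i))=\frac{\boldsymbol\alpha!}{\prod_k\mathbf u_k!}\prod_{k=1}^d\prod_{\boldsymbol\gamma\in\Delta_k^n}\big(\partial^{\boldsymbol\gamma}P(\hat{\mathbf y}(i))/\boldsymbol\gamma!\big)^{u_{k,\boldsymbol\gamma}}$, and $K_i(P;Q;N;\boldsymbol\alpha,\mathbf u,\boldsymbol\beta)=\int_{[0,1]^{n-1}}P(\hat{\mathbf y}(i))^{N-|\boldsymbol\alpha|}P^i_{\boldsymbol\alpha,\mathbf u}(\hat{\mathbf y}(i))\,\partial^{\boldsymbol\beta}Q(\hat{\mathbf y}(i))\prod_{k\ne i}dy_k$. *)

theory Defs
  imports "HOL-Complex_Analysis.Complex_Analysis" "HOL-Library.Poly_Mapping"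
begin

text \<open>
  Polynomials in the variables indexed by a finite type \<open>'n\<close>, as finitely supported maps from
  exponent vectors to coefficients; the number of variables is \<^term>\<open>CARD('n)\<close>.
  Multi-indices over the variables are plain functions \<open>'n \<Rightarrow> nat\<close>.
\<close>

type_synonym 'n mpoly = "('n \<Rightarrow>\<^sub>0 nat) \<Rightarrow>\<^sub>0 real"

definition mpoly_eval :: "'n::finite mpoly \<Rightarrow> real ^ 'n \<Rightarrow> real" where
  "mpoly_eval p x =
     (\<Sum>m\<in>Poly_Mapping.keys p. Poly_Mapping.lookup p m * (\<Prod>i\<in>UNIV. (x $ i) ^ Poly_Mapping.lookup m i))"

definition homogeneous :: "nat \<Rightarrow> 'n::finite mpoly \<Rightarrow> bool" where
  "homogeneous d p \<longleftrightarrow> (\<forall>m\<in>Poly_Mapping.keys p. (\<Sum>i\<in>UNIV. Poly_Mapping.lookup m i) = d)"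

definition elliptic :: "'n::finite mpoly \<Rightarrow> bool" where
  "elliptic p \<longleftrightarrow> (\<forall>x. x \<noteq> 0 \<longrightarrow> mpoly_eval p x \<noteq> 0)"

text \<open>
  Below, monomials not containing the \<open>i\<close>-th variable contribute the coefficient \<open>0\<close>, so the
  truncated subtraction on exponents is harmless.
\<close>

definition mpoly_pderiv :: "'n::finite \<Rightarrow> 'n mpoly \<Rightarrow> 'n mpoly" where
  "mpoly_pderiv i p =
     (\<Sum>m\<in>Poly_Mapping.keys p.
        Poly_Mapping.single (m - Poly_Mapping.single i 1)
          (of_nat (Poly_Mapping.lookup m i) * Poly_Mapping.lookup p m))"

text \<open>
  \<^term>\<open>Finite_Set.fold\<close> is meaningful here because the partial derivatives commute
  (lemma \<open>comp_fun_commute_mpoly_pderiv_funpow\<close> below), so no order on \<open>'n\<close> is needed.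
\<close>

definition mpoly_deriv :: "('n::finite \<Rightarrow> nat) \<Rightarrow> 'n mpoly \<Rightarrow> 'n mpoly" where
  "mpoly_deriv \<gamma> p = Finite_Set.fold (\<lambda>i. mpoly_pderiv i ^^ \<gamma> i) p UNIV"

lemma lookup_mpoly_pderiv:
  "Poly_Mapping.lookup (mpoly_pderiv i p) m =
     of_nat (Suc (Poly_Mapping.lookup m i)) * Poly_Mapping.lookup p (m + Poly_Mapping.single i 1)"
proof -
  let ?e = "Poly_Mapping.single i (1::nat)"
  let ?c = "\<lambda>k. of_nat (Poly_Mapping.lookup k i) * Poly_Mapping.lookup p k"
  have *: "(?c k when k - ?e = m) = (if k = m + ?e then ?c k else 0)" for k
  proof (cases "Poly_Mapping.lookup k i = 0")
    case True
    then have "k \<noteq> m + ?e" by (auto simp: lookup_add)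
    with True show ?thesis by simp
  next
    case False
    have "k = (k - ?e) + ?e"
      by (rule poly_mapping_eqI) (use False in \<open>auto simp: lookup_add lookup_minus lookup_single when_def\<close>)
    then have "k - ?e = m \<longleftrightarrow> k = m + ?e" by auto
    then show ?thesis by (simp add: when_def)
  qed
  have "Poly_Mapping.lookup (mpoly_pderiv i p) m =
      (\<Sum>k\<in>Poly_Mapping.keys p. if k = m + ?e then ?c k else 0)"
    unfolding mpoly_pderiv_def lookup_sum lookup_single * ..
  also have "\<dots> = ?c (m + ?e)"
    by (simp add: sum.delta in_keys_iff)
  finally show ?thesis by (simp add: lookup_add)
qed

lemma comp_fun_commute_mpoly_pderiv: "comp_fun_commute mpoly_pderiv"
proof
  fix i j :: "'n::finite"
  show "mpoly_pderiv j \<circ> mpoly_pderiv i = mpoly_pderiv i \<circ> mpoly_pderiv j"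
  proof (rule ext, rule poly_mapping_eqI)
    fix p :: "'n mpoly" and m
    show "Poly_Mapping.lookup ((mpoly_pderiv j \<circ> mpoly_pderiv i) p) m =
        Poly_Mapping.lookup ((mpoly_pderiv i \<circ> mpoly_pderiv j) p) m"
      by (cases "i = j") (simp_all add: lookup_mpoly_pderiv lookup_add lookup_single_not_eq ac_simps)
  qed
qed

lemma comp_fun_commute_mpoly_pderiv_funpow:
  "comp_fun_commute (\<lambda>i. mpoly_pderiv i ^^ \<gamma> i)"
  by (rule comp_fun_commute.comp_fun_commute_funpow[OF comp_fun_commute_mpoly_pderiv])

text \<open>
  \<open>Z\<close> is the meromorphic continuation to the whole plane of
  \<open>\<Sum>m. Q(m) P(m)\<^sup>-\<^sup>s\<close>, the sum being over vectors of positive integers. ``Nicely''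
  meromorphic means that the values of \<open>Z\<close> at removable singularities are the limits, so that
  \<open>Z\<close> is determined as a function.
\<close>

definition zeta_continuation ::
    "nat \<Rightarrow> nat \<Rightarrow> 'n::finite mpoly \<Rightarrow> 'n mpoly \<Rightarrow> (complex \<Rightarrow> complex) \<Rightarrow> bool" where
  "zeta_continuation d q P Q Z \<longleftrightarrow>
     Z nicely_meromorphic_on UNIV \<and>
     (\<forall>s. Re s > real (CARD('n) + q) / real d \<longrightarrow>
        ((\<lambda>m :: 'n \<Rightarrow> nat.
            complex_of_real (mpoly_eval Q (\<chi> i. real (m i))) *
            complex_of_real (mpoly_eval P (\<chi> i. real (m i))) powr (- s))
         has_sum Z s) {m. \<forall>i. m i \<ge> 1})"

definition bernoulli_number :: "nat \<Rightarrow> real" where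
  "bernoulli_number k = fact k * fps_nth (fps_X / (fps_exp 1 - 1)) k"

definition bernoulli_tilde :: "nat \<Rightarrow> real" where
  "bernoulli_tilde k = (if k = 1 then 1 / 2 else bernoulli_number k)"

text \<open>
  Vectors indexed by \<open>1, \<dots>, d\<close> are extensional functions on \<open>{1..d}\<close>, which makes the index sets
  below finite. For \<open>|\<beta>| \<le> q\<close> every \<open>\<alpha>\<close> in \<open>I_set d q N \<beta>\<close> satisfies \<open>|\<alpha>| > N\<close>
  (lemma \<open>I_set_size\<close>), so \<open>|\<alpha>| - 1 - N\<close> may be computed in the natural numbers.
\<close>

definition I_set :: "nat \<Rightarrow> nat \<Rightarrow> nat \<Rightarrow> ('n::finite \<Rightarrow> nat) \<Rightarrow> (nat \<Rightarrow> nat) set" where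
  "I_set d q N \<beta> =
     {\<alpha> \<in> {1..d} \<rightarrow>\<^sub>E UNIV. (\<Sum>k=1..d. k * \<alpha> k) + (\<Sum>i\<in>UNIV. \<beta> i) = d * N + q + CARD('n)}"

definition Delta :: "nat \<Rightarrow> ('n::finite \<Rightarrow> nat) set" where
  "Delta k = {\<gamma>. (\<Sum>i\<in>UNIV. \<gamma> i) = k}"

definition V_set :: "nat \<Rightarrow> (nat \<Rightarrow> nat) \<Rightarrow> (nat \<Rightarrow> ('n::finite \<Rightarrow> nat) \<Rightarrow> nat) set" where
  "V_set d \<alpha> = (\<Pi>\<^sub>E k\<in>{1..d}. {v \<in> Delta k \<rightarrow>\<^sub>E UNIV. (\<Sum>\<gamma>\<in>Delta k. v \<gamma>) = \<alpha> k})"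

definition g_index :: "nat \<Rightarrow> (nat \<Rightarrow> ('n::finite \<Rightarrow> nat) \<Rightarrow> nat) \<Rightarrow> 'n \<Rightarrow> nat" where
  "g_index d u i = (\<Sum>k=1..d. \<Sum>\<gamma>\<in>Delta k. u k \<gamma> * \<gamma> i)"

definition yhat :: "'n::finite \<Rightarrow> ('n \<Rightarrow> real) \<Rightarrow> real ^ 'n" where
  "yhat i y = (\<chi> k. if k = i then 1 else y k)"

definition P_coeff ::
    "nat \<Rightarrow> 'n::finite mpoly \<Rightarrow> (nat \<Rightarrow> nat) \<Rightarrow> (nat \<Rightarrow> ('n \<Rightarrow> nat) \<Rightarrow> nat) \<Rightarrow> real ^ 'n \<Rightarrow> real" where
  "P_coeff d P \<alpha> u x =
     (\<Prod>k=1..d. fact (\<alpha> k)) / (\<Prod>k=1..d. \<Prod>\<gamma>\<in>Delta k. fact (u k \<gamma>)) *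
     (\<Prod>k=1..d. \<Prod>\<gamma>\<in>Delta k.
        (mpoly_eval (mpoly_deriv \<gamma> P) x / (\<Prod>i\<in>UNIV. fact (\<gamma> i))) ^ u k \<gamma>)"

text \<open>
  The integral over the unit cube in the coordinates other than \<open>i\<close>. If \<^term>\<open>CARD('n) = 1\<close>, the
  measure is the unit mass on a single point and the integral is the value of the integrand.
\<close>

definition K_integral ::
    "nat \<Rightarrow> 'n::finite \<Rightarrow> 'n mpoly \<Rightarrow> 'n mpoly \<Rightarrow> nat \<Rightarrow> (nat \<Rightarrow> nat) \<Rightarrow>
     (nat \<Rightarrow> ('n \<Rightarrow> nat) \<Rightarrow> nat) \<Rightarrow> ('n \<Rightarrow> nat) \<Rightarrow> real" where
  "K_integral d i P Q N \<alpha> u \<beta> =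
     (LINT y : (UNIV - {i}) \<rightarrow>\<^sub>E {0..1} | Pi\<^sub>M (UNIV - {i}) (\<lambda>_. lborel).
        mpoly_eval P (yhat i y) powi (int N - int (\<Sum>k=1..d. \<alpha> k)) *
        P_coeff d P \<alpha> u (yhat i y) *
        mpoly_eval (mpoly_deriv \<beta> Q) (yhat i y))"

lemma finite_multi_indices_le: "finite {\<beta> :: 'n::finite \<Rightarrow> nat. (\<Sum>i\<in>UNIV. \<beta> i) \<le> q}"
proof (rule finite_subset)
  show "{\<beta> :: 'n \<Rightarrow> nat. (\<Sum>i\<in>UNIV. \<beta> i) \<le> q} \<subseteq> PiE UNIV (\<lambda>_. {..q})"
  proof
    fix \<beta> :: "'n \<Rightarrow> nat" assume \<beta>: "\<beta> \<in> {\<beta>. (\<Sum>i\<in>UNIV. \<beta> i) \<le> q}"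
    have "\<beta> i \<le> q" for i
    proof -
      have "\<beta> i \<le> (\<Sum>i\<in>UNIV. \<beta> i)" by (rule member_le_sum) auto
      also have "\<dots> \<le> q" using \<beta> by simp
      finally show ?thesis .
    qed
    then show "\<beta> \<in> PiE UNIV (\<lambda>_. {..q})" by (simp add: PiE_iff)
  qed
qed (intro finite_PiE; simp)

lemma finite_Delta: "finite (Delta k :: ('n::finite \<Rightarrow> nat) set)"
  by (rule finite_subset[OF _ finite_multi_indices_le[of k]]) (auto simp: Delta_def)

lemma finite_I_set:
  fixes \<beta> :: "'n::finite \<Rightarrow> nat"
  shows "finite (I_set d q N \<beta>)"
proof (rule finite_subset)
  show "I_set d q N \<beta> \<subseteq> {1..d} \<rightarrow>\<^sub>E {..d * N + q + CARD('n)}"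
  proof
    fix \<alpha> assume \<alpha>: "\<alpha> \<in> I_set d q N \<beta>"
    have "\<alpha> k \<le> d * N + q + CARD('n)" if "k \<in> {1..d}" for k
    proof -
      have "\<alpha> k \<le> k * \<alpha> k" using that by simp
      also have "\<dots> \<le> (\<Sum>k=1..d. k * \<alpha> k)"
        by (rule member_le_sum[where f = "\<lambda>k. k * \<alpha> k"]) (use that in auto)
      also have "\<dots> \<le> d * N + q + CARD('n)" using \<alpha> by (simp add: I_set_def)
      finally show ?thesis .
    qed
    then show "\<alpha> \<in> {1..d} \<rightarrow>\<^sub>E {..d * N + q + CARD('n)}"
      using \<alpha> by (auto simp: I_set_def PiE_iff)
  qed
qed (intro finite_PiE; simp)

lemma I_set_size:
  fixes \<beta> :: "'n::finite \<Rightarrow> nat"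
  assumes "\<alpha> \<in> I_set d q N \<beta>" and "(\<Sum>i\<in>UNIV. \<beta> i) \<le> q"
  shows "(\<Sum>k=1..d. \<alpha> k) > N"
proof -
  have "d * N < d * N + CARD('n)" by simp
  also have "\<dots> \<le> (\<Sum>k=1..d. k * \<alpha> k)" using assms by (simp add: I_set_def)
  also have "\<dots> \<le> (\<Sum>k=1..d. d * \<alpha> k)" by (intro sum_mono) simp
  also have "\<dots> = d * (\<Sum>k=1..d. \<alpha> k)" by (simp add: sum_distrib_left)
  finally show ?thesis by simp
qed

lemma finite_V_set: "finite (V_set d \<alpha> :: (nat \<Rightarrow> ('n::finite \<Rightarrow> nat) \<Rightarrow> nat) set)"
  unfolding V_set_def
proof (intro finite_PiE)
  fix k
  show "finite {v \<in> (Delta k :: ('n \<Rightarrow> nat) set) \<rightarrow>\<^sub>E UNIV. (\<Sum>\<gamma>\<in>Delta k. v \<gamma>) = \<alpha> k}"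
  proof (rule finite_subset)
    show "{v \<in> (Delta k :: ('n \<Rightarrow> nat) set) \<rightarrow>\<^sub>E UNIV. (\<Sum>\<gamma>\<in>Delta k. v \<gamma>) = \<alpha> k}
        \<subseteq> Delta k \<rightarrow>\<^sub>E {..\<alpha> k}"
    proof
      fix v :: "('n \<Rightarrow> nat) \<Rightarrow> nat"
      assume "v \<in> {v \<in> Delta k \<rightarrow>\<^sub>E UNIV. (\<Sum>\<gamma>\<in>Delta k. v \<gamma>) = \<alpha> k}"
      then have v: "v \<in> extensional (Delta k)" "(\<Sum>\<gamma>\<in>Delta k. v \<gamma>) = \<alpha> k"
        by (simp_all add: PiE_iff)
      have "v \<gamma> \<le> \<alpha> k" if "\<gamma> \<in> Delta k" for \<gamma>
        unfolding v(2)[symmetric] by (rule member_le_sum) (use that finite_Delta in simp_all)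
      with v(1) show "v \<in> Delta k \<rightarrow>\<^sub>E {..\<alpha> k}" by (simp add: PiE_iff)
    qed
  qed (intro finite_PiE; simp add: finite_Delta)
qed simp

end

theory Submission
  imports Defs
begin

text \<open>
  With \<open>h\<^sup>d = t\<close>, the theta series \<open>\<Theta>(t) = \<Sum>m. Q(m) exp (- t P(m))\<close> is \<open>h\<^sup>-\<^sup>q\<close> times a sum of
  \<open>F = Q e\<^sup>-\<^sup>P\<close> over the grid \<open>h m\<close>. Euler--Maclaurin summation in each variable gives, as \<open>t \<rightarrow> 0\<close>,
  the expansion of \<open>\<Theta>(t)\<close> with terms
  \<open>t powr ((|\<gamma>| - q - n) / d) * (\<Prod>i. B\<^sub>\<gamma>\<^sub>i / \<gamma>\<^sub>i!) * \<integral> \<partial>\<^sup>\<gamma> F\<close>, the integral being over the positive orthant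
  and the Bernoulli numbers having \<open>B\<^sub>1 = 1/2\<close>. Since \<open>\<Gamma>(s) Z(s)\<close> is the Mellin transform of \<open>\<Theta>\<close>,
  \<open>Z(- N)\<close> is \<open>(- 1)\<^sup>N N!\<close> times the coefficient of \<open>t\<^sup>N\<close>, which collects \<open>|\<gamma>| = d N + q + n\<close>.

  The derivatives \<open>\<partial>\<^sup>\<gamma> F\<close> are found by expanding \<open>Q(x + z v) exp (P(x) - P(x + z v))\<close> in powers of \<open>z\<close>
  and comparing coefficients of monomials in \<open>v\<close>. Each resulting term is a homogeneous function times
  \<open>e\<^sup>-\<^sup>P\<close>; in polar coordinates for the maximum norm its radial integral is a factorial and its spherical
  part is the sum of the integrals \<open>K\<^sub>i\<close> over the faces \<open>y\<^sub>i = 1\<close> of the unit cube.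
\<close>

section \<open>Polynomials as functions\<close>

text \<open>Every Euler-Maclaurin correction is written as an integral of a derivative, not as a
  difference of boundary values. The integral itself is then just the term of index 0, all
  coordinates and orders are treated alike, and the expansion is one sum over multi-indices. Cells
  are evaluated at their right endpoints because summation starts at 1; this is what turns B_1 =
  -1/2 into 1/2. Many triples (\<beta>, \<alpha>, u) share the exponent vector g(u) + \<beta>, so
  the stated sum cannot be matched term by term with the multi-indices \<gamma>. Both sides are
  compared as polynomials in v, and each power of v_i is then replaced by a Bernoulli number: a
  linear functional applied to an identity of polynomials. This stands in for a multivariate Faa di
  Bruno formula. At s = -N the function 1/\<Gamma>(s) has a simple zero with derivative (-1)^N N!.
  It cancels the possible simple pole c / (s + N) of the Mellin transform, which explains both the
  regularity and the factor (-1)^N N!. The factor (|\<alpha>| - 1 - N)! / d is the radial Gamma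
  integral.\<close>

definition mp_fun :: "'n::finite mpoly \<Rightarrow> ('n \<Rightarrow> real) \<Rightarrow> real" where
  "mp_fun p x = mpoly_eval p (\<chi> i. x i)"

lemma mpoly_eval_eq_mp_fun: "mpoly_eval p x = mp_fun p (\<lambda>i. x $ i)"
  by (simp add: mp_fun_def)

lemma mp_fun_superset:
  assumes "finite S" "Poly_Mapping.keys p \<subseteq> S"
  shows "mp_fun p x = (\<Sum>m\<in>S. Poly_Mapping.lookup p m * (\<Prod>i\<in>UNIV. x i ^ Poly_Mapping.lookup m i))"
  unfolding mp_fun_def mpoly_eval_def
  by (rule sum.mono_neutral_cong_left) (use assms in \<open>auto simp: in_keys_iff\<close>)

lemma mp_fun_zero [simp]: "mp_fun 0 x = 0"
  by (simp add: mp_fun_def mpoly_eval_def)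

lemma mp_fun_single: "mp_fun (Poly_Mapping.single m c) x = c * (\<Prod>i\<in>UNIV. x i ^ Poly_Mapping.lookup m i)"
  by (subst mp_fun_superset[of "{m}"]) auto

lemma mp_fun_one [simp]: "mp_fun 1 x = 1"
  using mp_fun_single[of 0 1 x] by simp

lemma mp_fun_add: "mp_fun (p + q) x = mp_fun p x + mp_fun q x"
  using keys_add[of p q]
  by (subst (1 2 3) mp_fun_superset[of "Poly_Mapping.keys p \<union> Poly_Mapping.keys q"])
     (auto simp: lookup_add algebra_simps sum.distrib)

lemma mp_fun_uminus: "mp_fun (- p) x = - mp_fun p x"
  using mp_fun_add[of p "- p" x] by simp

lemma mp_fun_diff: "mp_fun (p - q) x = mp_fun p x - mp_fun q x"
  using mp_fun_add[of p "- q" x] by (simp add: mp_fun_uminus)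

lemma mpoly_induct [case_names single add]:
  fixes p :: "'n::finite mpoly"
  assumes "\<And>m c. R (Poly_Mapping.single m c)" "\<And>p q. R p \<Longrightarrow> R q \<Longrightarrow> R (p + q)"
  shows "R p"
proof (induction p rule: update_induct)
  case const
  from assms(1)[of 0 0] show ?case by simp
next
  case (update f a b)
  have "Poly_Mapping.update a b f = f + Poly_Mapping.single a b"
    by (rule poly_mapping_eqI)
       (use update in \<open>auto simp: lookup_update lookup_add lookup_single in_keys_iff when_def\<close>)
  with assms update show ?case by metis
qed

lemma mp_fun_mult: "mp_fun (p * q) x = mp_fun p x * mp_fun q x"
proof (induction p rule: mpoly_induct)
  case (single m c)
  show ?case
  proof (induction q rule: mpoly_induct)
    case (single m' c')
    then show ?case
      by (simp add: mult_single mp_fun_single lookup_add power_add prod.distrib)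
  qed (simp add: mp_fun_add algebra_simps)
qed (simp add: mp_fun_add algebra_simps)

lemma mp_fun_power: "mp_fun (p ^ k) x = mp_fun p x ^ k"
  by (induction k) (auto simp: mp_fun_mult)

lemma mp_fun_prod: "mp_fun (prod f A) x = (\<Prod>a\<in>A. mp_fun (f a) x)"
  by (induction A rule: infinite_finite_induct) (auto simp: mp_fun_mult)

lemma mp_fun_const: "mp_fun (Poly_Mapping.single 0 c) x = c"
  by (simp add: mp_fun_single)

lemma continuous_on_mp_fun: "continuous_on S (\<lambda>x. mp_fun p (g x))"
  if "\<And>i. continuous_on S (\<lambda>x. g x i)"
  unfolding mp_fun_def mpoly_eval_def by (simp, intro continuous_intros that)

lemma mpoly_pderiv_add: "mpoly_pderiv i (p + q) = mpoly_pderiv i p + mpoly_pderiv i q"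
  by (rule poly_mapping_eqI) (simp add: lookup_mpoly_pderiv lookup_add algebra_simps)

lemma mpoly_pderiv_diff: "mpoly_pderiv i (p - q) = mpoly_pderiv i p - mpoly_pderiv i q"
  by (rule poly_mapping_eqI) (simp add: lookup_mpoly_pderiv lookup_minus algebra_simps)

lemma mpoly_pderiv_single:
  "mpoly_pderiv i (Poly_Mapping.single m c) =
     Poly_Mapping.single (m - Poly_Mapping.single i 1) (of_nat (Poly_Mapping.lookup m i) * c)"
  by (cases "c = 0") (simp_all add: mpoly_pderiv_def)

lemma mpoly_pderiv_mult:
  "mpoly_pderiv i (p * q) = mpoly_pderiv i p * q + p * mpoly_pderiv i q"
proof (induction p rule: mpoly_induct)
  case (single m c)
  show ?case
  proof (induction q rule: mpoly_induct)
    case (single m' c')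
    let ?e = "Poly_Mapping.single i (Suc 0)"
    \<comment> \<open>Truncated subtraction passes through the sum only where the
      \<open>i\<close>-th exponent is positive; where it is 0 the coefficient vanishes, hence the
      case split below.\<close>
    have *: "k + (k' - ?e) = k + k' - ?e" if "Poly_Mapping.lookup k' i > 0" for k k' :: "'a \<Rightarrow>\<^sub>0 nat"
      by (rule poly_mapping_eqI) (use that in \<open>auto simp: lookup_add lookup_minus lookup_single when_def\<close>)
    show ?case
      by (cases "Poly_Mapping.lookup m i = 0"; cases "Poly_Mapping.lookup m' i = 0")
         (auto simp: mult_single mpoly_pderiv_single * lookup_add algebra_simps
               simp flip: single_add)
  qed (simp add: mpoly_pderiv_add algebra_simps)
qed (simp add: mpoly_pderiv_add algebra_simps)

text \<open>Ties the formal derivative to the analytic one. Varying one coordinate by function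
  update keeps all analysis one-dimensional.\<close>

lemma has_field_derivative_mp_fun:
  "((\<lambda>y. mp_fun p (x(i := y))) has_field_derivative mp_fun (mpoly_pderiv i p) (x(i := y))) (at y)"
proof (induction p rule: mpoly_induct)
  case (single m c)
  have *: "(\<Prod>j\<in>UNIV. (x(i := y)) j ^ Poly_Mapping.lookup k j) =
      y ^ Poly_Mapping.lookup k i * (\<Prod>j\<in>UNIV - {i}. x j ^ Poly_Mapping.lookup k j)" for k y
    by (subst prod.remove[of _ i]) (auto intro!: prod.cong)
  have **: "(\<Prod>j\<in>UNIV - {i}. x j ^ Poly_Mapping.lookup (m - Poly_Mapping.single i 1) j) =
     (\<Prod>j\<in>UNIV - {i}. x j ^ Poly_Mapping.lookup m j)"
    by (rule prod.cong) (auto simp: lookup_minus lookup_single)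
  show ?case
    unfolding mpoly_pderiv_single mp_fun_single * **
    by (auto intro!: derivative_eq_intros simp: lookup_minus)
qed (auto simp: mp_fun_add mpoly_pderiv_add intro!: derivative_eq_intros)

section \<open>Multi-indices and iterated commuting operators\<close>

lemma multi_index_induct [case_names zero Suc]:
  fixes \<gamma> :: "'n::finite \<Rightarrow> nat"
  assumes "R (\<lambda>_. 0)" "\<And>\<gamma> i. R \<gamma> \<Longrightarrow> R (\<gamma>(i := Suc (\<gamma> i)))"
  shows "R \<gamma>"
proof (induction "\<Sum>i\<in>UNIV. \<gamma> i" arbitrary: \<gamma>)
  case 0
  then have "\<gamma> = (\<lambda>_. 0)" by (simp add: fun_eq_iff)
  with assms(1) show ?case by simp
next
  case (Suc k)
  then obtain i where i: "\<gamma> i \<noteq> 0" by (metis Zero_not_Suc sum.neutral)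
  define \<delta> where "\<delta> = \<gamma>(i := \<gamma> i - 1)"
  have \<gamma>: "\<gamma> = \<delta>(i := Suc (\<delta> i))" using i by (auto simp: \<delta>_def)
  have "(sum \<gamma> UNIV) = Suc (sum \<delta> UNIV)"
    by (subst \<gamma>, subst (1 2) sum.remove[of _ i]) auto
  with Suc have "R \<delta>" by simp
  from assms(2)[OF this, of i] show ?case by (simp only: \<gamma>)
qed

text \<open>Abstracted from \<open>mpoly_deriv\<close> so that one Taylor recursion serves both
  \<open>mpoly_pderiv\<close> and its conjugate \<open>exp_pderiv P\<close>.\<close>

definition mder :: "('n::finite \<Rightarrow> 'a \<Rightarrow> 'a) \<Rightarrow> ('n \<Rightarrow> nat) \<Rightarrow> 'a \<Rightarrow> 'a" where
  "mder D \<gamma> p = Finite_Set.fold (\<lambda>i. D i ^^ \<gamma> i) p UNIV"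

lemma mpoly_deriv_eq_mder: "mpoly_deriv = mder mpoly_pderiv"
  by (intro ext) (simp add: mpoly_deriv_def mder_def)

context
  fixes D :: "'n::finite \<Rightarrow> 'a \<Rightarrow> 'a"
  assumes comm: "comp_fun_commute D"
begin

text \<open>Commutation lets any chosen coordinate be applied last, so the otherwise unspecified
  order of the fold never matters.\<close>

lemma mder_remove: "mder D \<gamma> p = (D i ^^ \<gamma> i) (Finite_Set.fold (\<lambda>i. D i ^^ \<gamma> i) p (UNIV - {i}))"
proof -
  interpret comp_fun_commute "\<lambda>i. D i ^^ \<gamma> i"
    by (rule comp_fun_commute.comp_fun_commute_funpow[OF comm])
  show ?thesis unfolding mder_def by (rule fold_rec) auto
qed

lemma mder_remove_cong: 
  "Finite_Set.fold (\<lambda>j. D j ^^ (\<gamma>(i := k)) j) p (UNIV - {i}) = Finite_Set.fold (\<lambda>i. D i ^^ \<gamma> i) p (UNIV - {i})"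
proof (rule Finite_Set.fold_cong[where S = UNIV])
  show "comp_fun_commute_on UNIV (\<lambda>ia. D ia ^^ (\<gamma>(i := k)) ia)"
    using comp_fun_commute.comp_fun_commute_funpow[OF comm, of "\<gamma>(i := k)"]
    by (simp only: comp_fun_commute_def')
  show "comp_fun_commute_on UNIV (\<lambda>i. D i ^^ \<gamma> i)"
    using comp_fun_commute.comp_fun_commute_funpow[OF comm, of \<gamma>]
    by (simp only: comp_fun_commute_def')
qed auto

lemma mder_upd: "mder D (\<gamma>(i := k + l)) p = (D i ^^ k) (mder D (\<gamma>(i := l)) p)"
  unfolding mder_remove[of _ _ i] mder_remove_cong by (simp add: funpow_add)

lemma mder_Suc: "mder D (\<gamma>(i := Suc (\<gamma> i))) p = D i (mder D \<gamma> p)"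
  using mder_upd[of \<gamma> i 1 "\<gamma> i" p] by simp

lemma mder_D: "mder D \<gamma> (D i p) = D i (mder D \<gamma> p)"
proof -
  interpret comp_fun_commute "\<lambda>j. D j ^^ \<gamma> j"
    by (rule comp_fun_commute.comp_fun_commute_funpow[OF comm])
  have c: "D i (D j x) = D j (D i x)" for j x
    using comm by (auto simp: comp_fun_commute_def fun_eq_iff)
  have cc: "(D j ^^ k) (D i x) = D i ((D j ^^ k) x)" for j k x
    by (induction k) (auto simp: c)
  have "Finite_Set.fold (\<lambda>i. D i ^^ \<gamma> i) (D i p) A = D i (Finite_Set.fold (\<lambda>i. D i ^^ \<gamma> i) p A)"
    if "finite A" for A
    using that by (induction A rule: finite_induct) (auto simp: fold_insert cc)
  then show ?thesis unfolding mder_def by simp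
qed

lemma mder_Suc': "mder D (\<gamma>(i := Suc (\<gamma> i))) p = mder D \<gamma> (D i p)"
  by (simp add: mder_Suc mder_D)

lemma mder_zero: "mder D (\<lambda>_. 0) p = p"
proof -
  have "Finite_Set.fold (\<lambda>i. D i ^^ 0) p A = p" if "finite A" for A :: "'n set"
  proof -
    interpret comp_fun_commute "\<lambda>j. D j ^^ 0"
      by (rule comp_fun_commute.comp_fun_commute_funpow[OF comm])
    show ?thesis using that 
    proof (induction A rule: finite_induct)
      case (insert i A)
      then show ?case using fold_insert[of A i p] by (simp add: id_def)
    qed simp
  qed
  then show ?thesis by (simp add: mder_def)
qed

text \<open>Both sides count the pairs of a multi-index of size \<open>Suc M\<close> and a unit in it.\<close>

lemma mder_taylor_rec:
  fixes v :: "'n \<Rightarrow> real" and \<phi> :: "'a \<Rightarrow> real"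
  shows "real (Suc M) * (\<Sum>\<gamma>\<in>Delta (Suc M). (\<Prod>i\<in>UNIV. v i ^ \<gamma> i / fact (\<gamma> i)) * \<phi> (mder D \<gamma> p)) =
         (\<Sum>i\<in>UNIV. v i * (\<Sum>\<gamma>\<in>Delta M. (\<Prod>i\<in>UNIV. v i ^ \<gamma> i / fact (\<gamma> i)) * \<phi> (mder D \<gamma> (D i p))))"
proof -
  let ?w = "\<lambda>\<gamma> :: 'n \<Rightarrow> nat. \<Prod>i\<in>UNIV. v i ^ \<gamma> i / fact (\<gamma> i)"
  let ?c = "\<lambda>\<gamma>. ?w \<gamma> * \<phi> (mder D \<gamma> p)"
  have w: "?w (\<gamma>(i := Suc (\<gamma> i))) * real (Suc (\<gamma> i)) = v i * ?w \<gamma>" for \<gamma> i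
  proof -
    let ?r = "\<Prod>j\<in>UNIV - {i}. v j ^ \<gamma> j / fact (\<gamma> j)"
    have "v i ^ Suc (\<gamma> i) / fact (Suc (\<gamma> i)) * real (Suc (\<gamma> i)) = v i * (v i ^ \<gamma> i / fact (\<gamma> i))"
      by (simp add: fact_Suc del: of_nat_Suc)
    from arg_cong[OF this, of "\<lambda>a. a * ?r"]
    have "v i ^ Suc (\<gamma> i) / fact (Suc (\<gamma> i)) * ?r * real (Suc (\<gamma> i)) =
      v i * (v i ^ \<gamma> i / fact (\<gamma> i) * ?r)"
      by (simp only: mult_ac)
    moreover have "?w (\<gamma>(i := Suc (\<gamma> i))) = v i ^ Suc (\<gamma> i) / fact (Suc (\<gamma> i)) * ?r"
      by (subst prod.remove[of _ i]) (auto intro!: prod.cong)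
    moreover have "?w \<gamma> = v i ^ \<gamma> i / fact (\<gamma> i) * ?r"
      by (subst prod.remove[of _ i]) auto
    ultimately show ?thesis by (simp only:)
  qed
  have size: "(\<Sum>j\<in>UNIV. (\<gamma>(i := Suc (\<gamma> i))) j) = Suc (sum \<gamma> UNIV)" for \<gamma> :: "'n \<Rightarrow> nat" and i
    by (subst (1 2) sum.remove[of _ i]) auto
  have eq: "(\<Sum>\<gamma>\<in>Delta (Suc M). real (\<gamma> i) * ?c \<gamma>) = v i * (\<Sum>\<gamma>\<in>Delta M. ?w \<gamma> * \<phi> (mder D \<gamma> (D i p)))" for i
  proof -
    have "(\<Sum>\<gamma>\<in>Delta (Suc M). real (\<gamma> i) * ?c \<gamma>) = (\<Sum>\<gamma>\<in>{\<gamma>\<in>Delta (Suc M). \<gamma> i \<noteq> 0}. real (\<gamma> i) * ?c \<gamma>)"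
      by (rule sum.mono_neutral_right) (auto simp: finite_Delta)
    also have "\<dots> = (\<Sum>\<gamma>\<in>Delta M. v i * (?w \<gamma> * \<phi> (mder D \<gamma> (D i p))))"
    proof (rule sum.reindex_bij_witness[of _ "\<lambda>\<gamma>. \<gamma>(i := Suc (\<gamma> i))" "\<lambda>\<gamma>. \<gamma>(i := \<gamma> i - 1)"])
      fix \<gamma> :: "'n \<Rightarrow> nat" assume *: "\<gamma> \<in> {\<gamma> \<in> Delta (Suc M). \<gamma> i \<noteq> 0}"
      define \<delta> where "\<delta> = \<gamma>(i := \<gamma> i - 1)"
      have \<gamma>: "\<gamma> = \<delta>(i := Suc (\<delta> i))" using * by (auto simp: \<delta>_def)
      show "(\<gamma>(i := \<gamma> i - 1))(i := Suc ((\<gamma>(i := \<gamma> i - 1)) i)) = \<gamma>" using \<gamma> unfolding \<delta>_def by simp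
      show "\<gamma>(i := \<gamma> i - 1) \<in> Delta M"
        unfolding \<delta>_def[symmetric] using * size[of \<delta> i, folded \<gamma>] by (simp add: Delta_def)
      have "real (\<gamma> i) = real (Suc (\<delta> i))" by (subst \<gamma>) simp
      then have "real (\<gamma> i) * ?w \<gamma> = v i * ?w \<delta>"
        using w[of \<delta> i, folded \<gamma>] by (simp only: mult.commute)
      then have "real (\<gamma> i) * ?c \<gamma> = v i * ?w \<delta> * \<phi> (mder D \<gamma> p)" by (simp only: mult.assoc[symmetric])
      moreover have "mder D \<gamma> p = mder D \<delta> (D i p)" using mder_Suc'[of \<delta> i p, folded \<gamma>] .
      ultimately show "v i * (?w (\<gamma>(i := \<gamma> i - 1)) * \<phi> (mder D (\<gamma>(i := \<gamma> i - 1)) (D i p))) = real (\<gamma> i) * ?c \<gamma>"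
        unfolding \<delta>_def by (simp only: mult.assoc)
    qed (use size in \<open>auto simp: Delta_def\<close>)
    finally show ?thesis by (simp add: sum_distrib_left)
  qed
  have "real (Suc M) * (\<Sum>\<gamma>\<in>Delta (Suc M). ?c \<gamma>) = (\<Sum>\<gamma>\<in>Delta (Suc M). \<Sum>i\<in>UNIV. real (\<gamma> i) * ?c \<gamma>)"
    unfolding sum_distrib_left
  proof (rule sum.cong)
    fix \<gamma> :: "'n \<Rightarrow> nat" assume "\<gamma> \<in> Delta (Suc M)"
    then have "real (Suc M) = (\<Sum>i\<in>UNIV. real (\<gamma> i))" by (simp add: Delta_def flip: of_nat_sum)
    then show "real (Suc M) * ?c \<gamma> = (\<Sum>i\<in>UNIV. real (\<gamma> i) * ?c \<gamma>)"
      by (simp only: sum_distrib_right)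
  qed simp
  also have "\<dots> = (\<Sum>i\<in>UNIV. \<Sum>\<gamma>\<in>Delta (Suc M). real (\<gamma> i) * ?c \<gamma>)" by (rule sum.swap)
  finally show ?thesis unfolding eq .
qed

end

section \<open>Taylor series of polynomials\<close>

lemmas mder_Suc_pderiv = mder_Suc[OF comp_fun_commute_mpoly_pderiv]

lemma homogeneous_scale:
  assumes "homogeneous d p"
  shows "mp_fun p (\<lambda>i. r * x i) = r ^ d * mp_fun p x"
proof -
  have "(\<Prod>i\<in>UNIV. (r * x i) ^ Poly_Mapping.lookup m i) = r ^ d * (\<Prod>i\<in>UNIV. x i ^ Poly_Mapping.lookup m i)"
    if "m \<in> Poly_Mapping.keys p" for m
  proof -
    have "(\<Sum>i\<in>UNIV. Poly_Mapping.lookup m i) = d" using assms that by (simp add: homogeneous_def)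
    then show ?thesis by (simp add: power_mult_distrib prod.distrib flip: power_sum)
  qed
  then show ?thesis
    by (subst (1 2) mp_fun_superset[of "Poly_Mapping.keys p"])
       (auto simp: sum_distrib_left mult_ac intro!: sum.cong)
qed

lemma homogeneous_pderiv:
  assumes "homogeneous d p"
  shows "homogeneous (d - 1) (mpoly_pderiv i p)" "d = 0 \<Longrightarrow> mpoly_pderiv i p = 0"
proof -
  have *: "Suc (\<Sum>j\<in>UNIV. Poly_Mapping.lookup m j) = d" if "Poly_Mapping.lookup (mpoly_pderiv i p) m \<noteq> 0" for m
  proof -
    from that have "m + Poly_Mapping.single i 1 \<in> Poly_Mapping.keys p"
      by (auto simp: lookup_mpoly_pderiv in_keys_iff)
    with assms have "(\<Sum>j\<in>UNIV. Poly_Mapping.lookup (m + Poly_Mapping.single i 1) j) = d"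
      by (simp add: homogeneous_def)
    also have "(\<Sum>j\<in>UNIV. Poly_Mapping.lookup (m + Poly_Mapping.single i 1) j) = Suc (\<Sum>j\<in>UNIV. Poly_Mapping.lookup m j)"
      by (subst (1 2) sum.remove[of _ i]) (auto simp: lookup_add lookup_single when_def)
    finally show ?thesis .
  qed
  then show "homogeneous (d - 1) (mpoly_pderiv i p)"
    by (force simp: homogeneous_def in_keys_iff)
  show "mpoly_pderiv i p = 0" if "d = 0"
    using * that by (intro poly_mapping_eqI) auto
qed

text \<open>The two claims support each other: the truncated degree \<open>d - |\<gamma>|\<close>
  alone cannot tell degree 0 from overshoot, and it is a form of degree 0 that the next derivative
  annihilates.\<close>

lemma homogeneous_mder:
  assumes "homogeneous d p"
  shows "homogeneous (d - sum \<gamma> UNIV) (mder mpoly_pderiv \<gamma> p) \<and> 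
         ((sum \<gamma> UNIV) > d \<longrightarrow> mder mpoly_pderiv \<gamma> p = 0)"
proof (induction \<gamma> rule: multi_index_induct)
  case zero
  with assms show ?case by (simp add: mder_zero[OF comp_fun_commute_mpoly_pderiv])
next
  case (Suc \<gamma> i)
  have "(\<Sum>j\<in>UNIV. (\<gamma>(i := Suc (\<gamma> i))) j) = Suc (sum \<gamma> UNIV)"
    by (subst (1 2) sum.remove[of _ i]) auto
  then show ?case
    using homogeneous_pderiv[of "d - (sum \<gamma> UNIV)" "mder mpoly_pderiv \<gamma> p" i] Suc
    by (auto simp: mder_Suc_pderiv simp del: fun_upd_apply)
qed

lemmas mder_gt_degree = homogeneous_mder[THEN conjunct2, rule_format]

lemma mder_scale:
  assumes "homogeneous d p" "(sum \<gamma> UNIV) \<le> d"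
  shows "mp_fun (mder mpoly_pderiv \<gamma> p) (\<lambda>i. r * x i) = r ^ (d - sum \<gamma> UNIV) * mp_fun (mder mpoly_pderiv \<gamma> p) x"
  by (rule homogeneous_scale[OF homogeneous_mder[THEN conjunct1]]) (use assms in auto)

text \<open>The operator \<open>S \<mapsto> e\<^sup>P \<partial>\<^sub>i (S e\<^sup>-\<^sup>P)\<close>.\<close>

definition exp_pderiv :: "'n::finite mpoly \<Rightarrow> 'n \<Rightarrow> 'n mpoly \<Rightarrow> 'n mpoly" where
  "exp_pderiv P i S = mpoly_pderiv i S - S * mpoly_pderiv i P"

text \<open>Conjugating commuting operators keeps them commuting; algebraically this is the symmetry
  of the second derivatives of \<open>P\<close>.\<close>

lemma comp_fun_commute_exp_pderiv: "comp_fun_commute (exp_pderiv P)"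
proof
  fix i j
  have "mpoly_pderiv i (mpoly_pderiv j S) = mpoly_pderiv j (mpoly_pderiv i S)" for S :: "'a mpoly"
    using comp_fun_commute_mpoly_pderiv by (auto simp: comp_fun_commute_def fun_eq_iff)
  then show "exp_pderiv P j \<circ> exp_pderiv P i = exp_pderiv P i \<circ> exp_pderiv P j"
    by (auto simp: exp_pderiv_def mpoly_pderiv_diff mpoly_pderiv_mult algebra_simps)
qed

text \<open>For \<open>mpoly_pderiv\<close> this is S(x + z v) as a formal series in z. For
  \<open>exp_pderiv P\<close> it is e^(P(x)) times the series of S e^-P along the same line.\<close>

definition taylor_fps :: "('n::finite \<Rightarrow> 'n mpoly \<Rightarrow> 'n mpoly) \<Rightarrow> ('n \<Rightarrow> real) \<Rightarrow> ('n \<Rightarrow> real) \<Rightarrow> 'n mpoly \<Rightarrow> real fps" where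
  "taylor_fps D x v S = Abs_fps (\<lambda>k. \<Sum>\<gamma>\<in>Delta k. (\<Prod>i\<in>UNIV. v i ^ \<gamma> i / fact (\<gamma> i)) * mp_fun (mder D \<gamma> S) x)"

abbreviation taylor :: "('n::finite \<Rightarrow> real) \<Rightarrow> ('n \<Rightarrow> real) \<Rightarrow> 'n mpoly \<Rightarrow> real fps" where
  "taylor \<equiv> taylor_fps mpoly_pderiv"

text \<open>The chain rule: differentiating in z is the directional derivative along
  \<open>v\<close>. It allows identities of Taylor series to be proved coefficient by
  coefficient.\<close>

lemma fps_deriv_taylor_fps:
  assumes "comp_fun_commute D"
  shows "fps_deriv (taylor_fps D x v S) = (\<Sum>i\<in>UNIV. fps_const (v i) * taylor_fps D x v (D i S))"
proof (rule fps_ext)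
  fix k
  show "fps_nth (fps_deriv (taylor_fps D x v S)) k = fps_nth (\<Sum>i\<in>UNIV. fps_const (v i) * taylor_fps D x v (D i S)) k"
    using mder_taylor_rec[OF assms, of k v "\<lambda>p. mp_fun p x" S]
    by (simp add: taylor_fps_def fps_sum_nth)
qed

lemmas fps_deriv_taylor = fps_deriv_taylor_fps[OF comp_fun_commute_mpoly_pderiv]

lemma Delta_0: "Delta 0 = {\<lambda>_. 0}"
  by (auto simp: Delta_def fun_eq_iff)

lemma taylor_fps_nth_0: "comp_fun_commute D \<Longrightarrow> fps_nth (taylor_fps D x v S) 0 = mp_fun S x"
  by (simp add: taylor_fps_def Delta_0 mder_zero)

lemma taylor_fps_add:
  "taylor x v (S + T) = taylor x v S + taylor x v T"
proof -
  have "mder mpoly_pderiv \<gamma> (S + T) = mder mpoly_pderiv \<gamma> S + mder mpoly_pderiv \<gamma> T" for \<gamma>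
    by (induction \<gamma> rule: multi_index_induct)
       (simp_all add: mder_zero[OF comp_fun_commute_mpoly_pderiv] mder_Suc_pderiv mpoly_pderiv_add del: fun_upd_apply)
  then show ?thesis
    by (intro fps_ext) (simp add: taylor_fps_def mp_fun_add algebra_simps sum.distrib)
qed

text \<open>Avoids a multi-index Leibniz rule: both sides obey the same product rule in z, so the
  coefficient of order k + 1 follows from those of order k. \<open>S\<close> and \<open>T\<close>
  must vary, since differentiation replaces them by their partial derivatives.\<close>

lemma taylor_fps_mult:
  "taylor x v (S * T) = taylor x v S * taylor x v T"
proof -
  let ?\<tau> = "taylor x v"
  have "fps_nth (?\<tau> (S * T)) k = fps_nth (?\<tau> S * ?\<tau> T) k" for k
  proof (induction k arbitrary: S T)
    case 0
    show ?case by (simp add: taylor_fps_nth_0[OF comp_fun_commute_mpoly_pderiv] mp_fun_mult)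
  next
    case (Suc k)
    have "real (Suc k) * fps_nth (?\<tau> (S * T)) (Suc k) = fps_nth (fps_deriv (?\<tau> (S * T))) k"
      by simp
    also have "\<dots> = (\<Sum>i\<in>UNIV. v i * (fps_nth (?\<tau> (mpoly_pderiv i S) * ?\<tau> T) k + fps_nth (?\<tau> S * ?\<tau> (mpoly_pderiv i T)) k))"
      by (simp add: fps_deriv_taylor fps_sum_nth mpoly_pderiv_mult
        taylor_fps_add Suc)
    also have "\<dots> = fps_nth (\<Sum>i\<in>UNIV. fps_const (v i) * (?\<tau> (mpoly_pderiv i S) * ?\<tau> T + ?\<tau> S * ?\<tau> (mpoly_pderiv i T))) k"
      by (simp add: fps_sum_nth)
    also have "(\<Sum>i\<in>UNIV. fps_const (v i) * (?\<tau> (mpoly_pderiv i S) * ?\<tau> T + ?\<tau> S * ?\<tau> (mpoly_pderiv i T))) = fps_deriv (?\<tau> S * ?\<tau> T)"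
      by (simp add: fps_deriv_taylor sum.distrib sum_distrib_left sum_distrib_right algebra_simps)
    also have "fps_nth \<dots> k = real (Suc k) * fps_nth (?\<tau> S * ?\<tau> T) (Suc k)"
      by (simp only: fps_deriv_nth Suc_eq_plus1)
    finally show ?case by simp
  qed
  then show ?thesis by (intro fps_ext)
qed

lemma taylor_fps_diff: "taylor x v (S - T) = taylor x v S - taylor x v T"
  using taylor_fps_add[of x v "S - T" T] by simp

text \<open>Both sides satisfy the same linear differential system.\<close>

lemma taylor_fps_exp_pderiv:
  assumes "fps_deriv E = - fps_deriv (taylor x v P) * E" "fps_nth E 0 = 1"
  shows "taylor_fps (exp_pderiv P) x v S = taylor x v S * E"
proof -
  let ?\<tau> = "taylor x v"
  \<comment> \<open>\<open>E\<close> stands for exp(P(x) - P(x + z v)). Only its differential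
    equation and initial value are used, so no composition of formal series is needed.\<close>
  have deriv: "fps_deriv (?\<tau> S * E) = (\<Sum>i\<in>UNIV. fps_const (v i) * (?\<tau> (exp_pderiv P i S) * E))" for S
  proof -
    have "fps_deriv (?\<tau> S * E) = fps_deriv (?\<tau> S) * E - ?\<tau> S * fps_deriv (?\<tau> P) * E"
      by (simp add: assms(1) algebra_simps)
    also have "\<dots> = (\<Sum>i\<in>UNIV. fps_const (v i) * (?\<tau> (mpoly_pderiv i S) - ?\<tau> S * ?\<tau> (mpoly_pderiv i P)) * E)"
      by (simp add: fps_deriv_taylor sum_distrib_left sum_distrib_right
          algebra_simps sum_subtractf)
    also have "(\<lambda>i. ?\<tau> (mpoly_pderiv i S) - ?\<tau> S * ?\<tau> (mpoly_pderiv i P)) = (\<lambda>i. ?\<tau> (exp_pderiv P i S))"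
      by (simp add: exp_pderiv_def taylor_fps_mult taylor_fps_diff)
    finally show ?thesis by (simp add: mult.assoc)
  qed
  have "fps_nth (taylor_fps (exp_pderiv P) x v S) k = fps_nth (?\<tau> S * E) k" for k
  proof (induction k arbitrary: S)
    case 0
    show ?case by (simp add: taylor_fps_nth_0 comp_fun_commute_mpoly_pderiv comp_fun_commute_exp_pderiv assms)
  next
    case (Suc k)
    have "real (Suc k) * fps_nth (taylor_fps (exp_pderiv P) x v S) (Suc k) =
          fps_nth (fps_deriv (taylor_fps (exp_pderiv P) x v S)) k" by simp
    also have "\<dots> = (\<Sum>i\<in>UNIV. v i * fps_nth (?\<tau> (exp_pderiv P i S) * E) k)"
      by (simp add: fps_deriv_taylor_fps[OF comp_fun_commute_exp_pderiv] fps_sum_nth Suc)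
    also have "\<dots> = fps_nth (fps_deriv (?\<tau> S * E)) k"
      unfolding deriv by (simp add: fps_sum_nth)
    also have "\<dots> = real (Suc k) * fps_nth (?\<tau> S * E) (Suc k)"
      by (simp only: fps_deriv_nth Suc_eq_plus1)
    finally show ?case by simp
  qed
  then show ?thesis by (intro fps_ext)
qed

section \<open>Formal exponentials of monomials\<close>

text \<open>The series \<open>exp (c X\<^sup>k)\<close>.\<close>

definition fps_exp_monom :: "real \<Rightarrow> nat \<Rightarrow> real fps" where
  "fps_exp_monom c k = Abs_fps (\<lambda>n. if k dvd n then c ^ (n div k) / fact (n div k) else 0)"

lemma fps_deriv_exp_monom:
  assumes "k \<ge> 1"
  shows "fps_deriv (fps_exp_monom c k) = fps_const (c * real k) * fps_X ^ (k - 1) * fps_exp_monom c k"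
proof (rule fps_ext)
  fix n
  have "real (n + 1) * (if k dvd n + 1 then c ^ ((n + 1) div k) / fact ((n + 1) div k) else 0) =
     c * real k * (if n < k - 1 then 0 else if k dvd n - (k - 1) then c ^ ((n - (k - 1)) div k) / fact ((n - (k - 1)) div k) else 0)"
  proof (cases "k dvd Suc n")
    case True
    then obtain m where m: "Suc n = k * m" by auto
    then obtain l where l: "m = Suc l" by (cases m) auto
    have n: "n = k * l + (k - 1)" using m assms unfolding l by auto
    have n1: "real (n + 1) = real k * (real l + 1)" using m unfolding l by (simp add: algebra_simps flip: of_nat_Suc of_nat_mult of_nat_add)
    have s: "k * l + (k - 1) + 1 = k * Suc l" using assms by auto
    show ?thesis unfolding n1 unfolding n s using assms
      by (simp add: divide_simps del: mult_Suc_right)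
  next
    case False
    then have "\<not> k dvd n - (k - 1)" if "\<not> n < k - 1"
    proof -
      have "Suc n = n - (k - 1) + k" using that assms by auto
      with False show ?thesis by (metis dvd_add_triv_right_iff)
    qed
    with False show ?thesis by auto
  qed
  then show "fps_nth (fps_deriv (fps_exp_monom c k)) n = fps_nth (fps_const (c * real k) * fps_X ^ (k - 1) * fps_exp_monom c k) n"
    by (subst mult.assoc)
       (simp only: fps_deriv_nth fps_exp_monom_def fps_nth_Abs_fps fps_mult_left_const_nth fps_X_power_mult_nth)
qed

lemma fps_exp_monom_nth_0: "k \<ge> 1 \<Longrightarrow> fps_nth (fps_exp_monom c k) 0 = 1"
  by (simp add: fps_exp_monom_def)

lemma fps_deriv_prod_exp_monom:
  assumes "finite S" "\<And>s. s \<in> S \<Longrightarrow> k s \<ge> 1"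
  shows "fps_deriv (\<Prod>s\<in>S. fps_exp_monom (c s) (k s)) =
    (\<Sum>s\<in>S. fps_const (c s * real (k s)) * fps_X ^ (k s - 1)) * (\<Prod>s\<in>S. fps_exp_monom (c s) (k s))"
  using assms
  by (induction S rule: finite_induct) (simp_all add: fps_deriv_exp_monom algebra_simps)

text \<open>Picking the power \<open>u s\<close> from the exponential series of each factor
  contributes \<open>k s * u s\<close> to the degree. With weights 1, ..., d this yields the vectors
  \<alpha> of \<open>I_set\<close>; with all weights 1 it yields the multinomial theorem. Positive
  weights keep the index set finite.\<close>

lemma fps_nth_prod_exp_monom:
  assumes "finite S" "\<And>s. s \<in> S \<Longrightarrow> k s \<ge> 1"
  shows "fps_nth (\<Prod>s\<in>S. fps_exp_monom (c s) (k s)) l =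
    (\<Sum>u\<in>{u \<in> S \<rightarrow>\<^sub>E (UNIV :: nat set). (\<Sum>s\<in>S. k s * u s) = l}. \<Prod>s\<in>S. c s ^ u s / fact (u s))"
  using assms
proof (induction S arbitrary: l rule: finite_induct)
  case empty
  have "{u \<in> {} \<rightarrow>\<^sub>E (UNIV :: nat set). (\<Sum>s\<in>{}. k s * u s) = l} = (if l = 0 then {\<lambda>_. undefined} else {})" by auto
  then show ?case by simp
next
  case (insert t S)
  let ?U = "\<lambda>S l. {u \<in> S \<rightarrow>\<^sub>E (UNIV :: nat set). (\<Sum>s\<in>S. k s * u s) = l}"
  let ?w = "\<lambda>S u. \<Prod>s\<in>S. c s ^ u s / fact (u s)"
  have fin: "finite (?U S l)" for l
  proof (rule finite_subset)
    show "?U S l \<subseteq> S \<rightarrow>\<^sub>E {..l}"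
    proof
      fix u assume u: "u \<in> ?U S l"
      have "u s \<le> l" if "s \<in> S" for s
      proof -
        have "u s \<le> k s * u s" using insert that by auto
        also have "\<dots> \<le> (\<Sum>s\<in>S. k s * u s)" using that insert(1) by (intro member_le_sum) auto
        finally show ?thesis using u by simp
      qed
      with u show "u \<in> S \<rightarrow>\<^sub>E {..l}" by (auto simp: PiE_iff)
    qed
  qed (use insert in \<open>auto intro!: finite_PiE\<close>)
  have "fps_nth (\<Prod>s\<in>insert t S. fps_exp_monom (c s) (k s)) l =
    (\<Sum>j=0..l. if k t dvd j then c t ^ (j div k t) / fact (j div k t) * (\<Sum>u\<in>?U S (l - j). ?w S u) else 0)"
    using insert by (simp add: fps_mult_nth, intro sum.cong) (auto simp: fps_exp_monom_def)
  also have "\<dots> = (\<Sum>j\<in>{j\<in>{0..l}. k t dvd j}. c t ^ (j div k t) / fact (j div k t) * (\<Sum>u\<in>?U S (l - j). ?w S u))"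
    by (rule sum.mono_neutral_cong_right) auto
  also have "\<dots> = (\<Sum>a\<in>{a. k t * a \<le> l}. c t ^ a / fact a * (\<Sum>u\<in>?U S (l - k t * a). ?w S u))"
    using insert(4)[of t]
    by (intro sum.reindex_bij_witness[of _ "\<lambda>a. k t * a" "\<lambda>j. j div k t"]) auto
  also have "\<dots> = (\<Sum>(a, u)\<in>Sigma {a. k t * a \<le> l} (\<lambda>a. ?U S (l - k t * a)). c t ^ a / fact a * ?w S u)"
  proof -
    have "finite {a. k t * a \<le> l}"
      by (rule finite_subset[of _ "{..l}"]) (use insert(4)[of t] in \<open>auto elim: order.trans[rotated]\<close>)
    then show ?thesis by (subst sum.Sigma[symmetric]) (auto simp: sum_distrib_left fin)
  qed
  also have "\<dots> = (\<Sum>u\<in>?U (insert t S) l. ?w (insert t S) u)"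
  proof (rule sum.reindex_bij_witness[of _ "\<lambda>u. (u t, restrict u S)" "\<lambda>(a, u). u(t := a)"])
    fix au assume "au \<in> Sigma {a. k t * a \<le> l} (\<lambda>a. ?U S (l - k t * a))"
    then obtain a u where au: "au = (a, u)" "k t * a \<le> l" "u \<in> S \<rightarrow>\<^sub>E UNIV" "(\<Sum>s\<in>S. k s * u s) = l - k t * a"
      by auto
    have eq: "(\<Sum>s\<in>S. k s * (u(t := a)) s) = (\<Sum>s\<in>S. k s * u s)" "?w S (u(t := a)) = ?w S u"
      using insert(2) by (auto intro!: sum.cong prod.cong)
    show "(\<lambda>u. (u t, restrict u S)) ((\<lambda>(a, u). u(t := a)) au) = au"
      using insert(2) au by (auto simp: PiE_def extensional_def)
    have "(\<Sum>s\<in>insert t S. k s * (u(t := a)) s) = l"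
      unfolding sum.insert[OF insert(1,2)] eq using au by simp
    moreover have "u(t := a) \<in> insert t S \<rightarrow>\<^sub>E UNIV"
      using au(3) by (auto simp: PiE_iff extensional_def)
    ultimately show "(\<lambda>(a, u). u(t := a)) au \<in> ?U (insert t S) l"
      using au(1) by simp
    show "?w (insert t S) ((\<lambda>(a, u). u(t := a)) au) = (case au of (a, u) \<Rightarrow> c t ^ a / fact a * ?w S u)"
      unfolding prod.insert[OF insert(1,2)] using au eq by simp
  next
    fix u assume "u \<in> ?U (insert t S) l"
    then have u: "u \<in> insert t S \<rightarrow>\<^sub>E UNIV" "(\<Sum>s\<in>insert t S. k s * u s) = l" by auto
    show "(\<lambda>(a, u). u(t := a)) (u t, restrict u S) = u"
      using u(1) by (auto simp: fun_eq_iff PiE_iff extensional_def)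
    show "(u t, restrict u S) \<in> Sigma {a. k t * a \<le> l} (\<lambda>a. ?U S (l - k t * a))"
      using u insert by auto
  qed
  finally show ?case .
qed

section \<open>Expansion of the derivatives of a polynomial times an exponential\<close>

text \<open>Polynomials agreeing at all real points have the same coefficients, hence the same image
  under the linear map sending y^k to \<open>\<phi> k\<close>. Exponents may repeat on either
  side.\<close>

lemma sum_power_umbral:
  fixes c :: "'a \<Rightarrow> real" and c' :: "'b \<Rightarrow> real"
  assumes "finite S" "finite T" and eq: "\<And>y. (\<Sum>s\<in>S. c s * y ^ e s) = (\<Sum>t\<in>T. c' t * y ^ e' t)"
  shows "(\<Sum>s\<in>S. c s * \<phi> (e s)) = (\<Sum>t\<in>T. c' t * \<phi> (e' t))"
proof -
  define p where "p = (\<Sum>s\<in>S. monom (c s) (e s))"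
  define p' where "p' = (\<Sum>t\<in>T. monom (c' t) (e' t))"
  have "poly p = poly p'"
    using eq by (auto simp: p_def p'_def poly_sum poly_monom)
  then have pp: "p = p'" by (simp add: poly_eq_poly_eq_iff)
  have "\<exists>B. \<forall>k\<in>e ` S \<union> e' ` T. k \<le> B" using assms by (intro finite_nat_set_iff_bounded_le[THEN iffD1]) auto
  then obtain B where B: "\<forall>k\<in>e ` S \<union> e' ` T. k \<le> B" by blast
  have "(\<Sum>s\<in>S. c s * \<phi> (e s)) = (\<Sum>k\<le>B. coeff p k * \<phi> k)"
    using B by (simp add: p_def coeff_sum sum_distrib_right)
      (subst sum.swap, auto intro!: sum.cong simp: if_distrib[of "\<lambda>x. x * _"] cong: if_cong)
  moreover have "(\<Sum>t\<in>T. c' t * \<phi> (e' t)) = (\<Sum>k\<le>B. coeff p' k * \<phi> k)"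
    using B by (simp add: p'_def coeff_sum sum_distrib_right)
      (subst sum.swap, auto intro!: sum.cong simp: if_distrib[of "\<lambda>x. x * _"] cong: if_cong)
  ultimately show ?thesis by (simp add: pp)
qed

text \<open>The variables in \<open>J\<close> have already been replaced. With the other values
  frozen but arbitrary, the identity is one of polynomials in the next variable, to which
  \<open>sum_power_umbral\<close> applies.\<close>

lemma sum_monomials_umbral:
  fixes c :: "'a \<Rightarrow> real" and c' :: "'b \<Rightarrow> real" and \<phi> :: "'n::finite \<Rightarrow> nat \<Rightarrow> real"
  assumes "finite S" "finite T"
    and eq: "\<And>v. (\<Sum>s\<in>S. c s * (\<Prod>i\<in>UNIV. v i ^ e s i)) = (\<Sum>t\<in>T. c' t * (\<Prod>i\<in>UNIV. v i ^ e' t i))"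
  shows "(\<Sum>s\<in>S. c s * (\<Prod>i\<in>UNIV. \<phi> i (e s i))) = (\<Sum>t\<in>T. c' t * (\<Prod>i\<in>UNIV. \<phi> i (e' t i)))"
proof -
  let ?w = "\<lambda>J v e. \<Prod>i\<in>(UNIV :: 'n set). if i \<in> J then \<phi> i (e i) else v i ^ e i"
  have "(\<Sum>s\<in>S. c s * ?w J v (e s)) = (\<Sum>t\<in>T. c' t * ?w J v (e' t))" if "finite J" for J v
    using that
  proof (induction J arbitrary: v rule: finite_induct)
    case empty
    then show ?case using eq[of v] by simp
  next
    case (insert j J)
    let ?r = "\<lambda>e. \<Prod>i\<in>UNIV - {j}. if i \<in> J then \<phi> i (e i) else v i ^ e i"
    have r: "(\<Prod>i\<in>UNIV - {j}. if i \<in> J then \<phi> i (e i) else (v(j := y)) i ^ e i) = ?r e"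
        "(\<Prod>i\<in>UNIV - {j}. if i \<in> insert j J then \<phi> i (e i) else v i ^ e i) = ?r e" for e y
      by (rule prod.cong; auto)+
    have w1: "?w J (v(j := y)) e = ?r e * y ^ e j" for e y
      using insert(2) by (subst prod.remove[of _ j]) (auto simp: r mult.commute)
    have w2: "?w (insert j J) v e = ?r e * \<phi> j (e j)" for e
      using insert(2) by (subst prod.remove[of _ j]) (auto simp: r[simplified] mult.commute)
    have "(\<Sum>s\<in>S. (c s * ?r (e s)) * y ^ e s j) = (\<Sum>t\<in>T. (c' t * ?r (e' t)) * y ^ e' t j)" for y
      using insert(3)[of "v(j := y)"] unfolding w1 by (simp only: mult.assoc)
    from sum_power_umbral[OF assms(1,2) this] show ?case
      unfolding w2 by (simp only: mult.assoc)
  qed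
  from this[of UNIV] show ?thesis by simp
qed

lemma fps_exp_monom_1: "fps_exp_monom c 1 = fps_exp c"
  by (rule fps_ext) (simp add: fps_exp_monom_def)

text \<open>Compares coefficients in the factorization of exp((\<Sum> a_s) X) into the exponentials
  exp(a_s X).\<close>

lemma multinomial_real:
  fixes a :: "'a \<Rightarrow> real"
  assumes "finite S"
  shows "(\<Sum>s\<in>S. a s) ^ m / fact m =
    (\<Sum>u\<in>{u \<in> S \<rightarrow>\<^sub>E (UNIV :: nat set). (\<Sum>s\<in>S. u s) = m}. \<Prod>s\<in>S. a s ^ u s / fact (u s))"
proof -
  have "(\<Prod>s\<in>S. fps_exp_monom (a s) 1) = fps_exp (\<Sum>s\<in>S. a s)"
    using assms by (induction S rule: finite_induct) (simp_all add: fps_exp_monom_1[unfolded One_nat_def] fps_exp_add_mult)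
  then have "fps_nth (\<Prod>s\<in>S. fps_exp_monom (a s) 1) m = (\<Sum>s\<in>S. a s) ^ m / fact m" by simp
  with fps_nth_prod_exp_monom[OF assms, of "\<lambda>_. 1" a m] show ?thesis by simp
qed

context
  fixes P Q :: "'n::finite mpoly" and d q :: nat
  assumes P: "homogeneous d P" and Q: "homogeneous q Q"
begin

text \<open>With p_k the coefficients of P(x + z v), the series exp(P(x) - P(x + z v)) factors into
  the exponentials of -p_k z^k. The product stops at \<open>d\<close> because higher derivatives of
  \<open>P\<close> vanish; the constant term has cancelled.\<close>

lemma taylor_fps_exp_expansion:
  fixes x v :: "'n \<Rightarrow> real"
  defines "p \<equiv> \<lambda>k. fps_nth (taylor x v P) k"
  shows "taylor_fps (exp_pderiv P) x v S = taylor x v S * (\<Prod>k=1..d. fps_exp_monom (- p k) k)"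
proof (rule taylor_fps_exp_pderiv)
  have "p k = 0" if "k > d" for k
    using mder_gt_degree[OF P] that unfolding p_def taylor_fps_def
    by (auto intro!: sum.neutral simp: Delta_def)
  then have "fps_deriv (taylor x v P) = (\<Sum>k=1..d. fps_const (p k * real k) * fps_X ^ (k - 1))"
  proof (intro fps_ext)
    fix n
    have *: "n = k - 1 \<longleftrightarrow> k = n + 1" if "k \<in> {1..d}" for k using that by auto
    have "fps_nth (\<Sum>k=1..d. fps_const (p k * real k) * fps_X ^ (k - 1)) n = (\<Sum>k=1..d. if k = n + 1 then p k * real k else 0)"
      unfolding fps_sum_nth by (intro sum.cong refl) (simp add: fps_X_power_nth *)
    also have "\<dots> = (if n + 1 \<le> d then p (n + 1) * real (n + 1) else 0)"
      by (subst sum.delta) auto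
    also have "\<dots> = fps_nth (fps_deriv (taylor x v P)) n"
      using \<open>\<And>k. k > d \<Longrightarrow> p k = 0\<close>[of "n + 1"] by (auto simp: p_def)
    finally show "fps_nth (fps_deriv (taylor x v P)) n =
      fps_nth (\<Sum>k=1..d. fps_const (p k * real k) * fps_X ^ (k - 1)) n" ..
  qed
  then have "- fps_deriv (taylor x v P) = (\<Sum>k=1..d. fps_const (- p k * real k) * fps_X ^ (k - 1))"
    by (simp add: sum_negf flip: fps_const_neg)
  then show "fps_deriv (\<Prod>k=1..d. fps_exp_monom (- p k) k) =
     - fps_deriv (taylor x v P) * (\<Prod>k=1..d. fps_exp_monom (- p k) k)"
    by (subst fps_deriv_prod_exp_monom) auto
  have "fps_nth (prod f A) 0 = (\<Prod>a\<in>A. fps_nth (f a) 0)" for f :: "nat \<Rightarrow> real fps" and A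
    by (induction A rule: infinite_finite_induct) auto
  then show "fps_nth (\<Prod>k=1..d. fps_exp_monom (- p k) k) 0 = 1"
    by (simp add: fps_exp_monom_nth_0)
qed

text \<open>Each p_k is a sum over \<open>Delta k\<close>, and the multinomial theorem for its power
  produces the component \<open>u k\<close>. The division by \<alpha>! undoes the \<alpha>! built
  into \<open>P_coeff\<close>.\<close>

lemma prod_taylor_powers:
  fixes x v :: "'n \<Rightarrow> real"
  defines "p \<equiv> \<lambda>k. fps_nth (taylor x v P) k"
  shows "(\<Prod>k=1..d. (- p k) ^ \<alpha> k / fact (\<alpha> k)) =
    (\<Sum>u\<in>V_set d \<alpha>. (- 1) ^ (sum \<alpha> {1..d}) / (\<Prod>k=1..d. fact (\<alpha> k)) * P_coeff d P \<alpha> u (\<chi> i. x i) *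
        (\<Prod>i\<in>UNIV. v i ^ g_index d u i))"
proof -
  let ?T = "\<lambda>\<gamma>. mp_fun (mder mpoly_pderiv \<gamma> P) x"
  let ?t = "\<lambda>\<gamma>. (\<Prod>i\<in>UNIV. v i ^ \<gamma> i / fact (\<gamma> i)) * ?T \<gamma>"
  let ?R = "\<lambda>u. (- 1) ^ (sum \<alpha> {1..d}) / (\<Prod>k=1..d. fact (\<alpha> k)) * P_coeff d P \<alpha> u (\<chi> i. x i) *
        (\<Prod>i\<in>UNIV. v i ^ g_index d u i)"
  have "(\<Prod>k=1..d. (- p k) ^ \<alpha> k / fact (\<alpha> k)) = (- 1) ^ (sum \<alpha> {1..d}) * (\<Prod>k=1..d. p k ^ \<alpha> k / fact (\<alpha> k))"
    by (subst power_sum, subst prod.distrib[symmetric], rule prod.cong) (auto simp: power_minus[of "p _"])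
  also have "(\<Prod>k=1..d. p k ^ \<alpha> k / fact (\<alpha> k)) = (\<Prod>k=1..d. \<Sum>w\<in>{w \<in> Delta k \<rightarrow>\<^sub>E UNIV. (\<Sum>\<gamma>\<in>Delta k. w \<gamma>) = \<alpha> k}.
       \<Prod>\<gamma>\<in>Delta k. ?t \<gamma> ^ w \<gamma> / fact (w \<gamma>))"
    unfolding p_def taylor_fps_def fps_nth_Abs_fps by (subst multinomial_real) (auto simp: finite_Delta)
  also have "\<dots> = (\<Sum>u\<in>V_set d \<alpha>. \<Prod>k=1..d. \<Prod>\<gamma>\<in>Delta k. ?t \<gamma> ^ u k \<gamma> / fact (u k \<gamma>))"
    unfolding V_set_def
  proof (rule prod_sum_PiE)
    fix k
    let ?V = "{w \<in> (Delta k :: ('n \<Rightarrow> nat) set) \<rightarrow>\<^sub>E UNIV. (\<Sum>\<gamma>\<in>Delta k. w \<gamma>) = \<alpha> k}"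
    show "finite ?V"
    proof (rule finite_subset)
      show "?V \<subseteq> Delta k \<rightarrow>\<^sub>E {..\<alpha> k}"
      proof
        fix w assume "w \<in> ?V"
        then show "w \<in> Delta k \<rightarrow>\<^sub>E {..\<alpha> k}"
          using member_le_sum[of _ "Delta k" w] by (auto simp: PiE_iff finite_Delta)
      qed
    qed (auto intro!: finite_PiE simp: finite_Delta)
  qed auto
  also have "(- 1) ^ (sum \<alpha> {1..d}) * \<dots> = (\<Sum>u\<in>V_set d \<alpha>. ?R u)"
    unfolding sum_distrib_left
  proof (rule sum.cong)
    fix u :: "nat \<Rightarrow> ('n \<Rightarrow> nat) \<Rightarrow> nat"
    have "(\<Prod>k=1..d. \<Prod>\<gamma>\<in>Delta k. ?t \<gamma> ^ u k \<gamma> / fact (u k \<gamma>)) =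
       (\<Prod>k=1..d. \<Prod>\<gamma>\<in>Delta k. (?T \<gamma> / (\<Prod>i\<in>UNIV. fact (\<gamma> i))) ^ u k \<gamma>) / (\<Prod>k=1..d. \<Prod>\<gamma>\<in>Delta k. fact (u k \<gamma>)) *
       (\<Prod>k=1..d. \<Prod>\<gamma>\<in>Delta k. \<Prod>i\<in>UNIV. v i ^ (u k \<gamma> * \<gamma> i))"
      by (simp add: prod_dividef power_mult_distrib power_divide prod_power_distrib prod.distrib power_mult[symmetric] mult.commute)
    also have "(\<Prod>k=1..d. \<Prod>\<gamma>\<in>Delta k. \<Prod>i\<in>UNIV. v i ^ (u k \<gamma> * \<gamma> i)) = (\<Prod>k=1..d. \<Prod>i\<in>UNIV. \<Prod>\<gamma>\<in>Delta k. v i ^ (u k \<gamma> * \<gamma> i))"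
      by (intro prod.cong refl prod.swap)
    also have "\<dots> = (\<Prod>i\<in>UNIV. \<Prod>k=1..d. \<Prod>\<gamma>\<in>Delta k. v i ^ (u k \<gamma> * \<gamma> i))" by (rule prod.swap)
    also have "\<dots> = (\<Prod>i\<in>UNIV. v i ^ g_index d u i)" by (simp add: g_index_def power_sum)
    finally show "(- 1) ^ (sum \<alpha> {1..d}) * (\<Prod>k=1..d. \<Prod>\<gamma>\<in>Delta k. ?t \<gamma> ^ u k \<gamma> / fact (u k \<gamma>)) =
      ?R u"
      by (simp add: P_coeff_def mpoly_deriv_eq_mder mpoly_eval_eq_mp_fun)
  qed simp
  finally show ?thesis .
qed

text \<open>The combinatorial core. Both sides are the coefficient of z^(dN + q + n) in the
  expansion of Q(x + z v) exp(P(x) - P(x + z v)) when the factors \<open>\<phi> i k\<close> are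
  powers of v_i; the umbral lemma then admits arbitrary \<phi>.\<close>

lemma exp_pderiv_expansion:
  fixes \<phi> :: "'n \<Rightarrow> nat \<Rightarrow> real"
  shows "(\<Sum>\<gamma>\<in>Delta (d * N + q + CARD('n)). mp_fun (mder (exp_pderiv P) \<gamma> Q) x / (\<Prod>i\<in>UNIV. fact (\<gamma> i)) * (\<Prod>i\<in>UNIV. \<phi> i (\<gamma> i))) =
    (\<Sum>\<beta> | sum \<beta> UNIV \<le> q. \<Sum>\<alpha>\<in>I_set d q N \<beta>. \<Sum>u\<in>V_set d \<alpha>.
       (- 1) ^ (sum \<alpha> {1..d}) / ((\<Prod>k=1..d. fact (\<alpha> k)) * (\<Prod>i\<in>UNIV. fact (\<beta> i))) *
       (P_coeff d P \<alpha> u (\<chi> i. x i) * mp_fun (mder mpoly_pderiv \<beta> Q) x) *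
       (\<Prod>i\<in>UNIV. \<phi> i (g_index d u i + \<beta> i)))" (is "_ = (\<Sum>\<beta> | _ \<beta>. \<Sum>\<alpha>\<in>_ \<beta>. \<Sum>u\<in>_ \<alpha>. ?c \<beta> \<alpha> u * _ \<beta> \<alpha> u)")
proof -
  define M where "M = d * N + q + CARD('n)"
  let ?l = "\<lambda>\<gamma>. mp_fun (mder (exp_pderiv P) \<gamma> Q) x / (\<Prod>i\<in>UNIV. fact (\<gamma> i))"
  have sig: "(\<Sum>\<beta> | sum \<beta> UNIV \<le> q. \<Sum>\<alpha>\<in>I_set d q N \<beta>. \<Sum>u\<in>V_set d \<alpha>. F \<beta> \<alpha> u) =
     (\<Sum>(\<beta>, \<alpha>, u)\<in>Sigma {\<beta>. sum \<beta> UNIV \<le> q} (\<lambda>\<beta>. Sigma (I_set d q N \<beta>) (V_set d)). F \<beta> \<alpha> u)"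
    for F :: "('n \<Rightarrow> nat) \<Rightarrow> (nat \<Rightarrow> nat) \<Rightarrow> (nat \<Rightarrow> ('n \<Rightarrow> nat) \<Rightarrow> nat) \<Rightarrow> real"
    by (subst sum.Sigma[symmetric])
       (auto simp: finite_multi_indices_le finite_I_set finite_V_set sum.Sigma intro!: finite_SigmaI)
  have fin: "finite (Sigma {\<beta>. sum \<beta> UNIV \<le> q} (\<lambda>\<beta>::'n \<Rightarrow> nat. Sigma (I_set d q N \<beta>) (V_set d :: _ \<Rightarrow> (nat \<Rightarrow> ('n \<Rightarrow> nat) \<Rightarrow> nat) set)))"
    by (auto simp: finite_multi_indices_le finite_I_set finite_V_set intro!: finite_SigmaI)
  let ?S = "\<lambda>v. \<Sum>\<beta> | sum \<beta> UNIV \<le> q. \<Sum>\<alpha>\<in>I_set d q N \<beta>. \<Sum>u\<in>V_set d \<alpha>. ?c \<beta> \<alpha> u * (\<Prod>i\<in>UNIV. v i ^ (g_index d u i + \<beta> i))"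
  have v: "(\<Sum>\<gamma>\<in>Delta M. ?l \<gamma> * (\<Prod>i\<in>UNIV. v i ^ \<gamma> i)) =
    ?S v" for v
  proof -
    define p where "p = (\<lambda>k. fps_nth (taylor x v P) k)"
    define F where "F \<beta> = (\<Prod>i\<in>UNIV. v i ^ \<beta> i / fact (\<beta> i)) * mp_fun (mder mpoly_pderiv \<beta> Q) x *
      (\<Sum>\<alpha>\<in>I_set d q N \<beta>. \<Prod>k=1..d. (- p k) ^ \<alpha> k / fact (\<alpha> k))" for \<beta>
    \<comment> \<open>A term \<beta> of \<open>Q\<close> uses up j of the \<open>M\<close> powers of
      z; the remaining \<open>M - j\<close> come from the exponentials. This is the defining
      equation of \<open>I_set\<close>.\<close>
    have I: "I_set d q N \<beta> = {\<alpha> \<in> {1..d} \<rightarrow>\<^sub>E UNIV. (\<Sum>k=1..d. k * \<alpha> k) = M - j}"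
      if "\<beta> \<in> Delta j" "j \<le> M" for \<beta> :: "'n \<Rightarrow> nat" and j
      using that by (auto simp: I_set_def M_def Delta_def)
    have "(\<Sum>\<gamma>\<in>Delta M. ?l \<gamma> * (\<Prod>i\<in>UNIV. v i ^ \<gamma> i)) =
      fps_nth (taylor_fps (exp_pderiv P) x v Q) M"
      by (simp add: taylor_fps_def prod_dividef mult.commute)
    also have "\<dots> = (\<Sum>j=0..M. \<Sum>\<beta>\<in>Delta j. F \<beta>)"
      unfolding taylor_fps_exp_expansion fps_mult_nth
    proof (intro sum.cong refl)
      fix j assume "j \<in> {0..M}"
      then have "F \<beta> = (\<Prod>i\<in>UNIV. v i ^ \<beta> i / fact (\<beta> i)) * mp_fun (mder mpoly_pderiv \<beta> Q) x *
         fps_nth (\<Prod>k=1..d. fps_exp_monom (- p k) k) (M - j)" if "\<beta> \<in> Delta j" for \<beta>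
        using I[OF that] by (subst fps_nth_prod_exp_monom) (auto simp: F_def)
      then show "fps_nth (taylor x v Q) j *
          fps_nth (\<Prod>k=1..d. fps_exp_monom (- fps_nth (taylor x v P) k) k) (M - j) = (\<Sum>\<beta>\<in>Delta j. F \<beta>)"
        by (simp add: taylor_fps_def[of _ _ _ Q] p_def sum_distrib_right)
    qed
    also have "\<dots> = (\<Sum>\<beta>\<in>(\<Union>j\<in>{0..M}. Delta j). F \<beta>)"
      by (rule sum.UNION_disjoint[symmetric]) (auto simp: finite_Delta, auto simp: Delta_def)
    also have "(\<Union>j\<in>{0..M}. Delta j) = {\<beta> :: 'n \<Rightarrow> nat. sum \<beta> UNIV \<le> M}"
      by (auto simp: Delta_def)
    \<comment> \<open>Derivatives of \<open>Q\<close> of order above \<open>q\<close> vanish, which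
      gives the bound on |\<beta>| in the statement.\<close>
    also have "sum F \<dots> = (\<Sum>\<beta> | sum \<beta> UNIV \<le> q. F \<beta>)"
    proof (rule sum.mono_neutral_right)
      show "{\<beta>. sum \<beta> UNIV \<le> q} \<subseteq> {\<beta> :: 'n \<Rightarrow> nat. sum \<beta> UNIV \<le> M}" by (auto simp: M_def)
      show "\<forall>\<beta>\<in>{\<beta>. sum \<beta> UNIV \<le> M} - {\<beta>. sum \<beta> UNIV \<le> q}. F \<beta> = 0"
        using mder_gt_degree[OF Q] by (auto simp: F_def)
    qed (rule finite_multi_indices_le)
    also have "\<dots> = ?S v"
      unfolding F_def p_def prod_taylor_powers sum_distrib_left
      by (intro sum.cong refl) (simp add: prod_dividef power_add prod.distrib mult_ac)
    finally show ?thesis .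
  qed
  have "(\<Sum>\<gamma>\<in>Delta M. ?l \<gamma> * (\<Prod>i\<in>UNIV. \<phi> i (\<gamma> i))) =
    (\<Sum>\<beta> | sum \<beta> UNIV \<le> q. \<Sum>\<alpha>\<in>I_set d q N \<beta>. \<Sum>u\<in>V_set d \<alpha>. ?c \<beta> \<alpha> u * (\<Prod>i\<in>UNIV. \<phi> i (g_index d u i + \<beta> i)))"
    unfolding sig using sum_monomials_umbral[OF finite_Delta[of M] fin, of "\<lambda>\<gamma>. ?l \<gamma>" "\<lambda>\<gamma>. \<gamma>"
        "\<lambda>(\<beta>, \<alpha>, u). ?c \<beta> \<alpha> u" "\<lambda>(\<beta>, \<alpha>, u) i. g_index d u i + \<beta> i" \<phi>] v[unfolded sig]
    by (simp add: case_prod_unfold)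
  then show ?thesis unfolding M_def .
qed

end

section \<open>Euler--Maclaurin summation on a half-line\<close>

text \<open>Changing B_1 from -1/2 to 1/2 adds X to the generating function, turning it into X e^X /
  (e^X - 1). The recursion reads off coefficients after multiplication by e^X - 1.\<close>

lemma bernoulli_tilde_rec:
  "(\<Sum>k\<le>K. bernoulli_tilde k / fact k / fact (Suc K - k)) = 1 / fact K"
proof -
  define E where "E = (fps_exp 1 - 1 :: real fps)"
  define G where "G = fps_X / E"
  \<comment> \<open>The division of \<open>fps_X\<close> by \<open>E\<close> is exact because
    \<open>E\<close> has no constant term but a nonzero linear one.\<close>
  have sub: "subdegree E = 1"
    by (rule subdegreeI) (auto simp: E_def)
  then have "E \<noteq> 0" by auto
  then have "E dvd fps_X"
    using sub by (subst fps_dvd_iff) auto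
  then have GE: "G * E = fps_X" by (simp add: G_def)
  have E_nth: "fps_nth E n = (if n = 0 then 0 else 1 / fact n)" for n by (simp add: E_def)
  have "fps_nth (G * E) 1 = fps_nth G 0" "fps_nth (G * E) 2 = fps_nth G 0 / 2 + fps_nth G 1"
    by (auto simp: fps_mult_nth E_nth numeral_2_eq_2)
  with GE have G01: "fps_nth G 0 = 1" "fps_nth G 1 = - 1 / 2" by auto
  have bt: "bernoulli_tilde k / fact k = fps_nth (G + fps_X) k" for k
    using G01 by (auto simp: bernoulli_tilde_def bernoulli_number_def G_def[unfolded E_def, symmetric])
  have "(\<Sum>k\<le>K. bernoulli_tilde k / fact k / fact (Suc K - k)) = (\<Sum>k=0..K. fps_nth (G + fps_X) k * fps_nth E (Suc K - k))"
    unfolding bt E_nth by (intro sum.cong) auto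
  also have "\<dots> = fps_nth ((G + fps_X) * E) (Suc K)"
    by (simp add: fps_mult_nth E_nth)
  also have "(G + fps_X) * E = fps_X * fps_exp 1"
    by (simp add: distrib_right GE) (simp add: E_def algebra_simps)
  also have "fps_nth \<dots> (Suc K) = 1 / fact K" by simp
  finally show ?thesis .
qed

abbreviation derivative_chain :: "(nat \<Rightarrow> real \<Rightarrow> real) \<Rightarrow> bool" where
  "derivative_chain f \<equiv> \<forall>k x. (f k has_real_derivative f (Suc k) x) (at x)"

text \<open>The usual boundary terms are kept in the form B_k h^k / k! times the integral of the
  k-th derivative, so k = 0 is the integral itself.\<close>

abbreviation em_sum :: "nat \<Rightarrow> real \<Rightarrow> (nat \<Rightarrow> real) \<Rightarrow> real" where
  "em_sum K h g \<equiv> \<Sum>k<K. bernoulli_tilde k / fact k * h ^ k * g k"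

lemma poly_antiderivative:
  fixes p :: "real poly"
  shows "\<exists>r. pderiv r = p"
proof
  have *: "pderiv (sum f A) = (\<Sum>a\<in>A. pderiv (f a))" for f :: "nat \<Rightarrow> real poly" and A
    by (induction A rule: infinite_finite_induct) (auto simp: pderiv_add)
  have "pderiv (\<Sum>k\<le>degree p. monom (coeff p k / real (Suc k)) (Suc k)) = (\<Sum>k\<le>degree p. monom (coeff p k) k)"
    by (simp add: * pderiv_monom del: of_nat_Suc)
  then show "pderiv (\<Sum>k\<le>degree p. monom (coeff p k / real (Suc k)) (Suc k)) = p"
    by (simp only: poly_as_sum_of_monoms)
qed

lemma has_integral_real_derivative:
  fixes F f :: "real \<Rightarrow> real"
  assumes "a \<le> b" and F: "\<And>x. (F has_real_derivative f x) (at x)"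
  shows "(f has_integral F b - F a) {a..b}"
  using assms(1) DERIV_subset[OF F]
  by (intro fundamental_theorem_of_calculus) (simp_all flip: has_real_derivative_iff_has_vector_derivative)

lemma has_real_derivative_divided_power:
  fixes x :: real
  shows "((\<lambda>x. x ^ Suc m / fact (Suc m)) has_real_derivative x ^ m / fact m) (at x)"
proof -
  have "((\<lambda>x. x ^ Suc m / fact (Suc m)) has_real_derivative (1 + real m) * x ^ m / fact (Suc m)) (at x)"
    by (intro DERIV_cdivide, rule DERIV_cong[OF DERIV_power_Suc[OF DERIV_ident]]) simp
  then show ?thesis by (simp add: fact_Suc)
qed

text \<open>Repeated integration by parts. The kernel \<open>p\<close> is a polynomial chosen before
  \<open>h\<close>, \<open>a\<close> and \<open>f\<close>, so it may be identified by testing the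
  formula on one convenient function.\<close>

lemma euler_maclaurin_cell_exact:
  assumes "K \<ge> 1"
  shows "\<exists>p :: real poly. \<forall>h>0. \<forall>a f. derivative_chain f \<longrightarrow>
    h * f 0 (a + h) = em_sum K h (\<lambda>k. integral {a..a+h} (f k)) +
      h ^ K * integral {a..a+h} (\<lambda>x. poly p ((x - a) / h) * f K x)"
  using assms
proof (induction K rule: nat_induct_at_least)
  case base
  show ?case
  \<comment> \<open>The kernel y comes from integrating the derivative of (x - a) f(x). It vanishes
    at the left end, so only the right endpoint value survives.\<close>
  proof (intro exI[of _ "[:0, 1:]"] allI impI)
    fix h a :: real and f :: "nat \<Rightarrow> real \<Rightarrow> real"
    assume h: "h > 0" and f: "derivative_chain f"
    have cont: "continuous_on A (f k)" for k A
      using f by (meson DERIV_isCont continuous_at_imp_continuous_on)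
    have "((\<lambda>x. f 0 x + (x - a) * f 1 x) has_integral (a + h - a) * f 0 (a + h) - (a - a) * f 0 a) {a..a+h}"
    proof (rule has_integral_real_derivative)
      fix x
      show "((\<lambda>x. (x - a) * f 0 x) has_real_derivative f 0 x + (x - a) * f 1 x) (at x)"
        using f[rule_format, of 0 x] by (auto intro!: derivative_eq_intros)
    qed (use h in auto)
    moreover have "(f 0 has_integral integral {a..a+h} (f 0)) {a..a+h}"
      by (intro integrable_integral integrable_continuous_interval cont)
    ultimately have "((\<lambda>x. (f 0 x + (x - a) * f 1 x) - f 0 x) has_integral
        ((a + h - a) * f 0 (a + h) - (a - a) * f 0 a) - integral {a..a+h} (f 0)) {a..a+h}"
      by (rule has_integral_diff)
    then have "((\<lambda>x. (x - a) * f 1 x) has_integral h * f 0 (a + h) - integral {a..a+h} (f 0)) {a..a+h}"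
      by simp
    then have "integral {a..a+h} (\<lambda>x. (x - a) * f 1 x) = h * f 0 (a + h) - integral {a..a+h} (f 0)"
      by (rule integral_unique)
    moreover have "h ^ 1 * integral {a..a+h} (\<lambda>x. poly [:0, 1:] ((x - a) / h) * f 1 x) = integral {a..a+h} (\<lambda>x. (x - a) * f 1 x)"
      using h by (subst integral_mult_right[symmetric]) simp
    moreover have "bernoulli_tilde 0 = 1" using bernoulli_tilde_rec[of 0] by simp
    ultimately show "h * f 0 (a + h) = em_sum 1 h (\<lambda>k. integral {a..a+h} (f k)) +
      h ^ 1 * integral {a..a+h} (\<lambda>x. poly [:0, 1:] ((x - a) / h) * f 1 x)" by simp
  qed
next
  case (Suc K)
  then obtain p :: "real poly" where "\<forall>h>0. \<forall>a f. derivative_chain f \<longrightarrow>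
    h * f 0 (a + h) = em_sum K h (\<lambda>k. integral {a..a+h} (f k)) +
      h ^ K * integral {a..a+h} (\<lambda>x. poly p ((x - a) / h) * f K x)"
    by (elim exE)
  note p = this[rule_format]
  obtain r0 where r0: "pderiv r0 = p" using poly_antiderivative by blast
  \<comment> \<open>\<open>b\<close> is the mean of \<open>p\<close> over [0, 1]. Subtracting it
    makes the primitive \<open>r\<close> of b - p vanish at both ends, so the next integration by
    parts has no boundary term.\<close>
  define b where "b = poly r0 1 - poly r0 0"
  define r where "r = [:poly r0 0, b:] - r0"
  have r: "pderiv r = [:b:] - p" "poly r 0 = 0" "poly r 1 = 0"
    by (auto simp: r_def b_def pderiv_diff r0 pderiv_pCons)
  have int_p: "integral {0..1} (poly p) = b"
    unfolding b_def
    by (intro integral_unique has_integral_real_derivative) (simp_all flip: r0)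
  \<comment> \<open>Test function x^K / K! with h = 1 and a = 0: its K-th derivative is 1, so the
    remainder is exactly \<open>b\<close> and the formula becomes the Bernoulli recursion.\<close>
  have "b = bernoulli_tilde K / fact K"
  proof -
    define f where "f = (\<lambda>j x :: real. if j \<le> K then x ^ (K - j) / fact (K - j) else 0)"
    have "(f j has_real_derivative f (Suc j) x) (at x)" for j x
    proof (cases "j < K")
      case True
      have "K - j = Suc (K - Suc j)" using True by auto
      then show ?thesis
        using True has_real_derivative_divided_power[of "K - Suc j" x] by (simp only: f_def) simp
    next
      case False
      then have "f j = (\<lambda>_. if j = K then 1 else 0)" "f (Suc j) x = 0" by (auto simp: f_def)
      then show ?thesis by simp
    qed
    then have "1 * f 0 (0 + 1) = (\<Sum>k<K. bernoulli_tilde k / fact k * 1 ^ k * integral {0..0+1} (f k)) +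
      1 ^ K * integral {0..0+1} (\<lambda>x. poly p ((x - 0) / 1) * f K x)" by (intro p) auto
    moreover have "integral {0..1} (f k) = 1 / fact (Suc K - k)" if "k < K" for k
    proof -
      have s: "Suc K - k = Suc (K - k)" using that by auto
      have "(f k has_integral 1 ^ (Suc K - k) / fact (Suc K - k) - 0 ^ (Suc K - k) / fact (Suc K - k)) {0..1}"
      proof (rule has_integral_real_derivative)
        fix x :: real
        show "((\<lambda>x. x ^ (Suc K - k) / fact (Suc K - k)) has_real_derivative f k x) (at x)"
          using that has_real_derivative_divided_power[of "K - k" x] by (simp only: f_def s) simp
      qed auto
      then show ?thesis using s by (simp add: integral_unique)
    qed
    then have "(\<Sum>k<K. bernoulli_tilde k / fact k * 1 ^ k * integral {0..0+1} (f k)) =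
      (\<Sum>k<K. bernoulli_tilde k / fact k / fact (Suc K - k))"
      by (intro sum.cong) auto
    moreover have "f 0 (0 + 1) = 1 / fact K" "f K = (\<lambda>_. 1)" by (auto simp: f_def)
    ultimately have "1 / fact K = (\<Sum>k<K. bernoulli_tilde k / fact k / fact (Suc K - k)) + b"
      using int_p by simp
    then show ?thesis using bernoulli_tilde_rec[of K] by (simp add: lessThan_Suc_atMost[symmetric])
  qed
  note b = this
  show ?case
  proof (intro exI[of _ r] allI impI)
    fix h a :: real and f :: "nat \<Rightarrow> real \<Rightarrow> real"
    assume h: "h > 0" and f: "derivative_chain f"
    let ?P = "integral {a..a+h} (\<lambda>x. poly p ((x - a) / h) * f K x)" and ?R = "integral {a..a+h} (\<lambda>x. poly r ((x - a) / h) * f (Suc K) x)"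
    let ?D = "\<lambda>x. (b - poly p ((x - a) / h)) * f K x / h + poly r ((x - a) / h) * f (Suc K) x"
    have cont: "continuous_on A (f k)" for k A
      using f by (meson DERIV_isCont continuous_at_imp_continuous_on)
    have contp: "continuous_on A (\<lambda>x. poly s ((x - a) / h))" for s A
      using h by (intro continuous_intros) auto
    have "(?D has_integral
      poly r ((a + h - a) / h) * f K (a + h) - poly r ((a - a) / h) * f K a) {a..a+h}"
    proof (rule has_integral_real_derivative)
      fix x
      have "((\<lambda>x. poly r ((x - a) / h)) has_real_derivative poly (pderiv r) ((x - a) / h) * (1 / h)) (at x)"
        by (rule DERIV_chain2[OF poly_DERIV]) (use h in \<open>auto intro!: derivative_eq_intros\<close>)
      then show "((\<lambda>x. poly r ((x - a) / h) * f K x) has_real_derivative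
        ?D x) (at x)"
        using f[rule_format, of K x] h by (auto intro!: derivative_eq_intros simp: r(1) field_simps)
    qed (use h in auto)
    then have "(?D has_integral 0) {a..a+h}"
      using h r by simp
    moreover have "(?D has_integral
       (b * integral {a..a+h} (f K) - ?P) / h +
       ?R) {a..a+h}"
      unfolding left_diff_distrib
      by (intro has_integral_add has_integral_divide has_integral_diff has_integral_mult_right integrable_integral
          integrable_continuous_interval continuous_intros cont contp)
    ultimately have "(b * integral {a..a+h} (f K) - ?P) / h +
       ?R = 0"
      using has_integral_unique by blast
    then have "?P =
      b * integral {a..a+h} (f K) + h * ?R"
      using h by (simp add: field_simps)
    then show "h * f 0 (a + h) = em_sum (Suc K) h (\<lambda>k. integral {a..a+h} (f k)) +
      h ^ Suc K * ?R"
      using p[OF h, of f a, OF f[rule_format]] b by (simp add: algebra_simps)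
  qed
qed

text \<open>Only the boundedness of the kernel on [0, 1] is retained; the constant depends on
  \<open>K\<close> alone and is thus shared by all cells.\<close>

lemma euler_maclaurin_cell:
  assumes "K \<ge> 1"
  shows "\<exists>A\<ge>0. \<forall>h>0. \<forall>a f. derivative_chain f \<longrightarrow>
    \<bar>h * f 0 (a + h) - em_sum K h (\<lambda>k. integral {a..a+h} (f k))\<bar> \<le>
      A * h ^ K * integral {a..a+h} (\<lambda>x. \<bar>f K x\<bar>)"
proof -
  obtain p :: "real poly" where "\<forall>h>0. \<forall>a f. derivative_chain f \<longrightarrow>
    h * f 0 (a + h) = em_sum K h (\<lambda>k. integral {a..a+h} (f k)) +
      h ^ K * integral {a..a+h} (\<lambda>x. poly p ((x - a) / h) * f K x)"
    using euler_maclaurin_cell_exact[OF assms] by (elim exE)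
  note p = this[rule_format]
  have "compact (poly p ` {0..1})" by (intro compact_continuous_image continuous_intros) auto
  then obtain A where A: "\<And>y. y \<in> {0..1} \<Longrightarrow> \<bar>poly p y\<bar> \<le> A"
    by (metis bounded_iff compact_imp_bounded image_eqI real_norm_def)
  show ?thesis
  proof (intro exI[of _ A] conjI allI impI)
    show "A \<ge> 0" using A[of 0] by auto
    fix h a :: real and f :: "nat \<Rightarrow> real \<Rightarrow> real"
    assume h: "h > 0" and f: "derivative_chain f"
    have cont: "continuous_on A (f k)" for k A
      using f by (meson DERIV_isCont continuous_at_imp_continuous_on)
    have contp: "continuous_on A (\<lambda>x. poly s ((x - a) / h))" for s A
      using h by (intro continuous_intros) auto
    have "norm (integral {a..a+h} (\<lambda>x. poly p ((x - a) / h) * f K x)) \<le> integral {a..a+h} (\<lambda>x. A * \<bar>f K x\<bar>)"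
    proof (rule integral_norm_bound_integral)
      fix x assume "x \<in> {a..a+h}"
      then have "(x - a) / h \<in> {0..1}" using h by auto
      from A[OF this] show "norm (poly p ((x - a) / h) * f K x) \<le> A * \<bar>f K x\<bar>"
        by (simp add: abs_mult mult_right_mono)
    qed (intro integrable_continuous_interval continuous_intros cont contp)+
    then have "h ^ K * \<bar>integral {a..a+h} (\<lambda>x. poly p ((x - a) / h) * f K x)\<bar> \<le> h ^ K * (A * integral {a..a+h} (\<lambda>x. \<bar>f K x\<bar>))"
      using h by (intro mult_left_mono) auto
    then show "\<bar>h * f 0 (a + h) - em_sum K h (\<lambda>k. integral {a..a+h} (f k))\<bar> \<le>
      A * h ^ K * integral {a..a+h} (\<lambda>x. \<bar>f K x\<bar>)"
      using p[OF h, of f a, OF f[rule_format]] h by (simp add: abs_mult mult_ac)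
  qed
qed

definition grid :: "real \<Rightarrow> real set" where
  "grid h = range (\<lambda>m. h * real (Suc m))"

lemma bij_betw_grid: "h > 0 \<Longrightarrow> bij_betw (\<lambda>m. h * real (Suc m)) UNIV (grid h)"
  by (auto simp: bij_betw_def grid_def inj_on_def)

lemma sums_integral_cells:
  fixes g :: "real \<Rightarrow> real"
  assumes h: "h > 0" and g: "set_integrable lborel {0..} g"
  shows "(\<lambda>m. integral {h * real m..h * real m + h} g) sums (LINT x:{0..}|lborel. g x)"
proof -
  have g': "set_integrable lborel {0..b} g" for b
    by (rule set_integrable_subset[OF g]) auto
  have int: "g integrable_on {a..b}" if "a \<ge> 0" for a b
    by (rule set_borel_integral_eq_integral, rule set_integrable_subset[OF g]) (use that in auto)
  have "(\<Sum>m<n. integral {h * real m..h * real m + h} g) = integral {0..h * real n} g" for n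
  proof (induction n)
    case (Suc n)
    have "integral {0..h * real n} g + integral {h * real n..h * real n + h} g = integral {0..h * real n + h} g"
      using h by (intro Henstock_Kurzweil_Integration.integral_combine int) auto
    then show ?case using Suc by (simp add: algebra_simps)
  qed simp
  also have "integral {0..h * real n} g = (LINT x:{0..h * real n}|lborel. g x)" for n
    using set_borel_integral_eq_integral(2)[OF g'] by simp
  finally have eq: "(\<lambda>n. \<Sum>m<n. integral {h * real m..h * real m + h} g) = (\<lambda>n. LINT x:{0..h * real n}|lborel. g x)" by simp
  have "((\<lambda>b. LINT x:{0..b}|lborel. g x) \<longlongrightarrow> (LINT x:{0..}|lborel. g x)) at_top"
    by (rule tendsto_set_lebesgue_integral_at_top) (use g in auto)
  moreover have "filterlim (\<lambda>n. h * real n) at_top sequentially"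
    using h by (intro filterlim_tendsto_pos_mult_at_top[OF tendsto_const] filterlim_real_sequentially) auto
  ultimately show ?thesis unfolding sums_def eq by (rule filterlim_compose)
qed

text \<open>The right endpoints of the cells covering the half-line are exactly the points of
  \<open>grid h\<close>. The constant is independent of \<open>h\<close> and \<open>f\<close>, which
  later permits integrating the estimate over the remaining coordinates.\<close>

lemma euler_maclaurin_halfline:
  assumes "K \<ge> 1"
  shows "\<exists>A\<ge>0. \<forall>h>0. \<forall>f. derivative_chain f \<longrightarrow>
    (\<forall>k. set_integrable lborel {0..} (f k)) \<longrightarrow> integrable (count_space (grid h)) (f 0) \<longrightarrow>
    \<bar>h * integral\<^sup>L (count_space (grid h)) (f 0) - em_sum K h (\<lambda>k. (LINT x:{0..}|lborel. f k x))\<bar> \<le>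
      A * h ^ K * (LINT x:{0..}|lborel. \<bar>f K x\<bar>)"
proof -
  obtain A where "A \<ge> 0" and "\<forall>h>0. \<forall>a f. derivative_chain f \<longrightarrow>
    \<bar>h * f 0 (a + h) - em_sum K h (\<lambda>k. integral {a..a+h} (f k))\<bar> \<le>
      A * h ^ K * integral {a..a+h} (\<lambda>x. \<bar>f K x\<bar>)"
    using euler_maclaurin_cell[OF assms] by (elim exE conjE)
  note A = \<open>A \<ge> 0\<close> this(2)[rule_format]
  show ?thesis
  proof (intro exI[of _ A] conjI allI impI A)
    fix h and f :: "nat \<Rightarrow> real \<Rightarrow> real"
    assume h: "h > 0" and f: "derivative_chain f"
      and int: "\<forall>k. set_integrable lborel {0..} (f k)" and cnt: "integrable (count_space (grid h)) (f 0)"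
    let ?c = "\<lambda>m. {h * real m..h * real m + h}"
    let ?e = "\<lambda>m. h * f 0 (h * real m + h) - em_sum K h (\<lambda>k. integral (?c m) (f k))"
    let ?s = "h * integral\<^sup>L (count_space (grid h)) (f 0) - em_sum K h (\<lambda>k. (LINT x:{0..}|lborel. f k x))"
    let ?b = "\<lambda>m. A * h ^ K * integral (?c m) (\<lambda>x. \<bar>f K x\<bar>)"
    have "(\<lambda>m. f 0 (h * real (Suc m))) sums integral\<^sup>L (count_space UNIV) (\<lambda>m. f 0 (h * real (Suc m)))"
      by (rule sums_integral_count_space_nat) (use integrable_bij_count_space[OF bij_betw_grid[OF h], of "f 0"] cnt in simp)
    also have "integral\<^sup>L (count_space UNIV) (\<lambda>m. f 0 (h * real (Suc m))) = integral\<^sup>L (count_space (grid h)) (f 0)"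
      by (rule integral_bij_count_space[OF bij_betw_grid[OF h]])
    finally have "(\<lambda>m. f 0 (h * real m + h)) sums integral\<^sup>L (count_space (grid h)) (f 0)"
      by (simp add: algebra_simps)
    then have e: "?e sums ?s"
      by (intro sums_diff sums_mult sums_sum sums_integral_cells h int[rule_format])
    have "set_integrable lborel {0..} (\<lambda>x. \<bar>f K x\<bar>)"
      using int by (intro set_integrable_abs) auto
    then have b: "?b sums (A * h ^ K * (LINT x:{0..}|lborel. \<bar>f K x\<bar>))"
      by (intro sums_mult sums_integral_cells h)
    have le: "\<bar>?e m\<bar> \<le> ?b m" for m
      using A(2)[OF h, of f "h * real m", OF f[rule_format]] by simp
    have "?s \<le> A * h ^ K * (LINT x:{0..}|lborel. \<bar>f K x\<bar>)"
      using sums_le[OF _ e b] le by (simp add: abs_le_iff)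
    moreover have "- ?s \<le> A * h ^ K * (LINT x:{0..}|lborel. \<bar>f K x\<bar>)"
      using sums_le[OF _ sums_minus[OF e] b] le by (simp add: abs_le_iff)
    ultimately show "\<bar>?s\<bar> \<le> A * h ^ K * (LINT x:{0..}|lborel. \<bar>f K x\<bar>)" by linarith
  qed
qed

section \<open>Euler--Maclaurin summation on an orthant\<close>

lemma power_le_exp:
  fixes x e :: real
  assumes "x \<ge> 0" "e > 0"
  shows "x ^ k \<le> fact k / e ^ k * exp (e * x)"
proof -
  have "(e * x) ^ k /\<^sub>R fact k \<le> exp (e * x)"
    unfolding exp_def
    using sum_le_suminf[OF summable_exp_generic[of "e * x"], of "{k}"] assms by auto
  then show ?thesis using assms by (simp add: field_simps)
qed

text \<open>The integrability half of Fubini's theorem, needed to integrate one-coordinate estimates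
  over the other coordinates.\<close>

lemma (in product_sigma_finite) integrable_product_inner_integral:
  fixes f :: "_ \<Rightarrow> real"
  assumes I: "finite I" "i \<notin> I" and f: "integrable (Pi\<^sub>M (insert i I) M) f"
  shows "integrable (Pi\<^sub>M I M) (\<lambda>x. \<integral>y. f (x(i := y)) \<partial>M i)"
proof (rule integrableI_bounded)
  have [measurable]: "f \<in> borel_measurable (Pi\<^sub>M (insert i I) M)" using f by auto
  interpret sigma_finite_measure "M i" by (rule sigma_finite_measures)
  have [measurable]: "(\<lambda>z. f ((fst z)(i := snd z))) \<in> borel_measurable (Pi\<^sub>M I M \<Otimes>\<^sub>M M i)"
    using measurable_compose[OF measurable_add_dim[of i I M] \<open>f \<in> borel_measurable _\<close>]
    by (simp add: case_prod_unfold)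
  show "(\<lambda>x. \<integral>y. f (x(i := y)) \<partial>M i) \<in> borel_measurable (Pi\<^sub>M I M)"
    by (rule borel_measurable_lebesgue_integral) (simp add: case_prod_unfold)
  have "(\<integral>\<^sup>+x. ennreal (norm (\<integral>y. f (x(i := y)) \<partial>M i)) \<partial>Pi\<^sub>M I M) \<le> (\<integral>\<^sup>+x. (\<integral>\<^sup>+y. norm (f (x(i := y))) \<partial>M i) \<partial>Pi\<^sub>M I M)"
  proof (rule nn_integral_mono)
    fix x
    show "ennreal (norm (\<integral>y. f (x(i := y)) \<partial>M i)) \<le> (\<integral>\<^sup>+y. norm (f (x(i := y))) \<partial>M i)"
    \<comment> \<open>On lines where \<open>f\<close> is not integrable the Bochner integral is 0 by
      convention, so the bound is trivial there.\<close>
    proof (cases "integrable (M i) (\<lambda>y. f (x(i := y)))")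
      case True
      from integral_norm_bound_ennreal[OF this] show ?thesis .
    qed (simp add: not_integrable_integral_eq)
  qed
  also have "\<dots> = (\<integral>\<^sup>+x. norm (f x) \<partial>Pi\<^sub>M (insert i I) M)"
    by (rule product_nn_integral_insert[symmetric, OF I]) simp
  also have "\<dots> < \<infinity>" using f by (simp add: integrable_iff_bounded)
  finally show "(\<integral>\<^sup>+x. ennreal (norm (\<integral>y. f (x(i := y)) \<partial>M i)) \<partial>Pi\<^sub>M I M) < \<infinity>" .
qed

section \<open>Polynomial times exponential on mixed grid and half-line measures\<close>

definition exp_weight :: "'n::finite mpoly \<Rightarrow> 'n mpoly \<Rightarrow> ('n \<Rightarrow> real) \<Rightarrow> real" where
  "exp_weight P S x = mp_fun S x * exp (- mp_fun P x)"

lemma has_real_derivative_exp_weight: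
  "((\<lambda>y. exp_weight P S (x(i := y))) has_real_derivative exp_weight P (exp_pderiv P i S) (x(i := y))) (at y)"
  unfolding exp_weight_def exp_pderiv_def
  by (auto intro!: derivative_eq_intros has_field_derivative_mp_fun simp: mp_fun_diff mp_fun_mult algebra_simps)

text \<open>A density rather than a restriction, so that the space remains all of the reals and
  products combine directly with those of \<open>borel\<close> and \<open>lborel\<close>.\<close>

definition half_lborel :: "real measure" where
  "half_lborel = density lborel (\<lambda>x. ennreal (indicat_real {0..} x))"

lemma sets_half_lborel [measurable_cong, simp]: "sets half_lborel = sets borel"
  by (simp add: half_lborel_def)

lemma space_half_lborel [simp]: "space half_lborel = UNIV"
  by (simp add: half_lborel_def)

lemma integral_half_lborel:
  fixes f :: "real \<Rightarrow> real"
  assumes "f \<in> borel_measurable borel"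
  shows "integral\<^sup>L half_lborel f = (LINT x:{0..}|lborel. f x)"
  unfolding half_lborel_def set_lebesgue_integral_def
  by (subst integral_density) (use assms in auto)

lemma integrable_half_lborel:
  fixes f :: "real \<Rightarrow> real"
  assumes "f \<in> borel_measurable borel"
  shows "integrable half_lborel f \<longleftrightarrow> set_integrable lborel {0..} f"
  unfolding half_lborel_def set_integrable_def
  by (subst integrable_density) (use assms in auto)

lemma nn_integral_half_lborel:
  assumes "f \<in> borel_measurable borel"
  shows "integral\<^sup>N half_lborel f = (\<integral>\<^sup>+x. f x * indicator {0..} x \<partial>lborel)"
  unfolding half_lborel_def
  by (subst nn_integral_density) (use assms in \<open>auto simp: ennreal_indicator mult.commute\<close>)

lemma sigma_finite_half_lborel: "sigma_finite_measure half_lborel"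
  unfolding half_lborel_def by (subst sigma_finite_measure.sigma_finite_iff_density_finite[OF sigma_finite_lborel]) auto

lemma exp_half_lborel:
  assumes "e > 0"
  shows "integrable half_lborel (\<lambda>x. exp (- e * \<bar>x\<bar>))"
proof (rule integrableI_bounded)
  have "((\<lambda>x. - exp (- e * x) / e) \<longlongrightarrow> - 0 / e) at_top"
    using assms
    by (intro tendsto_intros filterlim_compose[OF exp_at_bot] filterlim_tendsto_neg_mult_at_bot[OF tendsto_const] filterlim_ident) auto
  then have "(\<integral>\<^sup>+x. ennreal (exp (- e * x)) * indicator {0..} x \<partial>lborel) = ennreal (0 - (- exp (- e * 0) / e))"
    using assms by (intro nn_integral_FTC_atLeast) (auto intro!: derivative_eq_intros)
  also have "(\<integral>\<^sup>+x. ennreal (exp (- e * x)) * indicator {0..} x \<partial>lborel) = (\<integral>\<^sup>+x. ennreal (norm (exp (- e * \<bar>x\<bar>))) \<partial>half_lborel)"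
    by (subst nn_integral_half_lborel) (auto intro!: nn_integral_cong split: split_indicator)
  finally show "(\<integral>\<^sup>+x. ennreal (norm (exp (- e * \<bar>x\<bar>))) \<partial>half_lborel) < \<infinity>" by simp
qed simp

text \<open>A geometric series, bounded through 1 + x \<le> e^x. The bound grows exactly like 1/h,
  which one factor \<open>h\<close> per grid coordinate compensates.\<close>

lemma exp_grid:
  assumes "e > 0" "h > 0"
  shows "integrable (count_space (grid h)) (\<lambda>x. exp (- e * \<bar>x\<bar>))"
    and "integral\<^sup>L (count_space (grid h)) (\<lambda>x. exp (- e * \<bar>x\<bar>)) \<le> 1 / (e * h)"
proof -
  let ?r = "exp (- e * h)"
  let ?w = "\<lambda>x. exp (- e * \<bar>x\<bar>)"
  have eq: "exp (- e * \<bar>h * real (Suc m)\<bar>) = ?r * ?r ^ m" for m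
    using assms by (simp add: abs_mult algebra_simps flip: exp_of_nat_mult exp_add)
  have r: "norm ?r < 1" using assms by simp
  then have int: "integrable (count_space UNIV) (\<lambda>m. exp (- e * \<bar>h * real (Suc m)\<bar>))"
    unfolding eq integrable_count_space_nat_iff by (simp add: norm_mult norm_power summable_mult summable_geometric)
  then show "integrable (count_space (grid h)) ?w"
    using integrable_bij_count_space[OF bij_betw_grid[OF assms(2)], of "\<lambda>x. exp (- e * \<bar>x\<bar>)"] by simp
  have "integral\<^sup>L (count_space (grid h)) ?w = suminf (\<lambda>m. ?r * ?r ^ m)"
    using integral_bij_count_space[OF bij_betw_grid[OF assms(2)], of "\<lambda>x. exp (- e * \<bar>x\<bar>)"]
      integral_count_space_nat[OF int] unfolding eq by simp
  also have "\<dots> = ?r * (1 / (1 - ?r))"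
    using r by (simp only: suminf_mult[OF summable_geometric[OF r]] suminf_geometric[OF r])
  also have "\<dots> = 1 / (exp (e * h) - 1)"
    using assms by (simp add: exp_minus divide_simps)
  also have "\<dots> \<le> 1 / (e * h)"
    using assms exp_ge_add_one_self[of "e * h"] by (intro divide_left_mono mult_pos_pos) (auto simp: algebra_simps)
  finally show "integral\<^sup>L (count_space (grid h)) ?w \<le> 1 / (e * h)" .
qed

text \<open>The grid sums are turned into integrals one coordinate at a time; \<open>J\<close> holds the coordinates done.\<close>

definition mixed :: "real \<Rightarrow> 'n set \<Rightarrow> 'n \<Rightarrow> real measure" where
  "mixed h J i = (if i \<in> J then half_lborel else count_space (grid h))"

lemma product_sigma_finite_mixed: "product_sigma_finite (mixed h J)"
proof (rule product_sigma_finite.intro)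
  fix i
  have "countable (grid h)" by (simp add: grid_def)
  then show "sigma_finite_measure (mixed h J i)"
    using sigma_finite_half_lborel sigma_finite_measure_count_space_countable
    by (auto simp: mixed_def)
qed

lemma measurable_mp_fun:
  fixes M :: "'n::finite \<Rightarrow> real measure"
  assumes "\<And>i. (\<lambda>x. x) \<in> borel_measurable (M i)"
  shows "mp_fun S \<in> borel_measurable (Pi\<^sub>M UNIV M)"
proof -
  have [measurable]: "(\<lambda>x. x i) \<in> borel_measurable (Pi\<^sub>M UNIV M)" for i
  proof -
    have "(\<lambda>x. x i) \<in> Pi\<^sub>M UNIV M \<rightarrow>\<^sub>M M i" by (rule measurable_component_singleton) simp
    from measurable_compose[OF this assms[of i]] show ?thesis .
  qed
  have "mp_fun S = (\<lambda>x. \<Sum>m\<in>Poly_Mapping.keys S. Poly_Mapping.lookup S m * (\<Prod>i\<in>UNIV. x i ^ Poly_Mapping.lookup m i))"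
    by (simp add: fun_eq_iff mp_fun_def mpoly_eval_def)
  then show ?thesis by simp
qed

lemma measurable_exp_weight:
  fixes M :: "'n::finite \<Rightarrow> real measure"
  assumes "\<And>i. (\<lambda>x. x) \<in> borel_measurable (M i)"
  shows "exp_weight P S \<in> borel_measurable (Pi\<^sub>M UNIV M)"
proof -
  note [measurable] = measurable_mp_fun[OF assms]
  show ?thesis unfolding exp_weight_def[abs_def] by simp
qed

lemma measurable_id_mixed: "(\<lambda>x. x) \<in> borel_measurable (mixed h J i)"
  by (auto simp: mixed_def intro: measurable_ident_sets)

section \<open>Decay estimates and summation for a positive form\<close>

context
  fixes P :: "'n::finite mpoly" and d :: nat
  assumes P: "homogeneous d P" "d \<ge> 1" and pos: "\<And>x :: real ^ 'n. x \<noteq> 0 \<Longrightarrow> mpoly_eval P x > 0"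
begin

text \<open>With c the minimum of \<open>P\<close> on the unit sphere, homogeneity gives P(x) \<ge>
  c r^d for r = |x|. Since d \<ge> 1, r^d \<ge> r - 1 for every r \<ge> 0, and r dominates the
  1-norm divided by n. A linear bound suffices and factorizes over coordinates after
  exponentiation.\<close>

lemma positive_form_lower_bound:
  "\<exists>c>0. \<exists>C. \<forall>x. c * (\<Sum>i\<in>UNIV. \<bar>x i\<bar>) - C \<le> mp_fun P x"
proof -
  have "\<exists>z\<in>sphere 0 1. \<forall>y\<in>sphere 0 1. mpoly_eval P z \<le> mpoly_eval P (y :: real ^ 'n)"
  proof (rule continuous_attains_inf)
    have "axis undefined 1 \<in> sphere (0 :: real ^ 'n) 1" by (simp add: norm_eq_sqrt_inner inner_axis_axis)
    then show "sphere 0 1 \<noteq> ({} :: (real ^ 'n) set)" by blast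
    show "continuous_on (sphere 0 1) (mpoly_eval P :: real ^ 'n \<Rightarrow> real)"
      unfolding mpoly_eval_eq_mp_fun[abs_def] by (intro continuous_on_mp_fun continuous_intros)
  qed auto
  then obtain z :: "real ^ 'n" where z: "norm z = 1" "\<And>y. norm y = 1 \<Longrightarrow> mpoly_eval P z \<le> mpoly_eval P y" by auto
  define c where "c = mpoly_eval P z"
  have c: "c > 0" unfolding c_def using z by (intro pos) auto
  let ?s = "\<lambda>x :: 'n \<Rightarrow> real. \<Sum>i\<in>UNIV. \<bar>x i\<bar>"
  have "c / CARD('n) * ?s x - c \<le> mp_fun P x" for x
  proof -
    define X :: "real ^ 'n" where "X = (\<chi> i. x i)"
    define r where "r = norm X"
    have "?s x \<le> (\<Sum>i\<in>(UNIV :: 'n set). r)"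
      using component_le_norm_cart[of X] by (intro sum_mono) (simp add: X_def r_def)
    then have "c / CARD('n) * ?s x \<le> c / CARD('n) * (CARD('n) * r)"
      using c by (intro mult_left_mono) auto
    then have 1: "c / CARD('n) * ?s x - c \<le> c * (r - 1)" by (simp add: algebra_simps)
    have "r - 1 \<le> r ^ d"
      using self_le_power[of r d] P(2) zero_le_power[of r d]
      by (cases "r \<ge> 1") (auto simp: r_def not_le intro: order.trans[of _ 0])
    then have 2: "c * (r - 1) \<le> c * r ^ d"
      using c by (intro mult_left_mono) auto
    have 3: "c * r ^ d \<le> mp_fun P x"
    proof (cases "X = 0")
      case True
      have "mp_fun P x = mp_fun P (\<lambda>i. 0 * x i)"
        using True by (intro arg_cong[where f = "mp_fun P"]) (auto simp: X_def vec_eq_iff)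
      also have "\<dots> = 0" unfolding homogeneous_scale[OF P(1)] using P(2) by (simp add: power_0_left)
      finally show ?thesis using True P(2) by (simp add: r_def power_0_left)
    next
      case False
      then have "r > 0" by (simp add: r_def)
      have "c \<le> mpoly_eval P ((1 / r) *\<^sub>R X)" unfolding c_def by (rule z(2)) (use \<open>r > 0\<close> in \<open>simp add: r_def\<close>)
      then have "c * r ^ d \<le> mpoly_eval P ((1 / r) *\<^sub>R X) * r ^ d"
        using \<open>r > 0\<close> by (intro mult_right_mono) auto
      also have "mpoly_eval P ((1 / r) *\<^sub>R X) = mp_fun P (\<lambda>i. x i / r)"
        by (simp add: mpoly_eval_eq_mp_fun X_def field_simps)
      also have "\<dots> * r ^ d = mp_fun P (\<lambda>i. r * (x i / r))"
        unfolding homogeneous_scale[OF P(1)] by (rule mult.commute)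
      also have "\<dots> = mp_fun P x" using \<open>r > 0\<close> by simp
      finally show ?thesis .
    qed
    from 1 2 3 show ?thesis by linarith
  qed
  moreover have "c / CARD('n) > 0" using c by simp
  ultimately show ?thesis by blast
qed

text \<open>Half of the exponential decay absorbs the polynomial factor and the other half remains,
  whence \<open>e = c / 2\<close>. The rate does not depend on \<open>S\<close>, so all derivatives
  share one majorant up to a constant.\<close>

lemma exp_weight_bound:
  "\<exists>e>0. \<forall>S. \<exists>C\<ge>0. \<forall>x. \<bar>exp_weight P S x\<bar> \<le> C * (\<Prod>i\<in>UNIV. exp (- e * \<bar>x i\<bar>))"
proof -
  obtain c C where c: "c > 0" and C: "\<And>x. c * (\<Sum>i\<in>UNIV. \<bar>x i\<bar>) - C \<le> mp_fun P x"
    using positive_form_lower_bound by blast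
  define e where "e = c / 2"
  have e: "e > 0" using c by (simp add: e_def)
  let ?W = "\<lambda>x. \<Prod>i\<in>UNIV. exp (- e * \<bar>x i\<bar>)" and ?s = "\<lambda>x. \<Sum>i\<in>UNIV. \<bar>x i\<bar>"
  have "\<exists>C\<ge>0. \<forall>x. \<bar>exp_weight P S x\<bar> \<le> C * ?W x" for S
  proof (induction S rule: mpoly_induct)
    case (single m a)
    define B where "B = (\<Prod>i\<in>UNIV. fact (Poly_Mapping.lookup m i) / e ^ Poly_Mapping.lookup m i)"
    have "B \<ge> 0" using e by (auto simp: B_def intro!: prod_nonneg)
    have "\<bar>exp_weight P (Poly_Mapping.single m a) x\<bar> \<le> (\<bar>a\<bar> * B * exp C) * ?W x" for x
    proof -
      have "(\<Prod>i\<in>UNIV. \<bar>x i\<bar> ^ Poly_Mapping.lookup m i) \<le>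
        (\<Prod>i\<in>UNIV. fact (Poly_Mapping.lookup m i) / e ^ Poly_Mapping.lookup m i * exp (e * \<bar>x i\<bar>))"
        by (intro prod_mono conjI power_le_exp e) auto
      also have "\<dots> = B * exp (e * ?s x)"
        by (simp only: prod.distrib B_def exp_sum[OF finite] sum_distrib_left)
      finally have 1: "(\<Prod>i\<in>UNIV. \<bar>x i\<bar> ^ Poly_Mapping.lookup m i) \<le> B * exp (e * ?s x)" .
      have 2: "exp (- mp_fun P x) \<le> exp C * exp (- c * ?s x)"
        using C[of x] by (simp flip: exp_add)
      have "\<bar>exp_weight P (Poly_Mapping.single m a) x\<bar> = \<bar>a\<bar> * ((\<Prod>i\<in>UNIV. \<bar>x i\<bar> ^ Poly_Mapping.lookup m i) * exp (- mp_fun P x))"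
        by (simp add: exp_weight_def mp_fun_single abs_mult abs_prod power_abs)
      also have "\<dots> \<le> \<bar>a\<bar> * ((B * exp (e * ?s x)) * (exp C * exp (- c * ?s x)))"
        using 1 2 \<open>B \<ge> 0\<close> by (intro mult_left_mono mult_mono) auto
      also have "\<dots> = (\<bar>a\<bar> * B * exp C) * (exp (e * ?s x) * exp (- c * ?s x))"
        by (simp only: mult_ac)
      also have "exp (e * ?s x) * exp (- c * ?s x) = exp (\<Sum>i\<in>UNIV. - e * \<bar>x i\<bar>)"
        by (simp add: e_def field_simps sum_negf flip: exp_add sum_distrib_left sum_divide_distrib)
      also have "\<dots> = ?W x" by (rule exp_sum) simp
      finally show ?thesis .
    qed
    moreover have "\<bar>a\<bar> * B * exp C \<ge> 0" using \<open>B \<ge> 0\<close> by simp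
    ultimately show ?case by blast
  next
    case (add S T)
    then obtain A B where A: "A \<ge> 0" "\<And>x. \<bar>exp_weight P S x\<bar> \<le> A * ?W x"
      and B: "B \<ge> 0" "\<And>x. \<bar>exp_weight P T x\<bar> \<le> B * ?W x" by blast
    show ?case
    proof (intro exI[of _ "A + B"] conjI allI)
      fix x
      have "exp_weight P (S + T) x = exp_weight P S x + exp_weight P T x"
        by (simp add: exp_weight_def mp_fun_add algebra_simps)
      then show "\<bar>exp_weight P (S + T) x\<bar> \<le> (A + B) * ?W x"
        using A(2)[of x] B(2)[of x] by (simp add: distrib_right)
    qed (use A B in auto)
  qed
  with e show ?thesis by blast
qed

lemma integrable_exp_weight_mixed:
  assumes h: "h > 0"
  shows "integrable (Pi\<^sub>M UNIV (mixed h J)) (exp_weight P S)"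
proof -
  obtain e C where e: "e > 0" and C: "\<And>x. \<bar>exp_weight P S x\<bar> \<le> C * (\<Prod>i\<in>UNIV. exp (- e * \<bar>x i\<bar>))"
    using exp_weight_bound by metis
  interpret product_sigma_finite "mixed h J :: 'n \<Rightarrow> real measure" by (rule product_sigma_finite_mixed)
  have "integrable (Pi\<^sub>M UNIV (mixed h J)) (\<lambda>x. C * (\<Prod>i\<in>UNIV. exp (- e * \<bar>x i\<bar>)))"
    by (intro integrable_mult_right product_integrable_prod)
       (use e h exp_half_lborel exp_grid in \<open>auto simp: mixed_def\<close>)
  then show ?thesis
    by (rule Bochner_Integration.integrable_bound)
       (use order.trans[OF C abs_ge_self] measurable_exp_weight[OF measurable_id_mixed] in \<open>simp_all del: mult_minus_left\<close>)
qed

text \<open>The majorant is a product: a half-line coordinate contributes at most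
  \<open>\<kappa>\<close> and a grid coordinate at most \<open>\<kappa> / h\<close>. The power of
  \<open>h\<close> cancels the latter, making the bound uniform in \<open>h\<close> and
  \<open>J\<close>.\<close>

lemma integral_exp_weight_mixed_bound:
  "\<exists>C\<ge>0. \<forall>h J. 0 < h \<longrightarrow> h \<le> 1 \<longrightarrow> h ^ card (- J) * (\<integral>x. \<bar>exp_weight P S x\<bar> \<partial>Pi\<^sub>M UNIV (mixed h J)) \<le> C"
proof -
  obtain e C where e: "e > 0" and C0: "C \<ge> 0" and C: "\<And>x. \<bar>exp_weight P S x\<bar> \<le> C * (\<Prod>i\<in>UNIV. exp (- e * \<bar>x i\<bar>))"
    using exp_weight_bound by metis
  define \<kappa> where "\<kappa> = max (1 / e) (integral\<^sup>L half_lborel (\<lambda>x. exp (- e * \<bar>x\<bar>)))"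
  have k: "\<kappa> > 0" using e by (auto simp: \<kappa>_def less_max_iff_disj)
  show ?thesis
  proof (intro exI[of _ "C * \<kappa> ^ CARD('n)"] conjI allI impI)
    show "C * \<kappa> ^ CARD('n) \<ge> 0" using C0 k by simp
    fix h :: real and J :: "'n set" assume h: "0 < h" "h \<le> 1"
    let ?I = "\<integral>x. \<bar>exp_weight P S x\<bar> \<partial>Pi\<^sub>M UNIV (mixed h J)"
    let ?w = "\<lambda>x. exp (- e * \<bar>x\<bar>)"
    interpret product_sigma_finite "mixed h J :: 'n \<Rightarrow> real measure" by (rule product_sigma_finite_mixed)
    have int: "integrable (mixed h J i) ?w" for i
      using e h exp_half_lborel exp_grid by (auto simp: mixed_def)
    have "?I \<le> (\<integral>x. C * (\<Prod>i\<in>UNIV. exp (- e * \<bar>x i\<bar>)) \<partial>Pi\<^sub>M UNIV (mixed h J))"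
      using integrable_exp_weight_mixed[OF h(1)] C
      by (intro integral_mono integrable_mult_right product_integrable_prod integrable_abs int) auto
    also have "\<dots> = C * (\<Prod>i\<in>UNIV. integral\<^sup>L (mixed h J i) ?w)"
      by (simp only: integral_mult_right_zero product_integral_prod[OF finite int])
    also have "\<dots> \<le> C * (\<Prod>i\<in>UNIV. \<kappa> * (if i \<in> J then 1 else 1 / h))"
    proof (intro mult_left_mono prod_mono conjI C0)
      fix i
      have "1 / (e * h) \<le> \<kappa> * (1 / h)" using e h by (simp add: \<kappa>_def field_simps max_def)
      then show "integral\<^sup>L (mixed h J i) ?w \<le> \<kappa> * (if i \<in> J then 1 else 1 / h)"
        using exp_grid(2)[OF e h(1)] by (auto simp: mixed_def \<kappa>_def)
    qed auto
    also have "(\<Prod>i\<in>UNIV. \<kappa> * (if i \<in> J then 1 else 1 / h)) = \<kappa> ^ CARD('n) * (1 / h) ^ card (- J)"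
      by (simp add: prod.distrib prod.If_cases)
    finally have "?I \<le> C * (\<kappa> ^ CARD('n) * (1 / h) ^ card (- J))" .
    then have "h ^ card (- J) * ?I \<le> h ^ card (- J) * (C * (\<kappa> ^ CARD('n) * (1 / h) ^ card (- J)))"
      using h by (intro mult_left_mono) auto
    also have "\<dots> = C * \<kappa> ^ CARD('n)" using h by (simp add: power_one_over)
    finally show "h ^ card (- J) * ?I \<le> C * \<kappa> ^ CARD('n)" .
  qed
qed

text \<open>Applies the half-line estimate in coordinate \<open>j\<close> with the others fixed and
  then integrates over them. The prefactor pays for the coordinates that are still grid
  sums.\<close>

lemma euler_maclaurin_step:
  assumes "K \<ge> 1" "j \<notin> J"
  shows "\<exists>C. \<forall>h. 0 < h \<longrightarrow> h \<le> 1 \<longrightarrow> h ^ card (- insert j J) *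
    \<bar>h * (\<integral>x. exp_weight P S x \<partial>Pi\<^sub>M UNIV (mixed h J)) - (\<Sum>k<K. bernoulli_tilde k / fact k * h ^ k *
      (\<integral>x. exp_weight P ((exp_pderiv P j ^^ k) S) x \<partial>Pi\<^sub>M UNIV (mixed h (insert j J))))\<bar> \<le> C * h ^ K"
proof -
  let ?S = "\<lambda>k. (exp_pderiv P j ^^ k) S"
  obtain A where "A \<ge> 0" and "\<forall>h>0. \<forall>f. derivative_chain f \<longrightarrow>
    (\<forall>k. set_integrable lborel {0..} (f k)) \<longrightarrow> integrable (count_space (grid h)) (f 0) \<longrightarrow>
    \<bar>h * integral\<^sup>L (count_space (grid h)) (f 0) - em_sum K h (\<lambda>k. (LINT x:{0..}|lborel. f k x))\<bar> \<le>
      A * h ^ K * (LINT x:{0..}|lborel. \<bar>f K x\<bar>)"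
    using euler_maclaurin_halfline[OF assms(1)] by (elim exE conjE)
  note A = \<open>A \<ge> 0\<close> this(2)[rule_format]
  obtain e where e: "e > 0" and bound: "\<And>S. \<exists>C\<ge>0. \<forall>x. \<bar>exp_weight P S x\<bar> \<le> C * (\<Prod>i\<in>UNIV. exp (- e * \<bar>x i\<bar>))"
    using exp_weight_bound by blast
  obtain C where C: "\<And>h J. 0 < h \<Longrightarrow> h \<le> 1 \<Longrightarrow> h ^ card (- J) * (\<integral>x. \<bar>exp_weight P (?S K) x\<bar> \<partial>Pi\<^sub>M UNIV (mixed h J)) \<le> C"
    using integral_exp_weight_mixed_bound by blast
  show ?thesis
  proof (intro exI[of _ "A * C"] allI impI)
    fix h :: real assume h: "0 < h" "h \<le> 1"
    let ?I = "UNIV - {j}"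
    let ?lhs = "h * (\<integral>x. exp_weight P S x \<partial>Pi\<^sub>M UNIV (mixed h J)) - (\<Sum>k<K. bernoulli_tilde k / fact k * h ^ k *
      (\<integral>x. exp_weight P (?S k) x \<partial>Pi\<^sub>M UNIV (mixed h (insert j J))))"
    let ?bd = "\<integral>x. \<bar>exp_weight P (?S K) x\<bar> \<partial>Pi\<^sub>M UNIV (mixed h (insert j J))"
    \<comment> \<open>Away from \<open>j\<close> the mixed measures before and after the step
      coincide, so all integrals can be taken over the same \<open>N\<close>.\<close>
    define N where "N = Pi\<^sub>M ?I (mixed h J)"
    have N: "N = Pi\<^sub>M ?I (mixed h (insert j J))"
      unfolding N_def by (rule PiM_cong) (auto simp: mixed_def)
    interpret M: product_sigma_finite "mixed h J :: 'n \<Rightarrow> real measure" by (rule product_sigma_finite_mixed)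
    interpret M': product_sigma_finite "mixed h (insert j J) :: 'n \<Rightarrow> real measure" by (rule product_sigma_finite_mixed)
    have U: "insert j ?I = UNIV" by auto
    have fin: "finite ?I" "j \<notin> ?I" by auto
    have j: "mixed h J j = count_space (grid h)" "mixed h (insert j J) j = half_lborel"
      using assms(2) by (auto simp: mixed_def)
    let ?f = "\<lambda>x k y. exp_weight P (?S k) (x(j := y))"
    have deriv: "(?f x k has_real_derivative ?f x (Suc k) y) (at y)" for x k y
      using has_real_derivative_exp_weight[of P "?S k" x j y] by simp
    have meas: "?f x k \<in> borel_measurable borel" for x k
      by (intro borel_measurable_continuous_onI continuous_at_imp_continuous_on ballI DERIV_isCont[OF deriv])
    have int_line: "integrable M (?f x k)"
      if "integrable M (\<lambda>x. exp (- e * \<bar>x\<bar>))" "?f x k \<in> borel_measurable M" for x k and M :: "real measure"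
    proof -
      obtain C where C: "C \<ge> 0" "\<And>x. \<bar>exp_weight P (?S k) x\<bar> \<le> C * (\<Prod>i\<in>UNIV. exp (- e * \<bar>x i\<bar>))"
        using bound[of "?S k"] by blast
      have le: "\<bar>?f x k y\<bar> \<le> C * exp (- e * \<bar>y\<bar>)" for y
      proof -
        have "(\<Prod>i\<in>UNIV. exp (- e * \<bar>(x(j := y)) i\<bar>)) = exp (- e * \<bar>y\<bar>) * (\<Prod>i\<in>?I. exp (- e * \<bar>(x(j := y)) i\<bar>))"
          by (subst prod.remove[of _ j]) auto
        also have "\<dots> \<le> exp (- e * \<bar>y\<bar>) * 1"
          using e by (intro mult_left_mono prod_le_1) auto
        finally have le: "(\<Prod>i\<in>UNIV. exp (- e * \<bar>(x(j := y)) i\<bar>)) \<le> exp (- e * \<bar>y\<bar>)" by (simp only: mult_1_right)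
        show ?thesis by (rule order.trans[OF C(2) mult_left_mono[OF le C(1)]])
      qed
      have "integrable M (\<lambda>y. C * exp (- e * \<bar>y\<bar>))" using that(1) by (rule integrable_mult_right)
      then show ?thesis
        by (rule Bochner_Integration.integrable_bound)
           (use that(2) order.trans[OF le abs_ge_self] in \<open>simp_all del: mult_minus_left\<close>)
    qed
    have int_half: "set_integrable lborel {0..} (?f x k)" for x k
      using int_line[OF exp_half_lborel[OF e], of k x] meas[of k x] by (simp add: integrable_half_lborel)
    have int_cnt: "integrable (count_space (grid h)) (?f x k)" for x k
      using int_line[OF exp_grid(1)[OF e h(1)], of k x] by simp
    have int: "integrable (Pi\<^sub>M (insert j ?I) (mixed h J)) (exp_weight P T)" for J T
      using integrable_exp_weight_mixed[OF h(1)] by (simp add: U)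
    let ?a = "\<lambda>x. integral\<^sup>L (count_space (grid h)) (?f x 0)"
    let ?c = "\<lambda>k x. integral\<^sup>L half_lborel (?f x k)"
    let ?e = "\<lambda>x. integral\<^sup>L half_lborel (\<lambda>y. \<bar>?f x K y\<bar>)"
    have a: "integrable N ?a" "(\<integral>x. exp_weight P S x \<partial>Pi\<^sub>M UNIV (mixed h J)) = integral\<^sup>L N ?a"
      using M.integrable_product_inner_integral[OF fin int] M.product_integral_insert[OF fin int]
      by (simp_all add: N_def j U)
    have c: "integrable N (?c k)" "(\<integral>x. exp_weight P (?S k) x \<partial>Pi\<^sub>M UNIV (mixed h (insert j J))) = integral\<^sup>L N (?c k)" for k
      using M'.integrable_product_inner_integral[OF fin int] M'.product_integral_insert[OF fin int]
      by (simp_all add: N j U)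
    have e: "integrable N ?e" "?bd = integral\<^sup>L N ?e"
      using M'.integrable_product_inner_integral[OF fin integrable_abs[OF int]] M'.product_integral_insert[OF fin integrable_abs[OF int]]
      by (simp_all add: N j U)
    have le: "\<bar>h * ?a x - em_sum K h (\<lambda>k. ?c k x)\<bar> \<le> A * h ^ K * ?e x" for x
      using A(2)[OF h(1), of "?f x", OF deriv int_half int_cnt] meas
      by (simp add: integral_half_lborel)
    have "\<bar>?lhs\<bar> =
      \<bar>\<integral>x. h * ?a x - em_sum K h (\<lambda>k. ?c k x) \<partial>N\<bar>"
      unfolding a(2) c(2)
      by (subst Bochner_Integration.integral_diff)
         (use a(1) c(1) in \<open>auto intro!: integrable_mult_right Bochner_Integration.integrable_sum simp: Bochner_Integration.integral_sum\<close>)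
    also have "\<dots> \<le> (\<integral>x. A * h ^ K * ?e x \<partial>N)"
      using le by (intro order.trans[OF integral_abs_bound] integral_mono integrable_abs integrable_mult_right
        Bochner_Integration.integrable_diff Bochner_Integration.integrable_sum a c e)
    also have "\<dots> = A * h ^ K * ?bd"
      unfolding e(2) by simp
    finally have "h ^ card (- insert j J) * \<bar>?lhs\<bar> \<le>
      h ^ card (- insert j J) * (A * h ^ K * ?bd)"
      using h by (intro mult_left_mono) auto
    also have "\<dots> = A * h ^ K * (h ^ card (- insert j J) * ?bd)"
      by (simp only: mult_ac)
    also have "\<dots> \<le> A * h ^ K * C"
      using C[OF h, of "insert j J"] A(1) h by (intro mult_left_mono) auto
    finally show "h ^ card (- insert j J) * \<bar>?lhs\<bar> \<le> A * C * h ^ K" by (simp add: mult_ac)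
  qed
qed

text \<open>Each conversion of a coordinate consumes one factor \<open>h\<close>, so n - |J| of them
  are left. Entries of \<gamma> outside \<open>J\<close> are 0 because those coordinates have not
  been expanded yet.\<close>

lemma euler_maclaurin_mixed:
  assumes "K \<ge> 1" "finite J"
  shows "\<exists>C. \<forall>h. 0 < h \<longrightarrow> h \<le> 1 \<longrightarrow>
    \<bar>h ^ CARD('n) * (\<integral>x. exp_weight P S x \<partial>Pi\<^sub>M UNIV (mixed h {})) -
     h ^ card (- J) * (\<Sum>\<gamma> | \<forall>i. if i \<in> J then \<gamma> i < K else \<gamma> i = 0.
       (\<Prod>i\<in>UNIV. bernoulli_tilde (\<gamma> i) / fact (\<gamma> i)) * h ^ (sum \<gamma> UNIV) *
       (\<integral>x. exp_weight P (mder (exp_pderiv P) \<gamma> S) x \<partial>Pi\<^sub>M UNIV (mixed h J)))\<bar> \<le> C * h ^ K"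
  using assms(2)
proof (induction J rule: finite_induct)
  case empty
  have "{\<gamma> :: 'n \<Rightarrow> nat. \<forall>i. \<gamma> i = 0} = {\<lambda>_. 0}" by auto
  moreover have "bernoulli_tilde 0 = 1" using bernoulli_tilde_rec[of 0] by simp
  ultimately show ?case
    by (intro exI[of _ 0]) (simp add: mder_zero[OF comp_fun_commute_exp_pderiv])
next
  case (insert j J)
  let ?L = "\<lambda>\<gamma>. mder (exp_pderiv P) \<gamma> S"
  let ?B = "\<lambda>J. {\<gamma> :: 'n \<Rightarrow> nat. \<forall>i. if i \<in> J then \<gamma> i < K else \<gamma> i = 0}"
  let ?b = "\<lambda>\<gamma> :: 'n \<Rightarrow> nat. \<Prod>i\<in>UNIV. bernoulli_tilde (\<gamma> i) / fact (\<gamma> i)"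
  let ?n = "\<lambda>\<gamma> :: 'n \<Rightarrow> nat. \<Sum>i\<in>UNIV. \<gamma> i"
  let ?T = "\<lambda>h S J. \<integral>x. exp_weight P S x \<partial>Pi\<^sub>M UNIV (mixed h J)"
  let ?E = "\<lambda>h \<gamma>. h * ?T h (?L \<gamma>) J - (\<Sum>k<K. bernoulli_tilde k / fact k * h ^ k * ?T h ((exp_pderiv P j ^^ k) (?L \<gamma>)) (insert j J))"
  obtain C where C: "\<And>h. 0 < h \<Longrightarrow> h \<le> 1 \<Longrightarrow>
     \<bar>h ^ CARD('n) * ?T h S {} - h ^ card (- J) * (\<Sum>\<gamma>\<in>?B J. ?b \<gamma> * h ^ ?n \<gamma> * ?T h (?L \<gamma>) J)\<bar> \<le> C * h ^ K"
    using insert.IH by blast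
  have "\<forall>\<gamma>. \<exists>D. \<forall>h. 0 < h \<longrightarrow> h \<le> 1 \<longrightarrow> h ^ card (- insert j J) * \<bar>?E h \<gamma>\<bar> \<le> D * h ^ K"
    by (intro allI euler_maclaurin_step[OF assms(1) insert.hyps(2)])
  from choice[OF this] obtain D where "\<forall>\<gamma> h. 0 < h \<longrightarrow> h \<le> 1 \<longrightarrow> h ^ card (- insert j J) * \<bar>?E h \<gamma>\<bar> \<le> D \<gamma> * h ^ K"
    by (elim exE)
  note D = this[rule_format]
  have card: "card (- J) = Suc (card (- insert j J))"
  proof -
    have "- J = insert j (- insert j J)" using insert.hyps by auto
    then show ?thesis by (metis ComplD card_insert_disjoint finite insertI1)
  qed
  show ?case
  proof (intro exI[of _ "C + (\<Sum>\<gamma>\<in>?B J. \<bar>?b \<gamma>\<bar> * D \<gamma>)"] allI impI)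
    fix h :: real assume h: "0 < h" "h \<le> 1"
    let ?U = "\<lambda>\<gamma> k. ?b \<gamma> * h ^ ?n \<gamma> * (bernoulli_tilde k / fact k * h ^ k * ?T h ((exp_pderiv P j ^^ k) (?L \<gamma>)) (insert j J))"
    let ?V = "\<lambda>\<gamma>. ?b \<gamma> * h ^ ?n \<gamma> * ?T h (?L \<gamma>) (insert j J)"
    let ?W = "\<lambda>\<gamma>. ?b \<gamma> * h ^ ?n \<gamma> * (h ^ card (- insert j J) * ?E h \<gamma>)"
    \<comment> \<open>A multi-index for \<open>insert j J\<close> is one for \<open>J\<close>
      together with its new entry k < K at \<open>j\<close>; that entry supplies the k-th Bernoulli
      factor and k further derivatives.\<close>
    have upd: "(\<Sum>\<gamma>\<in>?B (insert j J). ?V \<gamma>) =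
      (\<Sum>\<gamma>\<in>?B J. \<Sum>k<K. ?U \<gamma> k)"
    proof -
      have "(\<Sum>\<gamma>\<in>?B (insert j J). ?V \<gamma>) =
        (\<Sum>(\<gamma>, k)\<in>?B J \<times> {..<K}. ?U \<gamma> k)"
      proof (rule sum.reindex_bij_witness[of _ "\<lambda>(\<gamma>, k). \<gamma>(j := k)" "\<lambda>\<gamma>. (\<gamma>(j := 0), \<gamma> j)"])
        fix \<gamma> :: "'n \<Rightarrow> nat" assume g: "\<gamma> \<in> ?B (insert j J)"
        show "(case (\<gamma>(j := 0), \<gamma> j) of (\<gamma>, k) \<Rightarrow> \<gamma>(j := k)) = \<gamma>" by simp
        show "(\<gamma>(j := 0), \<gamma> j) \<in> ?B J \<times> {..<K}" using g insert.hyps by auto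
        have b0: "bernoulli_tilde 0 = 1" using bernoulli_tilde_rec[of 0] by simp
        have "?b \<gamma> = ?b (\<gamma>(j := 0)) * (bernoulli_tilde (\<gamma> j) / fact (\<gamma> j))"
          by (subst (1 2) prod.remove[of _ j]) (simp_all add: b0)
        moreover have "?n \<gamma> = ?n (\<gamma>(j := 0)) + \<gamma> j"
          by (subst (1 2) sum.remove[of _ j]) simp_all
        moreover have "?L \<gamma> = (exp_pderiv P j ^^ \<gamma> j) (?L (\<gamma>(j := 0)))"
          using mder_upd[OF comp_fun_commute_exp_pderiv, of P \<gamma> j "\<gamma> j" 0 S] by simp
        ultimately show "(case (\<gamma>(j := 0), \<gamma> j) of (\<gamma>, k) \<Rightarrow>
            ?U \<gamma> k) =
            ?V \<gamma>"
          by (simp only: prod.case power_add mult_ac)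
      next
        fix a assume "a \<in> ?B J \<times> {..<K}"
        then obtain \<gamma> k where a: "a = (\<gamma>, k)" "\<gamma> \<in> ?B J" "k < K" by blast
        then have "\<gamma> j = 0" using insert.hyps by auto
        then show "((case a of (\<gamma>, k) \<Rightarrow> \<gamma>(j := k))(j := 0), (case a of (\<gamma>, k) \<Rightarrow> \<gamma>(j := k)) j) = a"
          using a by (auto simp: fun_eq_iff)
        show "(case a of (\<gamma>, k) \<Rightarrow> \<gamma>(j := k)) \<in> ?B (insert j J)" using a by auto
      qed
      then show ?thesis by (simp only: sum.cartesian_product)
    qed
    have tri: "\<bar>x - z\<bar> \<le> \<bar>x - y\<bar> + \<bar>y - z\<bar>" for x y z :: real by linarith
    \<comment> \<open>The extra factor \<open>h\<close> in \<open>h ^ card (- J)\<close> is the one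
      multiplying the grid integral inside \<open>?E\<close>, so the difference is a finite
      combination of one-coordinate errors.\<close>
    have diff: "h ^ card (- J) * (\<Sum>\<gamma>\<in>?B J. ?b \<gamma> * h ^ ?n \<gamma> * ?T h (?L \<gamma>) J) -
      h ^ card (- insert j J) * (\<Sum>\<gamma>\<in>?B (insert j J). ?V \<gamma>) =
      (\<Sum>\<gamma>\<in>?B J. ?W \<gamma>)" (is "?y - ?z = ?s")
      unfolding upd card by (simp add: sum_distrib_left right_diff_distrib sum_subtractf mult_ac)
    have "\<bar>?s\<bar> \<le> (\<Sum>\<gamma>\<in>?B J. \<bar>?b \<gamma>\<bar> * D \<gamma> * h ^ K)"
    proof (rule order.trans[OF sum_abs], rule sum_mono)
      fix \<gamma>
      have "\<bar>?W \<gamma>\<bar> = \<bar>?b \<gamma>\<bar> * (h ^ ?n \<gamma> * (h ^ card (- insert j J) * \<bar>?E h \<gamma>\<bar>))"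
        using h by (simp add: abs_mult)
      also have "\<dots> \<le> \<bar>?b \<gamma>\<bar> * (1 * (h ^ card (- insert j J) * \<bar>?E h \<gamma>\<bar>))"
        using h by (intro mult_left_mono mult_right_mono power_le_one) auto
      also have "\<dots> \<le> \<bar>?b \<gamma>\<bar> * (D \<gamma> * h ^ K)"
        unfolding mult_1 by (intro mult_left_mono D h) auto
      finally show "\<bar>?W \<gamma>\<bar> \<le> \<bar>?b \<gamma>\<bar> * D \<gamma> * h ^ K"
        by (simp only: mult.assoc)
    qed
    from order.trans[OF tri add_mono[OF C[OF h] this[folded diff]]]
    show "\<bar>h ^ CARD('n) * ?T h S {} - h ^ card (- insert j J) * (\<Sum>\<gamma>\<in>?B (insert j J). ?V \<gamma>)\<bar> \<le>
      (C + (\<Sum>\<gamma>\<in>?B J. \<bar>?b \<gamma>\<bar> * D \<gamma>)) * h ^ K"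
      by (simp only: distrib_right sum_distrib_right)
  qed
qed

end

section \<open>Polar coordinates for the maximum norm\<close>

abbreviation borel_PiM :: "'i set \<Rightarrow> ('i \<Rightarrow> real) measure" where
  "borel_PiM I \<equiv> Pi\<^sub>M I (\<lambda>_. borel)"

abbreviation lborel_PiM :: "'i set \<Rightarrow> ('i \<Rightarrow> real) measure" where
  "lborel_PiM I \<equiv> Pi\<^sub>M I (\<lambda>_. lborel)"

interpretation lborel_product: product_sigma_finite "\<lambda>_ :: 'n. lborel :: real measure"
  by (rule product_sigma_finite.intro) (rule sigma_finite_lborel)

interpretation half_product: product_sigma_finite "\<lambda>_ :: 'n. half_lborel"
  by (rule product_sigma_finite.intro) (rule sigma_finite_half_lborel)

lemma sets_PiM_lborel: "sets (lborel_PiM I) = sets (borel_PiM I)"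
  by (rule sets_PiM_cong) auto

lemma sets_PiM_half: "sets (Pi\<^sub>M I (\<lambda>_. half_lborel)) = sets (borel_PiM I)"
  by (rule sets_PiM_cong) auto

lemma nn_integral_PiM_insert_inner_measurable:
  assumes f: "f \<in> borel_measurable (borel_PiM (insert i I))"
    and g: "g \<in> borel_measurable borel"
  shows "(\<lambda>x. \<integral>\<^sup>+y. f (x(i := g y)) \<partial>lborel) \<in> borel_measurable (borel_PiM I)"
proof -
  have m: "(\<lambda>p. (fst p, g (snd p))) \<in> borel_PiM I \<Otimes>\<^sub>M lborel \<rightarrow>\<^sub>M borel_PiM I \<Otimes>\<^sub>M borel"
    using g by measurable
  have "(\<lambda>p. f ((fst p)(i := g (snd p)))) \<in> borel_measurable (borel_PiM I \<Otimes>\<^sub>M lborel)"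
    using measurable_compose[OF m measurable_compose[OF measurable_add_dim f]]
    by (simp add: case_prod_unfold)
  then have "(\<lambda>(x, y). f (x(i := g y))) \<in> borel_measurable (borel_PiM I \<Otimes>\<^sub>M lborel)"
    by (simp add: case_prod_unfold)
  then show ?thesis by (rule lborel.borel_measurable_nn_integral)
qed

lemma nn_integral_PiM_scale:
  fixes r :: real
  assumes "finite I" "r > 0" "f \<in> borel_measurable (borel_PiM I)"
  shows "(\<integral>\<^sup>+x. f x \<partial>lborel_PiM I) = ennreal (r ^ card I) * (\<integral>\<^sup>+x. f (\<lambda>i\<in>I. r * x i) \<partial>lborel_PiM I)"
  using assms(1,3)
proof (induction I arbitrary: f rule: finite_induct)
  case empty
  then show ?case
    by (simp add: PiM_empty nn_integral_count_space_finite restrict_def)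
next
  case (insert i I)
  note sets_PiM_lborel[measurable_cong]
  note f = insert.prems
  have meas_scale: "(\<lambda>x. \<lambda>i\<in>J. r * x i) \<in> borel_PiM J \<rightarrow>\<^sub>M borel_PiM J" for J :: "'a set"
    by measurable
  have f': "f \<in> borel_measurable (lborel_PiM (insert i I))"
    using f by measurable
  have fs': "(\<lambda>x. f (\<lambda>j\<in>insert i I. r * x j)) \<in> borel_measurable (lborel_PiM (insert i I))"
    using measurable_compose[OF meas_scale f] by measurable
  define g where "g x = (\<integral>\<^sup>+y. f (x(i := r * y)) \<partial>lborel)" for x
  have g: "g \<in> borel_measurable (borel_PiM I)"
    unfolding g_def by (rule nn_integral_PiM_insert_inner_measurable[OF f]) simp
  have "(\<integral>\<^sup>+x. f x \<partial>lborel_PiM (insert i I)) = (\<integral>\<^sup>+x. (\<integral>\<^sup>+y. f (x(i := y)) \<partial>lborel) \<partial>lborel_PiM I)"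
    by (rule lborel_product.product_nn_integral_insert[OF insert.hyps f'])
  also have "\<dots> = (\<integral>\<^sup>+x. ennreal r * g x \<partial>lborel_PiM I)"
  proof (rule nn_integral_cong)
    fix x assume x: "x \<in> space (lborel_PiM I)"
    have "(\<lambda>y. f (x(i := y))) \<in> borel_measurable borel"
      by (rule measurable_compose[OF measurable_component_update f]) (use x insert.hyps in \<open>auto simp: space_PiM\<close>)
    from nn_integral_real_affine[OF this, of r 0] \<open>r > 0\<close>
    show "(\<integral>\<^sup>+y. f (x(i := y)) \<partial>lborel) = ennreal r * g x" by (simp add: g_def)
  qed
  also have "\<dots> = ennreal r * (\<integral>\<^sup>+x. g x \<partial>lborel_PiM I)"
    by (rule nn_integral_cmult) (use g in measurable)
  also have "(\<integral>\<^sup>+x. g x \<partial>lborel_PiM I) = ennreal (r ^ card I) * (\<integral>\<^sup>+x. g (\<lambda>i\<in>I. r * x i) \<partial>lborel_PiM I)"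
    by (rule insert.IH[OF g])
  also have "(\<integral>\<^sup>+x. g (\<lambda>i\<in>I. r * x i) \<partial>lborel_PiM I) =
     (\<integral>\<^sup>+x. (\<integral>\<^sup>+y. f (\<lambda>j\<in>insert i I. r * (x(i := y)) j) \<partial>lborel) \<partial>lborel_PiM I)"
  proof -
    have "(\<lambda>j\<in>I. r * x j)(i := r * y) = (\<lambda>j\<in>insert i I. r * (x(i := y)) j)" for x y
      using insert.hyps by (auto simp: fun_eq_iff)
    then show ?thesis by (simp only: g_def)
  qed
  also have "\<dots> = (\<integral>\<^sup>+x. f (\<lambda>j\<in>insert i I. r * x j) \<partial>lborel_PiM (insert i I))"
    by (rule lborel_product.product_nn_integral_insert[OF insert.hyps fs', symmetric])
  finally have "(\<integral>\<^sup>+x. f x \<partial>lborel_PiM (insert i I)) =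
    ennreal r * (ennreal (r ^ card I) * (\<integral>\<^sup>+x. f (\<lambda>j\<in>insert i I. r * x j) \<partial>lborel_PiM (insert i I)))" .
  moreover have "ennreal (r ^ card (insert i I)) = ennreal r * ennreal (r ^ card I)"
    using insert.hyps \<open>r > 0\<close> by (simp add: ennreal_mult)
  ultimately show ?case by (simp only: mult.assoc)
qed

lemma nn_integral_PiM_half:
  assumes "finite I" "f \<in> borel_measurable (borel_PiM I)"
  shows "(\<integral>\<^sup>+x. f x \<partial>Pi\<^sub>M I (\<lambda>_. half_lborel)) = (\<integral>\<^sup>+x. f x * (\<Prod>i\<in>I. indicator {0..} (x i)) \<partial>lborel_PiM I)"
  using assms
proof (induction I arbitrary: f rule: finite_induct)
  case empty
  then show ?case
    by (simp add: PiM_empty nn_integral_count_space_finite)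
next
  case (insert i I)
  note f = insert.prems
  note sets_PiM_lborel[measurable_cong] sets_PiM_half[measurable_cong]
  define g where "g x = (\<integral>\<^sup>+y. f (x(i := y)) * indicator {0..} y \<partial>lborel)" for x
  have [measurable]: "(\<lambda>x. \<Prod>i\<in>J. indicator {0..} (x i :: real) :: ennreal) \<in> borel_measurable (borel_PiM J)" for J :: "'a set"
    by (intro borel_measurable_prod_ennreal measurable_compose[OF measurable_component_singleton borel_measurable_indicator]) auto
  have fi: "(\<lambda>x. f x * indicator {0..} (x i)) \<in> borel_measurable (borel_PiM (insert i I))"
    using f by measurable
  have g: "g \<in> borel_measurable (borel_PiM I)"
    using nn_integral_PiM_insert_inner_measurable[OF fi, of "\<lambda>y. y"] by (simp add: g_def[abs_def])
  have f1: "f \<in> borel_measurable (Pi\<^sub>M (insert i I) (\<lambda>_. half_lborel))" using f by measurable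
  have f2: "(\<lambda>x. f x * (\<Prod>i\<in>insert i I. indicator {0..} (x i))) \<in> borel_measurable (lborel_PiM (insert i I))" using f by measurable
  have line: "(\<lambda>y. f (x(i := y))) \<in> borel_measurable borel" if "x \<in> extensional I" for x
    by (rule measurable_compose[OF measurable_component_update f]) (use that insert.hyps in \<open>auto simp: space_PiM PiE_def\<close>)
  have "(\<integral>\<^sup>+x. f x \<partial>Pi\<^sub>M (insert i I) (\<lambda>_. half_lborel)) = (\<integral>\<^sup>+x. (\<integral>\<^sup>+y. f (x(i := y)) \<partial>half_lborel) \<partial>Pi\<^sub>M I (\<lambda>_. half_lborel))"
    by (rule half_product.product_nn_integral_insert[OF insert.hyps f1])
  also have "\<dots> = (\<integral>\<^sup>+x. g x \<partial>Pi\<^sub>M I (\<lambda>_. half_lborel))"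
    unfolding g_def by (rule nn_integral_cong, rule nn_integral_half_lborel, rule line) (auto simp: space_PiM PiE_def)
  also have "\<dots> = (\<integral>\<^sup>+x. g x * (\<Prod>i\<in>I. indicator {0..} (x i)) \<partial>lborel_PiM I)"
    by (rule insert.IH[OF g])
  also have "\<dots> = (\<integral>\<^sup>+x. (\<integral>\<^sup>+y. f (x(i := y)) * (\<Prod>j\<in>insert i I. indicator {0..} ((x(i := y)) j)) \<partial>lborel) \<partial>lborel_PiM I)"
  proof (rule nn_integral_cong)
    fix x assume x: "x \<in> space (lborel_PiM I)"
    let ?p = "\<Prod>j\<in>I. indicator {0..} (x j) :: ennreal"
    have p: "(\<Prod>j\<in>insert i I. indicator {0..} ((x(i := y)) j)) = indicator {0..} y * ?p" for y
    proof -
      have "(\<Prod>j\<in>I. indicator {0..} ((x(i := y)) j)) = ?p"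
        using insert.hyps by (intro prod.cong) auto
      then show ?thesis using insert.hyps by simp
    qed
    have "g x * ?p = (\<integral>\<^sup>+y. f (x(i := y)) * indicator {0..} y * ?p \<partial>lborel)"
      unfolding g_def by (rule nn_integral_multc[symmetric]) (use line x in \<open>auto simp: space_PiM PiE_def\<close>)
    then show "g x * ?p = (\<integral>\<^sup>+y. f (x(i := y)) * (\<Prod>j\<in>insert i I. indicator {0..} ((x(i := y)) j)) \<partial>lborel)"
      unfolding p by (simp only: mult.assoc)
  qed
  also have "\<dots> = (\<integral>\<^sup>+x. f x * (\<Prod>j\<in>insert i I. indicator {0..} (x j)) \<partial>lborel_PiM (insert i I))"
    by (rule lborel_product.product_nn_integral_insert[OF insert.hyps f2, symmetric])
  finally show ?case .
qed

text \<open>Ensures that the regions on which a given coordinate is the largest overlap only in a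
  null set.\<close>

lemma AE_PiM_coordinates_distinct:
  assumes "i \<noteq> (j :: 'n::finite)"
  shows "AE x in lborel_PiM UNIV. x i \<noteq> x j"
proof -
  note sets_PiM_lborel[measurable_cong]
  have U: "insert i (UNIV - {i}) = UNIV" by auto
  have "{x \<in> space (lborel_PiM UNIV). x i = x j} \<in> sets (lborel_PiM UNIV)"
    by measurable
  then have m: "{x :: 'n \<Rightarrow> real. x i = x j} \<in> sets (lborel_PiM UNIV)"
    by (simp add: space_PiM)
  have "emeasure (lborel_PiM UNIV) {x :: 'n \<Rightarrow> real. x i = x j} = (\<integral>\<^sup>+x. indicator {x :: 'n \<Rightarrow> real. x i = x j} x \<partial>Pi\<^sub>M (insert i (UNIV - {i})) (\<lambda>_. lborel))"
    by (simp only: U nn_integral_indicator[OF m])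
  also have "\<dots> = (\<integral>\<^sup>+x. (\<integral>\<^sup>+y. indicator {x :: 'n \<Rightarrow> real. x i = x j} (x(i := y)) \<partial>lborel) \<partial>lborel_PiM (UNIV - {i}))"
    by (rule lborel_product.product_nn_integral_insert) (use m in \<open>simp_all add: U\<close>)
  also have "\<dots> = (\<integral>\<^sup>+x. (\<integral>\<^sup>+y. indicator {x j} y \<partial>lborel) \<partial>lborel_PiM (UNIV - {i}))"
    using assms by (intro nn_integral_cong) (auto split: split_indicator)
  also have "\<dots> = 0" by simp
  finally have "{x :: 'n \<Rightarrow> real. x i = x j} \<in> null_sets (lborel_PiM UNIV)"
    using m by auto
  then show ?thesis by (rule AE_I') auto
qed

text \<open>The orthant is cut according to which coordinate is largest. Where it is the i-th, that
  coordinate serves as the radius r and the others are r y with y in the unit cube; scaling n - 1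
  coordinates yields the Jacobian r^(n-1).\<close>

lemma nn_integral_max_polar:
  fixes f :: "('n::finite \<Rightarrow> real) \<Rightarrow> ennreal"
  assumes f: "f \<in> borel_measurable (borel_PiM UNIV)"
  shows "(\<integral>\<^sup>+x. f x \<partial>Pi\<^sub>M UNIV (\<lambda>_. half_lborel)) =
    (\<Sum>i\<in>UNIV. \<integral>\<^sup>+y. indicator ((UNIV - {i}) \<rightarrow>\<^sub>E {0..1}) y *
       (\<integral>\<^sup>+r. ennreal (r ^ (CARD('n) - 1)) * f (\<lambda>k. r * (if k = i then 1 else y k)) * indicator {0<..} r \<partial>lborel)
       \<partial>lborel_PiM (UNIV - {i}))"
proof -
  note sets_PiM_lborel[measurable_cong] 
  note [measurable] = f
  let ?pos = "\<lambda>x :: 'n \<Rightarrow> real. \<Prod>i\<in>UNIV. indicator {0..} (x i) :: ennreal"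
  let ?R = "\<lambda>i. {x :: 'n \<Rightarrow> real. \<forall>j. x j \<le> x i}"
  have [measurable]: "(\<lambda>x. x j) \<in> borel_measurable (borel_PiM UNIV)" for j :: 'n
    by (rule measurable_component_singleton) simp
  have R: "?R i \<in> sets (borel_PiM UNIV)" for i
  proof -
    have "{x \<in> space (borel_PiM UNIV). \<forall>j. x j \<le> x i} \<in> sets (borel_PiM UNIV)"
      by (intro sets.sets_Collect_countable_All borel_measurable_le measurable_component_singleton) auto
    then show ?thesis by (simp add: space_PiM)
  qed
  note [measurable] = R
  have "AE x in lborel_PiM UNIV. \<forall>i j :: 'n. i \<noteq> j \<longrightarrow> x i \<noteq> x j"
    by (simp add: AE_all_countable AE_PiM_coordinates_distinct)
  \<comment> \<open>Off the null set of ties exactly one index attains the maximum, so the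
    indicators of the regions sum to 1.\<close>
  then have split: "AE x in lborel_PiM UNIV. f x * ?pos x = (\<Sum>i\<in>UNIV. f x * ?pos x * indicator (?R i) x)"
  proof (rule AE_mp, intro AE_I2 impI)
    fix x :: "'n \<Rightarrow> real" assume inj: "\<forall>i j :: 'n. i \<noteq> j \<longrightarrow> x i \<noteq> x j"
    have "Max (range x) \<in> range x" by (intro Max_in) auto
    then obtain i where i: "x i = Max (range x)" by (metis rangeE)
    then have "x \<in> ?R i" by auto
    moreover have "x \<notin> ?R j" if "j \<noteq> i" for j
      using that inj \<open>x \<in> ?R i\<close> by (metis (mono_tags, lifting) antisym mem_Collect_eq)
    ultimately have ind: "indicator (?R j) x = (if j = i then 1 else 0 :: ennreal)" for j by auto
    have "(\<Sum>j\<in>UNIV. f x * ?pos x * indicator (?R j) x) = (\<Sum>j\<in>UNIV. if j = i then f x * ?pos x else 0)"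
      by (rule sum.cong) (simp_all only: ind, simp_all)
    then show "f x * ?pos x = (\<Sum>j\<in>UNIV. f x * ?pos x * indicator (?R j) x)" by simp
  qed
  have "(\<integral>\<^sup>+x. f x \<partial>Pi\<^sub>M UNIV (\<lambda>_. half_lborel)) = (\<integral>\<^sup>+x. f x * ?pos x \<partial>lborel_PiM UNIV)"
    by (rule nn_integral_PiM_half) (use f in auto)
  also have "\<dots> = (\<integral>\<^sup>+x. (\<Sum>i\<in>UNIV. f x * ?pos x * indicator (?R i) x) \<partial>lborel_PiM UNIV)"
    by (rule nn_integral_cong_AE[OF split])
  also have "\<dots> = (\<Sum>i\<in>UNIV. \<integral>\<^sup>+x. f x * ?pos x * indicator (?R i) x \<partial>lborel_PiM UNIV)"
    by (rule nn_integral_sum) measurable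
  also have "\<dots> = (\<Sum>i\<in>UNIV. \<integral>\<^sup>+y. indicator ((UNIV - {i}) \<rightarrow>\<^sub>E {0..1}) y *
       (\<integral>\<^sup>+r. ennreal (r ^ (CARD('n) - 1)) * f (\<lambda>k. r * (if k = i then 1 else y k)) * indicator {0<..} r \<partial>lborel)
       \<partial>lborel_PiM (UNIV - {i}))"
  proof (rule sum.cong)
    fix i :: 'n
    let ?I = "UNIV - {i}" and ?n = "CARD('n) - 1"
    let ?C = "?I \<rightarrow>\<^sub>E {0..1 :: real}"
    let ?L = "lborel_PiM ?I"
    let ?h = "\<lambda>r y k. r * (if k = i then 1 else y k)"
    let ?G = "\<lambda>r y. ennreal (r ^ ?n) * f (?h r y) * indicator {0<..} r * indicator ?C y"
    have U: "insert i ?I = UNIV" and fin: "finite ?I" "i \<notin> ?I" by auto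
    have card: "card ?I = ?n" by simp
    define F where "F x = f x * ?pos x * indicator (?R i) x" for x
    have F[measurable]: "F \<in> borel_measurable (borel_PiM UNIV)" unfolding F_def by measurable
    then have F': "F \<in> borel_measurable (borel_PiM (insert i ?I))" by (simp add: U)
    have C[measurable]: "?C \<in> sets (borel_PiM ?I)" by (rule sets_PiM_I_finite) auto
    have hat: "(\<lambda>p k. snd p * (if k = i then 1 else fst p k)) \<in> borel_PiM ?I \<Otimes>\<^sub>M borel \<rightarrow>\<^sub>M borel_PiM UNIV"
    proof (rule measurable_PiM_single')
      fix k
      have "(\<lambda>p. if k = i then 1 else fst p k) \<in> borel_measurable (borel_PiM ?I \<Otimes>\<^sub>M (borel :: real measure))"
        by (cases "k = i") (auto intro!: measurable_compose[OF measurable_fst measurable_component_singleton])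
      from borel_measurable_times[OF measurable_snd this]
      show "(\<lambda>p. snd p * (if k = i then 1 else fst p k)) \<in> borel_measurable (borel_PiM ?I \<Otimes>\<^sub>M (borel :: real measure))" .
    qed auto
    define \<Psi> where "\<Psi> p = f (\<lambda>k. snd p * (if k = i then 1 else fst p k)) * indicator {0<..} (snd p) * indicator ?C (fst p)" for p
    have "\<Psi> \<in> borel_measurable (borel_PiM ?I \<Otimes>\<^sub>M borel)"
      unfolding \<Psi>_def
      by (intro borel_measurable_times_ennreal measurable_compose[OF hat f] measurable_compose[OF measurable_fst borel_measurable_indicator]
        measurable_compose[OF measurable_snd borel_measurable_indicator] C) simp
    then have \<Psi>: "\<Psi> \<in> borel_measurable (?L \<Otimes>\<^sub>M lborel)" by measurable
    have \<Psi>r: "(\<lambda>y. f (?h r y) * indicator {0<..} r * indicator ?C y) \<in> borel_measurable (?L)" for r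
    proof -
      have "(\<lambda>y. (y, r)) \<in> ?L \<rightarrow>\<^sub>M ?L \<Otimes>\<^sub>M lborel" by simp
      from measurable_compose[OF this \<Psi>] show ?thesis by (simp add: \<Psi>_def cong: if_cong)
    qed
    \<comment> \<open>For r > 0 the orthant conditions together with the maximality of coordinate
      \<open>i\<close> say precisely that y lies in the cube.\<close>
    have pt: "F (?h r y) = f (?h r y) * indicator ?C y"
      if r: "r > 0" and ext: "y \<in> extensional ?I" for r y
    proof -
      have "(\<Prod>k\<in>UNIV. indicator {0..} (r * (if k = i then 1 else y k)) :: ennreal) * indicator (?R i) (?h r y) = indicator ?C y"
      proof (cases "y \<in> ?C")
        case True
        then have y: "0 \<le> y k \<and> y k \<le> 1" if "k \<noteq> i" for k using True that by (auto simp: PiE_iff)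
        have "(\<Prod>k\<in>UNIV. indicator {0..} (r * (if k = i then 1 else y k)) :: ennreal) = 1"
          using y r by (intro prod.neutral) auto
        moreover have "(?h r y) \<in> ?R i" using y r by auto
        ultimately show ?thesis using True by simp
      next
        case False
        then obtain k where k: "k \<noteq> i" "\<not> (0 \<le> y k \<and> y k \<le> 1)" using ext by (auto simp: PiE_iff)
        show ?thesis
        proof (cases "y k \<ge> 0")
          case True
          then have "(?h r y) \<notin> ?R i" using k r by (auto intro!: exI[of _ k])
          then show ?thesis using False by simp
        next
          case neg: False
          then have "indicator {0..} (r * (if k = i then 1 else y k)) = (0 :: ennreal)"
            using k r by (auto simp: zero_le_mult_iff)
          then have "(\<Prod>k\<in>UNIV. indicator {0..} (r * (if k = i then 1 else y k)) :: ennreal) = 0"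
            by (intro prod_zero bexI[of _ k]) simp_all
          then show ?thesis using False by simp
        qed
      qed
      then show ?thesis by (simp add: F_def mult.assoc)
    qed
    have "(\<integral>\<^sup>+x. F x \<partial>lborel_PiM UNIV) = (\<integral>\<^sup>+r. (\<integral>\<^sup>+x. F (x(i := r)) \<partial>?L) \<partial>lborel)"
      using lborel_product.product_nn_integral_insert_rev[OF fin, of F] F unfolding U by simp
    also have "\<dots> = (\<integral>\<^sup>+r. (\<integral>\<^sup>+y. ?G r y \<partial>?L) \<partial>lborel)"
    proof (rule nn_integral_cong_AE)
      have "AE r in lborel. (r :: real) \<noteq> 0" by (rule AE_lborel_singleton)
      then show "AE r in lborel. (\<integral>\<^sup>+x. F (x(i := r)) \<partial>?L) =
         (\<integral>\<^sup>+y. ?G r y \<partial>?L)"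
      proof (rule AE_mp, intro AE_I2 impI)
        fix r :: real assume "r \<noteq> 0"
        then consider "r < 0" | "r > 0" by linarith
        then show "(\<integral>\<^sup>+x. F (x(i := r)) \<partial>?L) =
         (\<integral>\<^sup>+y. ?G r y \<partial>?L)"
        proof cases
          case 1
          then have "F (x(i := r)) = 0" for x
            by (auto simp: F_def intro!: prod_zero bexI[of _ i])
          with 1 show ?thesis by simp
        next
          case 2
          have Fr: "(\<lambda>x. F (x(i := r))) \<in> borel_measurable (borel_PiM ?I)"
          proof -
            have "(\<lambda>x. x(i := r)) \<in> borel_PiM ?I \<rightarrow>\<^sub>M borel_PiM (insert i ?I)"
              by (rule measurable_fun_upd[where J = ?I]) auto
            from measurable_compose[OF this F'] show ?thesis .
          qed
          have upd: "(\<lambda>j\<in>?I. r * x j)(i := r) = (?h r x)" for x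
            by (auto simp: fun_eq_iff)
          have "(\<integral>\<^sup>+x. F (x(i := r)) \<partial>?L) =
             ennreal (r ^ card ?I) * (\<integral>\<^sup>+x. F (?h r x) \<partial>?L)"
            using nn_integral_PiM_scale[OF fin(1) 2 Fr] by (simp only: upd)
          also have "(\<integral>\<^sup>+x. F (?h r x) \<partial>?L) =
            (\<integral>\<^sup>+y. f (?h r y) * indicator {0<..} r * indicator ?C y \<partial>?L)"
            using 2 by (intro nn_integral_cong) (auto simp: pt space_PiM PiE_def)
          also have "ennreal (r ^ card ?I) * \<dots> =
            (\<integral>\<^sup>+y. ennreal (r ^ ?n) * (f (?h r y) * indicator {0<..} r * indicator ?C y) \<partial>?L)"
            unfolding card by (rule nn_integral_cmult[symmetric, OF \<Psi>r])
          finally show ?thesis by (simp only: mult.assoc)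
        qed
      qed
    qed
    also have "\<dots> = (\<integral>\<^sup>+y. (\<integral>\<^sup>+r. ?G r y \<partial>lborel) \<partial>?L)"
    proof (rule pair_sigma_finite.Fubini')
      show "pair_sigma_finite (?L) (lborel :: real measure)"
        by (intro pair_sigma_finite.intro lborel_product.sigma_finite sigma_finite_lborel) auto
      show "(\<lambda>(y, r). ?G r y)
         \<in> borel_measurable (?L \<Otimes>\<^sub>M lborel)"
      proof -
        have "(\<lambda>p. ennreal (snd p ^ ?n) * \<Psi> p) \<in> borel_measurable (?L \<Otimes>\<^sub>M lborel)"
          using \<Psi> by measurable
        then show ?thesis by (simp add: \<Psi>_def case_prod_unfold mult.assoc cong: if_cong)
      qed
    qed
    also have "\<dots> = (\<integral>\<^sup>+y. indicator ?C y * (\<integral>\<^sup>+r. ennreal (r ^ ?n) * f (?h r y) * indicator {0<..} r \<partial>lborel) \<partial>?L)"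
      by (intro nn_integral_cong) (auto split: split_indicator)
    finally show "(\<integral>\<^sup>+x. f x * ?pos x * indicator (?R i) x \<partial>lborel_PiM UNIV) =
      (\<integral>\<^sup>+y. indicator ?C y * (\<integral>\<^sup>+r. ennreal (r ^ ?n) * f (?h r y) * indicator {0<..} r \<partial>lborel) \<partial>?L)"
      unfolding F_def .
  qed simp
  finally show ?thesis .
qed

section \<open>Radial integration of homogeneous functions\<close>

text \<open>Substituting t = p r^d would give \<Gamma>(a) / (d p^a). As \<open>a\<close> is a
  positive integer, a primitive vanishing at infinity can be built by induction, and its value at 0
  gives the integral.\<close>

lemma nn_integral_power_exp:
  fixes p :: real
  assumes "p > 0" "d \<ge> 1" "a \<ge> 1"
  shows "(\<integral>\<^sup>+r. ennreal (r ^ (d * a - 1) * exp (- (r ^ d * p))) * indicator {0<..} r \<partial>lborel) = ennreal (fact (a - 1) / (real d * p ^ a))"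
proof -
  let ?e = "\<lambda>a r. r ^ (d * a - 1) * exp (- (r ^ d * p))"
  have lim0: "((\<lambda>r. r ^ (d * k) * exp (- (r ^ d * p))) \<longlongrightarrow> 0) at_top" for k
  proof -
    have "((\<lambda>x :: real. x ^ k / exp x) \<longlongrightarrow> 0) at_top" by (rule tendsto_power_div_exp_0)
    moreover have "filterlim (\<lambda>r :: real. r ^ d * p) at_top at_top"
      using assms by (intro filterlim_at_top_mult_tendsto_pos[OF tendsto_const] filterlim_pow_at_top filterlim_ident) auto
    ultimately have "((\<lambda>r. (r ^ d * p) ^ k / exp (r ^ d * p)) \<longlongrightarrow> 0) at_top"
      by (rule filterlim_compose)
    from tendsto_divide[OF this tendsto_const[of "p ^ k"]] assms
    show ?thesis by (simp add: power_mult_distrib exp_minus field_simps power_mult)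
  qed
  have "\<exists>F. (\<forall>r\<ge>0. (F has_real_derivative ?e a r) (at r)) \<and>
       F 0 = - fact (a - 1) / (real d * p ^ a) \<and> (F \<longlongrightarrow> 0) at_top"
    using \<open>a \<ge> 1\<close>
  proof (induction a rule: nat_induct_at_least)
    case base
    have "((\<lambda>r. - exp (- (r ^ d * p)) / (real d * p)) has_real_derivative r ^ (d * 1 - 1) * exp (- (r ^ d * p))) (at r)" for r
      using assms by (auto intro!: derivative_eq_intros simp: field_simps)
    moreover have "((\<lambda>r. - exp (- (r ^ d * p)) / (real d * p)) \<longlongrightarrow> - 0 / (real d * p)) at_top"
      using lim0[of 0] assms by (intro tendsto_intros) auto
    ultimately show ?case
      using assms by (intro exI[of _ "\<lambda>r. - exp (- (r ^ d * p)) / (real d * p)"]) (auto simp: power_0_left)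
  next
    case (Suc a)
    then obtain F where F: "\<And>r. r \<ge> 0 \<Longrightarrow> (F has_real_derivative ?e a r) (at r)"
       "F 0 = - fact (a - 1) / (real d * p ^ a)" "(F \<longlongrightarrow> 0) at_top" by blast
    \<comment> \<open>Integration by parts lowers \<open>a\<close> by one: the boundary function
      vanishes at 0 and at infinity, and the rest is a/p times the previous primitive.\<close>
    define G where "G = (\<lambda>r. - (r ^ (d * a) * exp (- (r ^ d * p))) / (real d * p) + real a / p * F r)"
    have "(G has_real_derivative r ^ (d * Suc a - 1) * exp (- (r ^ d * p))) (at r)" if "r \<ge> 0" for r
    proof -
      have e: "r ^ (d * Suc a - 1) = r ^ (d * a) * r ^ (d - 1)"
        using assms(2) by (simp flip: power_add) (metis Nat.add_diff_assoc add.commute)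
      have "(G has_real_derivative - ((real (d * a) * r ^ (d * a - 1)) * exp (- (r ^ d * p)) -
         r ^ (d * a) * (exp (- (r ^ d * p)) * (real d * r ^ (d - 1) * p))) / (real d * p) + real a / p * (?e a r)) (at r)"
        unfolding G_def using F(1)[OF that] assms by (auto intro!: derivative_eq_intros simp: field_simps)
      also have "- ((real (d * a) * r ^ (d * a - 1)) * exp (- (r ^ d * p)) -
         r ^ (d * a) * (exp (- (r ^ d * p)) * (real d * r ^ (d - 1) * p))) / (real d * p) + real a / p * (?e a r) =
         r ^ (d * Suc a - 1) * exp (- (r ^ d * p))"
        unfolding e using assms by (simp add: field_simps)
      finally show ?thesis .
    qed
    moreover have "G 0 = - fact (Suc a - 1) / (real d * p ^ Suc a)"
    proof -
      have "fact a = (real a * fact (a - 1) :: real)" using Suc.hyps by (simp add: fact_reduce)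
      then show ?thesis using assms Suc.hyps by (simp add: G_def F(2) power_0_left)
    qed
    moreover have "(G \<longlongrightarrow> - 0 / (real d * p) + real a / p * 0) at_top"
      unfolding G_def using assms by (intro tendsto_intros lim0 F(3)) auto
    ultimately show ?case by (intro exI[of _ G]) auto
  qed
  then obtain F where F: "\<And>r. r \<ge> 0 \<Longrightarrow> (F has_real_derivative ?e a r) (at r)"
       "F 0 = - fact (a - 1) / (real d * p ^ a)" "(F \<longlongrightarrow> 0) at_top" by blast
  have "(\<integral>\<^sup>+r. ennreal (?e a r) * indicator {0..} r \<partial>lborel) = ennreal (0 - F 0)"
    by (rule nn_integral_FTC_atLeast) (use F in auto)
  moreover have "(\<integral>\<^sup>+r. ennreal (?e a r) * indicator {0<..} r \<partial>lborel) =
      (\<integral>\<^sup>+r. ennreal (?e a r) * indicator {0..} r \<partial>lborel)"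
  proof (rule nn_integral_cong_AE)
    show "AE r in lborel. ennreal (?e a r) * indicator {0<..} r =
       ennreal (?e a r) * indicator {0..} r"
      by (rule AE_mp[OF AE_lborel_singleton[of 0]]) (auto split: split_indicator)
  qed
  ultimately show ?thesis by (simp add: F(2))
qed

abbreviation half_PiM :: "('n \<Rightarrow> real) measure" where
  "half_PiM \<equiv> Pi\<^sub>M UNIV (\<lambda>_. half_lborel)"

abbreviation face_lborel :: "'n \<Rightarrow> ('n \<Rightarrow> real) measure" where
  "face_lborel i \<equiv> lborel_PiM (UNIV - {i})"

abbreviation cube :: "'n \<Rightarrow> ('n \<Rightarrow> real) set" where
  "cube i \<equiv> (UNIV - {i}) \<rightarrow>\<^sub>E {0..1}"

abbreviation hat :: "'n \<Rightarrow> ('n \<Rightarrow> real) \<Rightarrow> 'n \<Rightarrow> real" where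
  "hat i y \<equiv> \<lambda>k. if k = i then 1 else y k"

context
  fixes P :: "'n::finite mpoly" and d :: nat
  assumes P: "homogeneous d P" "d \<ge> 1" and pos: "\<And>x :: real ^ 'n. x \<noteq> 0 \<Longrightarrow> mpoly_eval P x > 0"
begin

lemma mp_fun_hat_pos: "mp_fun P (\<lambda>k. if k = i then 1 else y k) > 0"
proof -
  have "(\<chi> k. if k = i then 1 else y k) \<noteq> (0 :: real ^ 'n)" by (auto simp: vec_eq_iff intro!: exI[of _ i])
  from pos[OF this] show ?thesis by (simp add: mpoly_eval_eq_mp_fun)
qed

text \<open>The hypothesis \<open>hom\<close> says that \<open>H\<close> has degree d a - n, with
  r^n moved to the other side to avoid subtraction. Along a ray the integrand is then r^(d a - 1)
  exp(-r^d P), a radial Gamma integral.\<close>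

lemma nn_integral_homogeneous_exp:
  fixes H :: "('n \<Rightarrow> real) \<Rightarrow> real"
  assumes H: "H \<in> borel_measurable (borel_PiM UNIV)" "\<And>x. H x \<ge> 0" "a \<ge> 1"
    and hom: "\<forall>r>0. \<forall>x. H (\<lambda>k. r * x k) * r ^ CARD('n) = r ^ (d * a) * H x"
  shows "(\<integral>\<^sup>+x. ennreal (H x * exp (- mp_fun P x)) \<partial>half_PiM) =
    (\<Sum>i\<in>UNIV. \<integral>\<^sup>+y. ennreal (fact (a - 1) / real d * (indicator (cube i) y *
       (H (hat i y) / mp_fun P (hat i y) ^ a))) \<partial>face_lborel i)"
proof -
  have [measurable]: "mp_fun P \<in> borel_measurable (borel_PiM UNIV)"
    by (rule measurable_mp_fun) simp
  note [measurable] = H(1)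
  have "(\<integral>\<^sup>+x. ennreal (H x * exp (- mp_fun P x)) \<partial>half_PiM) =
    (\<Sum>i\<in>UNIV. \<integral>\<^sup>+y. indicator (cube i) y *
       (\<integral>\<^sup>+r. ennreal (r ^ (CARD('n) - 1)) * ennreal (H (\<lambda>k. r * (if k = i then 1 else y k)) * exp (- mp_fun P (\<lambda>k. r * (if k = i then 1 else y k)))) * indicator {0<..} r \<partial>lborel)
       \<partial>face_lborel i)"
    by (rule nn_integral_max_polar) measurable
  also have "\<dots> = (\<Sum>i\<in>UNIV. \<integral>\<^sup>+y. ennreal (fact (a - 1) / real d * (indicator (cube i) y *
       (H (hat i y) / mp_fun P (hat i y) ^ a))) \<partial>face_lborel i)"
  proof (intro sum.cong refl nn_integral_cong)
    fix i :: 'n and y :: "'n \<Rightarrow> real"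
    let ?y = "\<lambda>k. if k = i then 1 else y k"
    let ?ry = "\<lambda>r k. r * ?y k"
    let ?J = "\<integral>\<^sup>+r. ennreal (r ^ (CARD('n) - 1)) * ennreal (H (?ry r) * exp (- mp_fun P (?ry r))) * indicator {0<..} r \<partial>lborel"
    have p: "mp_fun P ?y > 0" by (rule mp_fun_hat_pos)
    have pt: "ennreal (r ^ (CARD('n) - 1)) * ennreal (H (?ry r) * exp (- mp_fun P (?ry r))) * indicator {0<..} r =
      ennreal (H ?y) * (ennreal (r ^ (d * a - 1) * exp (- (r ^ d * mp_fun P ?y))) * indicator {0<..} r)" for r
    proof (cases "r > 0")
      case True
      \<comment> \<open>Multiplying by r replaces the truncated exponents n - 1 and d a - 1 by n and
        d a, for which homogeneity is available; r is cancelled afterwards.\<close>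
      have "r * (r ^ (CARD('n) - 1) * H (?ry r)) = r ^ CARD('n) * H (?ry r)"
        by (simp add: power_eq_if[of r "CARD('n)"] mult.assoc)
      also have "\<dots> = r ^ (d * a) * H ?y" using hom True by (simp add: mult.commute)
      also have "\<dots> = r * (r ^ (d * a - 1) * H ?y)"
        using P(2) H(3) by (simp add: power_eq_if[of r "d * a"] mult.assoc)
      finally have A: "r ^ (CARD('n) - 1) * H (?ry r) = r ^ (d * a - 1) * H ?y"
        using True by (simp only: mult_left_cancel[OF less_imp_neq[OF True, symmetric]])
      have B: "mp_fun P (?ry r) = r ^ d * mp_fun P ?y" by (rule homogeneous_scale[OF P(1)])
      have "r ^ (CARD('n) - 1) * H (?ry r) * exp (- mp_fun P (?ry r)) =
        r ^ (d * a - 1) * H ?y * exp (- (r ^ d * mp_fun P ?y))"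
        by (simp only: A B)
      then have "r ^ (CARD('n) - 1) * (H (?ry r) * exp (- mp_fun P (?ry r))) =
        H ?y * (r ^ (d * a - 1) * exp (- (r ^ d * mp_fun P ?y)))"
        by (simp only: mult_ac)
      then have "ennreal (r ^ (CARD('n) - 1)) * ennreal (H (?ry r) * exp (- mp_fun P (?ry r))) =
        ennreal (H ?y) * ennreal (r ^ (d * a - 1) * exp (- (r ^ d * mp_fun P ?y)))"
        using True H(2) by (simp only: ennreal_mult'[symmetric] zero_le_power less_imp_le)
      then show ?thesis by (simp only: mult.assoc)
    qed simp
    have "indicator (cube i) y *
       ?J =
       indicator (cube i) y * (ennreal (H ?y) * ennreal (fact (a - 1) / (real d * mp_fun P ?y ^ a)))"
      unfolding pt nn_integral_power_exp[OF p P(2) H(3), symmetric] by (subst nn_integral_cmult) auto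
    also have "\<dots> = ennreal (indicator (cube i) y * (H ?y * (fact (a - 1) / (real d * mp_fun P ?y ^ a))))"
      using H(2) by (cases "y \<in> cube i") (simp_all flip: ennreal_mult')
    finally show "indicator (cube i) y *
       ?J =
       ennreal (fact (a - 1) / real d * (indicator (cube i) y * (H ?y / mp_fun P ?y ^ a)))"
      by (simp add: field_simps)
  qed
  finally show ?thesis .
qed

text \<open>Finiteness of the total nonnegative integral forces every face integral to be finite, so
  the identity transfers to Bochner integrals.\<close>

lemma integral_homogeneous_exp_nonneg:
  fixes H :: "('n \<Rightarrow> real) \<Rightarrow> real"
  assumes H: "H \<in> borel_measurable (borel_PiM UNIV)" "\<And>x. H x \<ge> 0" "a \<ge> 1"
    and hom: "\<forall>r>0. \<forall>x. H (\<lambda>k. r * x k) * r ^ CARD('n) = r ^ (d * a) * H x"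
    and int: "integrable (half_PiM) (\<lambda>x. H x * exp (- mp_fun P x))"
  defines "G \<equiv> \<lambda>i y. indicator (cube i) y * (H (hat i y) / mp_fun P (hat i y) ^ a)"
  shows "integrable (face_lborel i) (G i)"
    and "(\<integral>x. H x * exp (- mp_fun P x) \<partial>half_PiM) =
      fact (a - 1) / real d * (\<Sum>i\<in>UNIV. \<integral>y. G i y \<partial>face_lborel i)"
proof -
  note sets_PiM_lborel[measurable_cong]
  let ?c = "fact (a - 1) / real d"
  have [measurable]: "mp_fun P \<in> borel_measurable (borel_PiM UNIV)"
    by (rule measurable_mp_fun) simp
  note [measurable] = H(1)
  have c: "?c > 0" using P(2) by simp
  have hat: "(\<lambda>y k. if k = i then 1 else y k) \<in> borel_PiM (UNIV - {i}) \<rightarrow>\<^sub>M borel_PiM UNIV" for i :: 'n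
  proof (rule measurable_PiM_single')
    fix k :: 'n
    show "(\<lambda>y. if k = i then 1 else y k) \<in> borel_measurable (borel_PiM (UNIV - {i}))"
      by (cases "k = i") (auto intro!: measurable_component_singleton)
  qed auto
  have C: "(UNIV - {i}) \<rightarrow>\<^sub>E {0..1 :: real} \<in> sets (borel_PiM (UNIV - {i}))" for i :: 'n
    by (rule sets_PiM_I_finite) auto
  have G: "G i \<in> borel_measurable (face_lborel i)" for i
  proof -
    note [measurable] = C[of i] measurable_compose[OF hat[of i] H(1)] measurable_compose[OF hat[of i], of "mp_fun P" borel]
    show ?thesis unfolding G_def by measurable
  qed
  have G0: "G i y \<ge> 0" for i y
    using H(2) mp_fun_hat_pos[of i y] unfolding G_def by (intro mult_nonneg_nonneg divide_nonneg_pos) auto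
  have eq: "(\<integral>\<^sup>+x. ennreal (H x * exp (- mp_fun P x)) \<partial>half_PiM) =
    (\<Sum>i\<in>UNIV. \<integral>\<^sup>+y. ennreal (?c * G i y) \<partial>face_lborel i)"
    unfolding G_def by (rule nn_integral_homogeneous_exp[OF H hom])
  have fin: "(\<integral>\<^sup>+x. ennreal (H x * exp (- mp_fun P x)) \<partial>half_PiM) < \<infinity>"
    using int H(2) by (simp add: integrable_iff_bounded)
  have "(\<integral>\<^sup>+y. ennreal (?c * G i y) \<partial>face_lborel i) < \<infinity>" for i
    using fin unfolding eq by (simp add: less_top)
  then have int_cG: "integrable (face_lborel i) (\<lambda>y. ?c * G i y)" for i
    using G G0 c by (intro integrableI_bounded) (auto simp: abs_mult)
  then show intG: "integrable (face_lborel i) (G i)" for i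
    using integrable_mult_right[OF int_cG[of i], where c = "inverse ?c"] P(2) by simp
  have "ennreal (\<integral>x. H x * exp (- mp_fun P x) \<partial>half_PiM) =
    (\<Sum>i\<in>UNIV. ennreal (\<integral>y. ?c * G i y \<partial>face_lborel i))"
    using eq nn_integral_eq_integral[OF int] nn_integral_eq_integral[OF int_cG] H(2) G0 c by simp
  also have "\<dots> = ennreal (\<Sum>i\<in>UNIV. \<integral>y. ?c * G i y \<partial>face_lborel i)"
    using G0 c by (intro sum_ennreal Bochner_Integration.integral_nonneg) auto
  finally have "(\<integral>x. H x * exp (- mp_fun P x) \<partial>half_PiM) =
     (\<Sum>i\<in>UNIV. \<integral>y. ?c * G i y \<partial>face_lborel i)"
    using H(2) G0 c by (subst (asm) ennreal_inj) (auto intro!: sum_nonneg Bochner_Integration.integral_nonneg)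
  also have "\<dots> = ?c * (\<Sum>i\<in>UNIV. \<integral>y. G i y \<partial>face_lborel i)"
    by (simp add: sum_distrib_left)
  finally show "(\<integral>x. H x * exp (- mp_fun P x) \<partial>half_PiM) =
      ?c * (\<Sum>i\<in>UNIV. \<integral>y. G i y \<partial>face_lborel i)" .
qed

text \<open>The positive and negative parts of \<open>H\<close> are homogeneous of the same degree,
  because the scaling factors are nonnegative; the nonnegative case applies to each.\<close>

lemma integral_homogeneous_exp:
  fixes H :: "('n \<Rightarrow> real) \<Rightarrow> real"
  assumes H: "H \<in> borel_measurable (borel_PiM UNIV)" "a \<ge> 1"
    and hom: "\<forall>r>0. \<forall>x. H (\<lambda>k. r * x k) * r ^ CARD('n) = r ^ (d * a) * H x"
    and int: "integrable (half_PiM) (\<lambda>x. H x * exp (- mp_fun P x))"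
  shows "(\<integral>x. H x * exp (- mp_fun P x) \<partial>half_PiM) =
      fact (a - 1) / real d * (\<Sum>i\<in>UNIV. \<integral>y. indicator (cube i) y *
        (H (hat i y) / mp_fun P (hat i y) ^ a) \<partial>face_lborel i)"
proof -
  have [measurable]: "mp_fun P \<in> borel_measurable (borel_PiM UNIV)"
    by (rule measurable_mp_fun) simp
  note sets_PiM_half[measurable_cong]
  note [measurable] = H(1)
  define A where "A = (\<lambda>x. max 0 (H x))"
  define B where "B = (\<lambda>x. max 0 (- H x))"
  have HAB: "H x = A x - B x" for x by (auto simp: A_def B_def)
  have m: "A \<in> borel_measurable (borel_PiM UNIV)" "B \<in> borel_measurable (borel_PiM UNIV)"
    unfolding A_def B_def by measurable
  have max: "max 0 (c * z) = c * max 0 z" if "c \<ge> 0" for c z :: real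
    using that by (auto simp: max_def mult_le_0_iff zero_le_mult_iff)
  have homA: "\<forall>r>0. \<forall>x. A (\<lambda>k. r * x k) * r ^ CARD('n) = r ^ (d * a) * A x"
    and homB: "\<forall>r>0. \<forall>x. B (\<lambda>k. r * x k) * r ^ CARD('n) = r ^ (d * a) * B x"
  proof (safe)
    fix r :: real and x assume r: "r > 0"
    have c: "r ^ CARD('n) \<ge> 0" "r ^ (d * a) \<ge> 0" using r by auto
    show "A (\<lambda>k. r * x k) * r ^ CARD('n) = r ^ (d * a) * A x"
      unfolding A_def using max[OF c(1), of "H (\<lambda>k. r * x k)"] max[OF c(2), of "H x"] hom[rule_format, OF r, of x]
      by (simp add: mult.commute)
    show "B (\<lambda>k. r * x k) * r ^ CARD('n) = r ^ (d * a) * B x"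
      unfolding B_def using max[OF c(1), of "- H (\<lambda>k. r * x k)"] max[OF c(2), of "- H x"] hom[rule_format, OF r, of x]
      by (simp add: mult.commute)
  qed
  have nn: "A x \<ge> 0" "B x \<ge> 0" for x by (auto simp: A_def B_def)
  have mA: "(\<lambda>x. A x * exp (- mp_fun P x)) \<in> borel_measurable (half_PiM)"
    and mB: "(\<lambda>x. B x * exp (- mp_fun P x)) \<in> borel_measurable (half_PiM)"
    using m by measurable
  have iA: "integrable (half_PiM) (\<lambda>x. A x * exp (- mp_fun P x))"
    by (rule Bochner_Integration.integrable_bound[OF int mA]) (auto simp: A_def abs_mult)
  have iB: "integrable (half_PiM) (\<lambda>x. B x * exp (- mp_fun P x))"
    by (rule Bochner_Integration.integrable_bound[OF int mB]) (auto simp: B_def abs_mult)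
  note resA = integral_homogeneous_exp_nonneg[OF m(1) nn(1) H(2) homA iA]
  note resB = integral_homogeneous_exp_nonneg[OF m(2) nn(2) H(2) homB iB]
  have "(\<integral>x. H x * exp (- mp_fun P x) \<partial>half_PiM) =
    (\<integral>x. A x * exp (- mp_fun P x) \<partial>half_PiM) - (\<integral>x. B x * exp (- mp_fun P x) \<partial>half_PiM)"
    unfolding HAB left_diff_distrib by (rule Bochner_Integration.integral_diff[OF iA iB])
  also have "\<dots> = fact (a - 1) / real d * (\<Sum>i\<in>UNIV. \<integral>y. indicator (cube i) y *
        (H (hat i y) / mp_fun P (hat i y) ^ a) \<partial>face_lborel i)"
    unfolding HAB diff_divide_distrib right_diff_distrib
    using resA(2) resB(2)
    by (subst Bochner_Integration.integral_diff[OF resA(1) resB(1)])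
       (simp add: sum_subtractf right_diff_distrib)
  finally show ?thesis .
qed

end

section \<open>Mellin transforms and analytic continuation\<close>

text \<open>
  Expanding \<open>exp (w * l x)\<close> around \<open>w = s\<close> under the integral gives a power series in \<open>w - s\<close>,
  so no differentiation under the integral sign is needed.
\<close>

lemma holomorphic_exp_integral:
  fixes l g :: "'a \<Rightarrow> real"
  assumes [measurable]: "l \<in> borel_measurable M" "g \<in> borel_measurable M"
    and int: "\<And>x. x > \<sigma> \<Longrightarrow> integrable M (\<lambda>y. exp (x * l y) * g y)"
  shows "(\<lambda>s. \<integral>y. exp (s * of_real (l y)) * of_real (g y) \<partial>M) holomorphic_on {s :: complex. Re s > \<sigma>}"
proof -
  let ?F = "\<lambda>s. \<integral>y. exp (s * of_real (l y)) * of_real (g y) \<partial>M :: complex"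
  have "?F holomorphic_on ball s ((Re s - \<sigma>) / 2)" if s: "Re s > \<sigma>" for s
  proof (rule power_series_holomorphic)
    fix w assume w: "w \<in> ball s ((Re s - \<sigma>) / 2)"
    define r where "r = norm (w - s)"
    have r: "r \<ge> 0" "r < (Re s - \<sigma>) / 2" using w by (auto simp: r_def dist_norm norm_minus_commute)
    let ?E = "\<lambda>y. exp (s * of_real (l y)) * of_real (g y) :: complex"
    let ?h = "\<lambda>k y. of_real (l y ^ k / fact k) * ?E y :: complex"
    let ?f = "\<lambda>k y. (w - s) ^ k * ?h k y"
    let ?G = "\<lambda>y. exp (r * \<bar>l y\<bar>) * (exp (Re s * l y) * \<bar>g y\<bar>)"
    have norm_f: "norm (?f k y) = (r * \<bar>l y\<bar>) ^ k / fact k * (exp (Re s * l y) * \<bar>g y\<bar>)" for k y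
      by (simp add: norm_mult norm_power norm_divide r_def power_mult_distrib power_abs)
    have f_sums: "(\<lambda>k. ?f k y) sums (exp (w * of_real (l y)) * of_real (g y))" for y
    proof -
      have "(\<lambda>k. ((w - s) * of_real (l y)) ^ k /\<^sub>R fact k * ?E y) sums
        (exp ((w - s) * of_real (l y)) * ?E y)"
        by (intro sums_mult2 exp_converges)
      also have "(\<lambda>k. ((w - s) * of_real (l y)) ^ k /\<^sub>R fact k * ?E y) = (\<lambda>k. ?f k y)"
        by (rule ext, subst power_mult_distrib) (simp add: scaleR_conv_of_real divide_inverse mult_ac)
      also have "exp ((w - s) * of_real (l y)) * ?E y = exp (w * of_real (l y)) * of_real (g y)"
        by (simp add: mult.assoc[symmetric] flip: exp_add) (simp add: algebra_simps)
      finally show ?thesis .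
    qed
    have norm_sums: "(\<lambda>k. norm (?f k y)) sums ?G y" for y
    proof -
      have "(\<lambda>k. (r * \<bar>l y\<bar>) ^ k /\<^sub>R fact k * (exp (Re s * l y) * \<bar>g y\<bar>)) sums ?G y"
        by (intro sums_mult2 exp_converges)
      then show ?thesis unfolding norm_f by (simp add: field_simps)
    qed
    \<comment> \<open>The norms of the series sum to \<open>?G\<close>. Depending on the sign of
      \<open>l y\<close>, it equals one of the integrands at Re s + r and Re s - r; both lie in the
      half-plane of integrability since the radius is half the distance to its boundary.\<close>
    have "integrable M (\<lambda>y. \<bar>exp ((Re s + r) * l y) * g y\<bar> + \<bar>exp ((Re s - r) * l y) * g y\<bar>)"
      using r s by (intro Bochner_Integration.integrable_add integrable_abs int) (auto simp: field_simps)
    then have int_G: "integrable M ?G"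
    proof (rule Bochner_Integration.integrable_bound, safe intro!: AE_I2)
      fix y
      have "exp (r * \<bar>l y\<bar>) * exp (Re s * l y) \<le> exp ((Re s + r) * l y) + exp ((Re s - r) * l y)"
      proof (cases "l y \<ge> 0")
        case True
        then have "exp (r * \<bar>l y\<bar>) * exp (Re s * l y) = exp ((Re s + r) * l y)"
          by (simp add: algebra_simps flip: exp_add)
        then show ?thesis by simp
      next
        case False
        then have "exp (r * \<bar>l y\<bar>) * exp (Re s * l y) = exp ((Re s - r) * l y)"
          by (simp add: algebra_simps flip: exp_add)
        then show ?thesis by simp
      qed
      then have "exp (r * \<bar>l y\<bar>) * exp (Re s * l y) * \<bar>g y\<bar> \<le> (exp ((Re s + r) * l y) + exp ((Re s - r) * l y)) * \<bar>g y\<bar>"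
        by (rule mult_right_mono) simp
      then show "norm (?G y) \<le> norm (\<bar>exp ((Re s + r) * l y) * g y\<bar> + \<bar>exp ((Re s - r) * l y) * g y\<bar>)"
        by (simp add: abs_mult distrib_right mult.assoc)
    qed simp
    have le_G: "norm (?f k y) \<le> ?G y" for k y
      using sum_le_suminf[OF sums_summable[OF norm_sums[of y]], of "{k}"] sums_unique[OF norm_sums[of y]] by simp
    have int_f: "integrable M (?f k)" for k
      by (rule Bochner_Integration.integrable_bound[OF int_G])
         (use le_G in \<open>auto intro!: AE_I2 order.trans[OF le_G abs_ge_self]\<close>)
    have "(\<lambda>k. \<integral>y. ?f k y \<partial>M) sums (\<integral>y. suminf (\<lambda>k. ?f k y) \<partial>M)"
    proof (rule sums_integral)
      show "AE y in M. summable (\<lambda>k. norm (?f k y))"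
        using norm_sums by (intro AE_I2) (auto simp: sums_iff)
      show "summable (\<lambda>k. \<integral>y. norm (?f k y) \<partial>M)"
      proof (rule summableI_nonneg_bounded)
        fix n
        have "(\<Sum>k<n. \<integral>y. norm (?f k y) \<partial>M) = (\<integral>y. (\<Sum>k<n. norm (?f k y)) \<partial>M)"
          using int_f by (intro Bochner_Integration.integral_sum[symmetric] integrable_norm) auto
        also have "\<dots> \<le> integral\<^sup>L M ?G"
        proof (rule integral_mono)
          fix y
          show "(\<Sum>k<n. norm (?f k y)) \<le> ?G y"
            using sum_le_suminf[OF sums_summable[OF norm_sums[of y]], of "{..<n}"] sums_unique[OF norm_sums[of y]] by simp
        qed (use int_f int_G in \<open>auto intro!: Bochner_Integration.integrable_sum integrable_norm\<close>)
        finally show "(\<Sum>k<n. \<integral>y. norm (?f k y) \<partial>M) \<le> integral\<^sup>L M ?G" .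
      qed simp
    qed (rule int_f)
    also have "(\<integral>y. suminf (\<lambda>k. ?f k y) \<partial>M) = ?F w"
      using sums_unique[OF f_sums] by simp
    finally show "(\<lambda>k. (\<integral>y. ?h k y \<partial>M) * (w - s) ^ k) sums ?F w"
      by (simp add: mult.commute)
  qed
  then have "?F analytic_on {s. Re s > \<sigma>}"
    unfolding analytic_on_def using divide_pos_pos by (metis (mono_tags, lifting) diff_gt_0_iff_gt mem_Collect_eq zero_less_numeral)
  then show ?thesis by (rule analytic_imp_holomorphic)
qed

section \<open>Mellin transforms of exponential sums\<close>

lemma Gamma_scaled_integral:
  fixes p s :: real
  assumes "p > 0" "s > 0"
  shows "has_bochner_integral lborel (\<lambda>t. indicator {0<..} t * (t powr (s - 1) * exp (- (t * p)))) (Gamma s * p powr (- s))"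
proof (rule has_bochner_integral_nn_integral)
  let ?g = "\<lambda>t :: real. indicator {0<..} t * (t powr (s - 1) * exp (- (t * p)))"
  let ?N = "\<integral>\<^sup>+t. ennreal (?g t) \<partial>lborel"
  have "ennreal (Gamma s) = (\<integral>\<^sup>+t. ennreal (indicator {0..} t * t powr (s - 1) / exp t) \<partial>lborel)"
    using Gamma_conv_nn_integral_real[of s] assms by simp
  also have "\<dots> = ennreal p * (\<integral>\<^sup>+t. ennreal (indicator {0..} (p * t) * (p * t) powr (s - 1) / exp (p * t)) \<partial>lborel)"
    using assms nn_integral_real_affine[of "\<lambda>t. ennreal (indicator {0..} t * t powr (s - 1) / exp t)" p 0] by simp
  also have "(\<lambda>t. ennreal (indicator {0..} (p * t) * (p * t) powr (s - 1) / exp (p * t))) = (\<lambda>t. ennreal (p powr (s - 1)) * ennreal (?g t))"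
  proof
    fix t
    have "indicator {0..} (p * t) * (p * t) powr (s - 1) / exp (p * t) = p powr (s - 1) * ?g t"
      using assms by (cases "t > 0"; cases "t = 0")
        (auto simp: powr_mult exp_minus field_simps zero_le_mult_iff indicator_def)
    then show "ennreal (indicator {0..} (p * t) * (p * t) powr (s - 1) / exp (p * t)) = ennreal (p powr (s - 1)) * ennreal (?g t)"
      by (simp flip: ennreal_mult')
  qed
  also have "(\<integral>\<^sup>+t. ennreal (p powr (s - 1)) * ennreal (?g t) \<partial>lborel) = ennreal (p powr (s - 1)) * ?N"
    by (rule nn_integral_cmult) measurable
  also have "ennreal p * \<dots> = ennreal (p powr s) * ?N"
    using assms by (simp add: mult.assoc[symmetric] powr_mult_base flip: ennreal_mult')
  finally have eq: "ennreal (Gamma s) = ennreal (p powr s) * ?N" .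
  have "ennreal (Gamma s * p powr (- s)) = ennreal (p powr (- s)) * ennreal (Gamma s)"
    by (subst mult.commute) (simp add: ennreal_mult')
  also have "\<dots> = ?N"
    unfolding eq using assms by (simp add: mult.assoc[symmetric] flip: ennreal_mult' powr_add)
  finally show "?N = ennreal (Gamma s * p powr (- s))" ..
  show "Gamma s * p powr (- s) \<ge> 0" using assms by (intro mult_nonneg_nonneg less_imp_le[OF Gamma_real_pos]) auto
qed (auto intro!: AE_I2)

text \<open>Fubini for the counting measure against Lebesgue measure. The inner integral of the
  absolute value is \<Gamma>(s) |w p^-s|, so the assumed absolute convergence is exactly what the
  interchange needs.\<close>

lemma mellin_exp_sum:
  fixes w p :: "'a \<Rightarrow> real" and s :: real
  assumes A: "countable A" and p: "\<And>m. m \<in> A \<Longrightarrow> p m > 0" and s: "s > 0"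
    and sum: "integrable (count_space A) (\<lambda>m. w m * p m powr (- s))"
  defines "\<Theta> \<equiv> \<lambda>t. \<integral>m. w m * exp (- (t * p m)) \<partial>count_space A"
  shows "integrable lborel (\<lambda>t. indicator {0<..} t * (t powr (s - 1) * \<Theta> t))"
    and "(\<integral>t. indicator {0<..} t * (t powr (s - 1) * \<Theta> t) \<partial>lborel) = Gamma s * (\<integral>m. w m * p m powr (- s) \<partial>count_space A)"
    and "\<Theta> \<in> borel_measurable borel"
proof -
  interpret C: sigma_finite_measure "count_space A" by (rule sigma_finite_measure_count_space_countable[OF A])
  interpret pair_sigma_finite "count_space A" lborel
    by (intro pair_sigma_finite.intro C.sigma_finite_measure_axioms sigma_finite_lborel)
  let ?m = "\<lambda>t. indicator {0<..} t * (t powr (s - 1) * \<Theta> t)"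
  let ?f = "\<lambda>(m, t). indicator {0<..} t * (t powr (s - 1) * (w m * exp (- (t * p m))))"
  have G: "has_bochner_integral lborel (\<lambda>t. ?f (m, t)) (w m * (Gamma s * p m powr (- s)))" if "m \<in> A" for m
    using has_bochner_integral_mult_right[OF Gamma_scaled_integral[OF p[OF that] s], of "w m"] by (simp add: mult_ac)
  have G': "has_bochner_integral lborel (\<lambda>t. norm (?f (m, t))) (Gamma s * \<bar>w m * p m powr (- s)\<bar>)" if "m \<in> A" for m
    using has_bochner_integral_mult_right[OF Gamma_scaled_integral[OF p[OF that] s], of "\<bar>w m\<bar>"] by (simp add: mult_ac abs_mult)
  have meas: "?f \<in> borel_measurable (count_space A \<Otimes>\<^sub>M lborel)"
    by (rule measurable_pair_measure_countable1[OF A]) (simp add: case_prod_unfold)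
  have int: "integrable (count_space A \<Otimes>\<^sub>M lborel) ?f"
  proof (rule Fubini_integrable[OF meas])
    have "integrable (count_space A) (\<lambda>m. Gamma s * \<bar>w m * p m powr (- s)\<bar>)"
      using sum by (intro integrable_mult_right integrable_abs)
    also have "?this \<longleftrightarrow> integrable (count_space A) (\<lambda>m. \<integral>t. norm (?f (m, t)) \<partial>lborel)"
      by (rule Bochner_Integration.integrable_cong[OF refl])
         (simp only: G'[THEN has_bochner_integral_integral_eq] space_count_space)
    finally show "integrable (count_space A) (\<lambda>m. \<integral>t. norm (?f (m, t)) \<partial>lborel)" .
    show "AE m in count_space A. integrable lborel (\<lambda>t. ?f (m, t))"
      using G[THEN has_bochner_integral_iff[THEN iffD1]] by (simp add: AE_count_space)
  qed
  have inner: "(\<integral>m. ?f (m, t) \<partial>count_space A) = ?m t" for t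
    by (simp add: \<Theta>_def)
  show "integrable lborel (\<lambda>t. ?m t)"
    using integrable_snd[of "\<lambda>m t. ?f (m, t)"] int unfolding inner[symmetric] by (simp add: case_prod_unfold)
  have "(\<integral>t. ?m t \<partial>lborel) = (\<integral>t. (\<integral>m. ?f (m, t) \<partial>count_space A) \<partial>lborel)"
    unfolding inner ..
  also have "\<dots> = (\<integral>m. (\<integral>t. ?f (m, t) \<partial>lborel) \<partial>count_space A)"
    using Fubini_integral[of "\<lambda>m t. ?f (m, t)"] int by (simp add: case_prod_unfold)
  also have "\<dots> = (\<integral>m. Gamma s * (w m * p m powr (- s)) \<partial>count_space A)"
    using G[THEN has_bochner_integral_integral_eq] by (intro Bochner_Integration.integral_cong) (auto simp: mult_ac)
  finally show "(\<integral>t. ?m t \<partial>lborel) = Gamma s * (\<integral>m. w m * p m powr (- s) \<partial>count_space A)"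
    by simp
  have "(\<lambda>(m, t). w m * exp (- (t * p m))) \<in> borel_measurable (count_space A \<Otimes>\<^sub>M borel)"
    by (rule measurable_pair_measure_countable1[OF A]) (simp add: case_prod_unfold)
  then have "(\<lambda>(t, m). w m * exp (- (t * p m))) \<in> borel_measurable (borel \<Otimes>\<^sub>M count_space A)"
    by (subst measurable_pair_swap_iff) (simp add: case_prod_unfold)
  then show "\<Theta> \<in> borel_measurable borel"
    unfolding \<Theta>_def by (rule C.borel_measurable_lebesgue_integral)
qed

lemma integral_powr_unit_interval:
  fixes x :: real
  assumes "x > 0"
  shows "has_bochner_integral lborel (\<lambda>t. indicator {0<..1} t * t powr (x - 1)) (1 / x)"
proof -
  have *: "((\<lambda>t. t powr (x - 1)) has_integral (1 powr ((x - 1) + 1) / ((x - 1) + 1))) {0..1}"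
    by (rule has_integral_powr_from_0) (use assms in auto)
  have "((\<lambda>t. if t \<in> {0..1} then t powr (x - 1) else 0) has_integral 1 / x) UNIV"
    using * by (subst has_integral_restrict_UNIV) simp
  also have "(\<lambda>t. if t \<in> {0..1} then t powr (x - 1) else 0) = (\<lambda>t. indicator {0<..1} t * t powr (x - 1))"
    by (auto simp: fun_eq_iff indicator_def)
  finally show ?thesis
    using assms by (intro has_bochner_integral_nn_integral nn_integral_has_integral_lborel[of _ "1 / x"]) (auto intro!: AE_I2)
qed

text \<open>
  The Mellin transform of \<open>\<Theta>\<close> is compared with \<open>\<Gamma> * Z\<close> on the real axis only; the identity theorem
  for meromorphic functions does the rest.
\<close>

lemma mellin_continuation_value:
  fixes \<Theta> :: "real \<Rightarrow> real" and Z :: "complex \<Rightarrow> complex" and c a :: "'b \<Rightarrow> real"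
  assumes \<Theta>: "\<Theta> \<in> borel_measurable borel" and B: "finite B"
    and asym: "\<And>t. 0 < t \<Longrightarrow> t \<le> 1 \<Longrightarrow> \<bar>\<Theta> t - (\<Sum>\<gamma>\<in>B. c \<gamma> * t powr a \<gamma>)\<bar> \<le> C * t powr \<rho>"
    and int: "\<And>s. s > \<sigma> \<Longrightarrow> integrable lborel (\<lambda>t. indicator {0<..} t * (t powr (s - 1) * \<Theta> t))"
    and Z: "Z nicely_meromorphic_on UNIV"
    and mellin: "\<And>s. s > \<sigma> \<Longrightarrow> s > 0 \<Longrightarrow> of_real (Gamma s) * Z (of_real s) = of_real (\<integral>t. indicator {0<..} t * (t powr (s - 1) * \<Theta> t) \<partial>lborel)"
    and \<rho>: "\<rho> > real N"
  shows "\<not> is_pole Z (- of_nat N) \<and> Z (- of_nat N) = of_real ((- 1) ^ N * fact N * (\<Sum>\<gamma> | \<gamma> \<in> B \<and> a \<gamma> = real N. c \<gamma>))"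
proof -
  note [measurable] = \<Theta>
  define R where "R t = \<Theta> t - (\<Sum>\<gamma>\<in>B. c \<gamma> * t powr a \<gamma>)" for t
  let ?m0 = "\<lambda>s t. indicator {0<..} t * (t powr (s - 1) * \<Theta> t)" and ?m1 = "\<lambda>s t. indicator {0<..1} t * (t powr (s - 1) * R t)"
    and ?m2 = "\<lambda>s t. indicator {1<..} t * (t powr (s - 1) * \<Theta> t)"
  let ?k = "\<lambda>s \<gamma> t. c \<gamma> * (indicator {0<..1} t * t powr (s + a \<gamma> - 1))"
  have [measurable]: "R \<in> borel_measurable borel" unfolding R_def[abs_def] by measurable
  let ?g1 = "\<lambda>t. indicator {0<..1} t * R t / t" and ?g2 = "\<lambda>t. indicator {1<..} t * \<Theta> t / t"
  define A where "A s = (\<integral>t. exp (s * of_real (ln t)) * of_real (?g1 t) \<partial>lborel)" for s :: complex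
  define D where "D s = (\<integral>t. exp (s * of_real (ln t)) * of_real (?g2 t) \<partial>lborel)" for s :: complex
  let ?H = "{s. Re s > - \<rho>}"
  have powr: "t powr (s - 1) = exp (s * ln t) / t" if "t > 0" for s t :: real
    using that by (simp add: powr_diff) (simp add: powr_def)
  have g1: "exp (s * ln t) * ?g1 t = ?m1 s t" for s t
    by (simp add: powr indicator_def)
  have g2: "exp (s * ln t) * ?g2 t = ?m2 s t" for s t
    by (simp add: powr indicator_def)
  have int1: "integrable lborel (\<lambda>t. ?m1 s t)" if s: "s > - \<rho>" for s
  proof (rule Bochner_Integration.integrable_bound)
    show "integrable lborel (\<lambda>t. C * (indicator {0<..1} t * t powr (s + \<rho> - 1)))"
      using integral_powr_unit_interval[of "s + \<rho>"] s by (intro integrable_mult_right) (auto simp: has_bochner_integral_iff)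
    show "AE t in lborel. norm (?m1 s t) \<le> norm (C * (indicator {0<..1} t * t powr (s + \<rho> - 1)))"
    proof (rule AE_I2)
      fix t :: real
      show "norm (?m1 s t) \<le> norm (C * (indicator {0<..1} t * t powr (s + \<rho> - 1)))"
      proof (cases "0 < t \<and> t \<le> 1")
        case True
        have "t powr (s - 1) * \<bar>R t\<bar> \<le> t powr (s - 1) * (C * t powr \<rho>)"
          using asym[of t] True by (intro mult_left_mono) (auto simp: R_def)
        also have "\<dots> = C * t powr (s + \<rho> - 1)" by (simp add: algebra_simps flip: powr_add)
        finally show ?thesis using True by (simp add: abs_mult) (meson abs_ge_self order_trans mult_right_mono powr_ge_zero)
      qed auto
    qed
  qed measurable
  have int2: "integrable lborel (\<lambda>t. ?m2 s t)" for s
  proof (rule Bochner_Integration.integrable_bound)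
    \<comment> \<open>For t > 1 a larger exponent only enlarges the integrand, so integrability far
      to the right gives it for every s.\<close>
    define s' where "s' = max s (\<sigma> + 1)"
    show "integrable lborel (\<lambda>t. indicator {0<..} t * (t powr (s' - 1) * \<Theta> t))"
      by (rule int) (simp add: s'_def)
    show "AE t in lborel. norm (?m2 s t) \<le> norm (indicator {0<..} t * (t powr (s' - 1) * \<Theta> t))"
      by (rule AE_I2) (auto simp: abs_mult indicator_def s'_def intro!: mult_right_mono powr_mono)
  qed measurable
  have holo: "A holomorphic_on ?H" "D holomorphic_on ?H"
    unfolding A_def D_def
    by (rule holomorphic_exp_integral; (use int1 int2 in \<open>unfold g1 g2\<close>)?; simp)+
  \<comment> \<open>The Mellin integral is split at t = 1: \<open>A\<close> carries the remainder
    near 0, \<open>D\<close> the part beyond 1, and each power t^a integrates to 1 / (s + a) on (0,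
    1]. This continues the transform to Re s > -\<rho>, which contains -N.\<close>
  define W where "W s = rGamma s * (A s + D s + (\<Sum>\<gamma>\<in>B. of_real (c \<gamma>) / (s + of_real (a \<gamma>))))" for s :: complex
  have open_H: "open ?H" "connected ?H"
    by (simp_all add: open_halfspace_Re_gt convex_connected convex_halfspace_Re_gt)
  have mero_AD: "A meromorphic_on ?H" "D meromorphic_on ?H"
    using holo open_H by (auto intro!: analytic_on_imp_meromorphic_on simp: analytic_on_open)
  have W_mero: "W meromorphic_on ?H"
  proof -
    have "rGamma meromorphic_on ?H"
      by (intro analytic_on_imp_meromorphic_on analytic_rGamma)
    then show ?thesis
      unfolding W_def[abs_def] using mero_AD by (intro meromorphic_intros) auto
  qed
  \<comment> \<open>Beyond this abscissa all pieces converge simultaneously, including the separate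
    powers of t.\<close>
  define \<sigma>1 where "\<sigma>1 = Max (insert \<sigma> (insert 0 ((\<lambda>\<gamma>. - a \<gamma>) ` B)))"
  have s1: "\<sigma>1 \<ge> \<sigma>" "\<sigma>1 \<ge> 0" "\<And>\<gamma>. \<gamma> \<in> B \<Longrightarrow> \<sigma>1 \<ge> - a \<gamma>"
    unfolding \<sigma>1_def using B by (intro Max_ge; simp)+
  have eq: "Z (of_real s) = W (of_real s)" if s: "s > \<sigma>1" for s :: real
  proof -
    have s0: "s > \<sigma>" "s > 0" "s > - \<rho>" "\<And>\<gamma>. \<gamma> \<in> B \<Longrightarrow> s + a \<gamma> > 0"
      using s s1 \<rho> by force+
    have "A (of_real s) = of_real (\<integral>t. ?m1 s t \<partial>lborel)"
      unfolding A_def g1[symmetric] by (subst integral_complex_of_real[symmetric]) (simp flip: exp_of_real)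
    moreover have "D (of_real s) = of_real (\<integral>t. ?m2 s t \<partial>lborel)"
      unfolding D_def g2[symmetric] by (subst integral_complex_of_real[symmetric]) (simp flip: exp_of_real)
    moreover have "(\<integral>t. ?m0 s t \<partial>lborel) =
      (\<integral>t. ?m1 s t \<partial>lborel) + (\<integral>t. ?m2 s t \<partial>lborel) +
      (\<Sum>\<gamma>\<in>B. c \<gamma> / (s + a \<gamma>))"
    proof -
      have hb: "has_bochner_integral lborel (\<lambda>t. ?k s \<gamma> t) (c \<gamma> * (1 / (s + a \<gamma>)))"
        if "\<gamma> \<in> B" for \<gamma>
        by (intro has_bochner_integral_mult_right integral_powr_unit_interval s0 that)
      have "has_bochner_integral lborel (\<lambda>t. ?m1 s t + ?m2 s t +
           (\<Sum>\<gamma>\<in>B. ?k s \<gamma> t))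
        ((\<integral>t. ?m1 s t \<partial>lborel) + (\<integral>t. ?m2 s t \<partial>lborel) +
        (\<Sum>\<gamma>\<in>B. c \<gamma> * (1 / (s + a \<gamma>))))"
        using int1[OF s0(3)] int2[of s]
        by (intro has_bochner_integral_add has_bochner_integral_sum hb has_bochner_integral_integrable)
      also have "(\<lambda>t. ?m1 s t + ?m2 s t +
           (\<Sum>\<gamma>\<in>B. ?k s \<gamma> t)) = (\<lambda>t. ?m0 s t)"
      proof
        fix t :: real
        consider "t \<le> 0" | "0 < t" "t \<le> 1" | "t > 1" by linarith
        then show "?m1 s t + ?m2 s t +
           (\<Sum>\<gamma>\<in>B. ?k s \<gamma> t) = ?m0 s t"
        proof cases
          case 2
          have "(\<Sum>\<gamma>\<in>B. c \<gamma> * t powr (s + a \<gamma> - 1)) = t powr (s - 1) * (\<Sum>\<gamma>\<in>B. c \<gamma> * t powr a \<gamma>)"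
            by (simp add: sum_distrib_left algebra_simps flip: powr_add)
          with 2 show ?thesis by (simp add: R_def algebra_simps)
        qed auto
      qed
      finally show ?thesis by (simp add: has_bochner_integral_iff)
    qed
    ultimately have "of_real (Gamma s) * Z (of_real s) = A (of_real s) + D (of_real s) + (\<Sum>\<gamma>\<in>B. of_real (c \<gamma>) / (of_real s + of_real (a \<gamma>)))"
      using mellin[OF s0(1,2)] by simp
    then have "W (of_real s) = rGamma (of_real s) * (of_real (Gamma s) * Z (of_real s))" by (simp add: W_def)
    also have "\<dots> = Z (of_real s)"
      using Gamma_real_pos[OF s0(2)] by (simp add: rGamma_inverse_Gamma Gamma_complex_of_real)
    finally show ?thesis ..
  qed
  have ZW_mero: "(\<lambda>s. Z s - W s) meromorphic_on ?H"
    using Z W_mero by (intro meromorphic_intros) (auto simp: nicely_meromorphic_on_def intro: meromorphic_on_subset)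
  \<comment> \<open>A meromorphic difference either vanishes or avoids 0 off a sparse set. The
    second case is impossible, as real points accumulating at \<sigma>1 + 1 are zeros.\<close>
  have "\<not> eventually (\<lambda>s. Z s - W s \<noteq> 0) (cosparse ?H)"
  proof
    assume ev: "eventually (\<lambda>s. Z s - W s \<noteq> 0) (cosparse ?H)"
    let ?z = "of_real (\<sigma>1 + 1) :: complex"
    have "?z \<in> ?H" using s1 \<rho> by auto
    with ev have "eventually (\<lambda>s. Z s - W s \<noteq> 0) (at ?z)"
      using open_H by (simp add: eventually_cosparse_open_eq)
    moreover have "filterlim (\<lambda>x :: real. of_real x :: complex) (at ?z) (at (\<sigma>1 + 1))"
      unfolding filterlim_at eventually_at_filter
      by (intro conjI always_eventually tendsto_of_real tendsto_ident_at) (simp del: of_real_add)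
    ultimately have "eventually (\<lambda>x. Z (of_real x) - W (of_real x) \<noteq> 0) (at (\<sigma>1 + 1))"
      by (rule eventually_compose_filterlim)
    moreover have "eventually (\<lambda>x. x > \<sigma>1) (at (\<sigma>1 + 1))"
      using eventually_at_in_open'[of "{\<sigma>1<..}" "\<sigma>1 + 1"] by simp
    ultimately have "eventually (\<lambda>_. False) (at (\<sigma>1 + 1))"
      by eventually_elim (use eq in auto)
    then show False by simp
  qed
  then have "eventually (\<lambda>s. Z s - W s = 0) (cosparse ?H)"
    using meromorphic_imp_constant_or_avoid[OF ZW_mero open_H, of 0] by auto
  moreover have N_in: "- of_nat N \<in> ?H" using \<rho> by simp
  ultimately have "eventually (\<lambda>s. Z s - W s = 0) (at (- of_nat N))"
    using open_H(1) by (simp only: eventually_cosparse_open_eq)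
  then have near: "eventually (\<lambda>s. W s = Z s) (at (- of_nat N))"
    by eventually_elim simp
  let ?L = "of_real ((- 1) ^ N * fact N * (\<Sum>\<gamma> | \<gamma> \<in> B \<and> a \<gamma> = real N. c \<gamma>)) :: complex"
  have "(W \<longlongrightarrow> ?L) (at (- of_nat N))"
  proof -
    let ?z = "- of_nat N :: complex"
    have deriv: "(rGamma has_field_derivative (- 1) ^ N * fact N) (at ?z)"
      by (rule has_field_derivative_rGamma_nonpos_int)
    have rG0: "rGamma ?z = 0" by (rule rGamma_nonpos_Int) simp
    have lim_rG: "(rGamma \<longlongrightarrow> 0) (at ?z)"
      using DERIV_isCont[OF deriv] rG0 by (simp add: isCont_def)
    \<comment> \<open>Since 1/\<Gamma> vanishes at -N, this quotient is its difference quotient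
      there. It governs the terms with a = N; every other term keeps a factor tending to 0.\<close>
    have lim_quot: "((\<lambda>s. rGamma s / (s + of_nat N)) \<longlongrightarrow> (- 1) ^ N * fact N) (at ?z)"
      using deriv rG0 by (simp add: has_field_derivative_iff)
    have lim_AD: "(A \<longlongrightarrow> A ?z) (at ?z)" "(D \<longlongrightarrow> D ?z) (at ?z)"
      using holo open_H N_in by (meson continuous_on_eq_continuous_at holomorphic_on_imp_continuous_on isCont_def)+
    have lim_term: "((\<lambda>s. rGamma s * (of_real (c \<gamma>) / (s + of_real (a \<gamma>)))) \<longlongrightarrow>
      (if a \<gamma> = real N then of_real (c \<gamma>) * ((- 1) ^ N * fact N) else 0)) (at ?z)" for \<gamma>
    proof (cases "a \<gamma> = real N")
      case True
      have "((\<lambda>s. of_real (c \<gamma>) * (rGamma s / (s + of_nat N))) \<longlongrightarrow> of_real (c \<gamma>) * ((- 1) ^ N * fact N)) (at ?z)"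
        by (intro tendsto_intros lim_quot)
      then show ?thesis using True by (simp add: mult_ac)
    next
      case False
      then have "?z + of_real (a \<gamma>) \<noteq> 0"
        by (metis add.inverse_inverse add_eq_0_iff of_real_eq_iff of_real_of_nat_eq)
      then have "((\<lambda>s. rGamma s * (of_real (c \<gamma>) / (s + of_real (a \<gamma>)))) \<longlongrightarrow> 0 * (of_real (c \<gamma>) / (?z + of_real (a \<gamma>)))) (at ?z)"
        by (intro tendsto_intros lim_rG)
      then show ?thesis using False by simp
    qed
    have "((\<lambda>s. rGamma s * (A s + D s) + (\<Sum>\<gamma>\<in>B. rGamma s * (of_real (c \<gamma>) / (s + of_real (a \<gamma>))))) \<longlongrightarrow>
      0 * (A ?z + D ?z) + (\<Sum>\<gamma>\<in>B. if a \<gamma> = real N then of_real (c \<gamma>) * ((- 1) ^ N * fact N) else 0)) (at ?z)"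
      by (intro tendsto_intros lim_rG lim_AD lim_term)
    moreover have "(\<Sum>\<gamma>\<in>B. if a \<gamma> = real N then of_real (c \<gamma>) * ((- 1) ^ N * fact N) else 0) = ?L"
      using B by (simp add: sum.inter_filter[symmetric] sum_distrib_left mult_ac)
    ultimately show ?thesis
      unfolding W_def[abs_def] by (simp add: distrib_left sum_distrib_left)
  qed
  then have lim: "(Z \<longlongrightarrow> ?L) (at (- of_nat N))"
    by (rule Lim_transform_eventually[OF _ near])
  then have np: "\<not> is_pole Z (- of_nat N)"
    using not_tendsto_and_filterlim_at_infinity[of "at (- of_nat N :: complex)" Z ?L] unfolding is_pole_def by auto
  \<comment> \<open>At a point that is not a pole, nice meromorphy makes the value equal to the
    limit.\<close>
  then have "Z \<midarrow>- of_nat N\<rightarrow> Z (- of_nat N)"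
    using Z by (auto simp: nicely_meromorphic_on_def)
  with lim np show ?thesis using LIM_unique by blast
qed

section \<open>The value of the zeta function\<close>

lemma bij_betw_grid_vectors:
  assumes "h > 0"
  shows "bij_betw (\<lambda>m i. h * real (m i)) {m :: 'n::finite \<Rightarrow> nat. \<forall>i. m i \<ge> 1} (UNIV \<rightarrow>\<^sub>E grid h)"
  unfolding bij_betw_def
proof
  show "inj_on (\<lambda>m i. h * real (m i)) {m :: 'n \<Rightarrow> nat. \<forall>i. m i \<ge> 1}"
    using assms by (auto simp: inj_on_def fun_eq_iff)
  show "(\<lambda>m i. h * real (m i)) ` {m :: 'n \<Rightarrow> nat. \<forall>i. m i \<ge> 1} = UNIV \<rightarrow>\<^sub>E grid h"
  proof (intro equalityI subsetI)
    fix x assume "x \<in> (\<lambda>m i. h * real (m i)) ` {m :: 'n \<Rightarrow> nat. \<forall>i. m i \<ge> 1}"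
    then obtain m where m: "\<forall>i. m i \<ge> 1" "x = (\<lambda>i. h * real (m i))" by blast
    have "h * real (m i) \<in> grid h" for i
      using m(1)[rule_format, of i] by (auto simp: grid_def intro!: image_eqI[of _ _ "m i - 1"])
    then show "x \<in> UNIV \<rightarrow>\<^sub>E grid h" by (simp add: PiE_iff m(2))
  next
    fix x :: "'n \<Rightarrow> real" assume "x \<in> UNIV \<rightarrow>\<^sub>E grid h"
    then have "\<forall>i. \<exists>k. x i = h * real (Suc k)" by (auto simp: PiE_iff grid_def)
    then obtain k where k: "\<forall>i. x i = h * real (Suc (k i))" by (metis (no_types))
    show "x \<in> (\<lambda>m i. h * real (m i)) ` {m :: 'n \<Rightarrow> nat. \<forall>i. m i \<ge> 1}"
      by (rule image_eqI[of _ _ "\<lambda>i. Suc (k i)"]) (use k in \<open>auto simp: fun_eq_iff\<close>)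
  qed
qed

lemma triple_sum_distrib_left:
  fixes c :: real
  shows "c * (\<Sum>\<beta>\<in>S. \<Sum>\<alpha>\<in>T \<beta>. \<Sum>u\<in>U \<alpha>. f \<beta> \<alpha> u) = (\<Sum>\<beta>\<in>S. \<Sum>\<alpha>\<in>T \<beta>. \<Sum>u\<in>U \<alpha>. c * f \<beta> \<alpha> u)"
  by (simp only: sum_distrib_left)

context
  fixes P Q :: "'n::finite mpoly" and d q :: nat
  assumes P: "homogeneous d P" and d: "d \<ge> 1"
    and pos: "\<And>x :: real ^ 'n. x \<noteq> 0 \<Longrightarrow> mpoly_eval P x > 0"
    and Q: "homogeneous q Q"
begin

definition theta :: "real \<Rightarrow> real" where
  "theta t = (\<integral>m. mp_fun Q (\<lambda>i. real (m i)) * exp (- (t * mp_fun P (\<lambda>i. real (m i)))) \<partial>count_space {m. \<forall>i. m i \<ge> 1})"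

definition theta_coeff :: "('n \<Rightarrow> nat) \<Rightarrow> real" where
  "theta_coeff \<gamma> = (\<Prod>i\<in>UNIV. bernoulli_tilde (\<gamma> i) / fact (\<gamma> i)) *
     (\<integral>x. exp_weight P (mder (exp_pderiv P) \<gamma> Q) x \<partial>half_PiM)"

text \<open>With no coordinate converted the product measure counts the grid vectors h m, and
  homogeneity pulls h^q out of \<open>Q\<close> and h^d out of \<open>P\<close>.\<close>

lemma theta_eq_grid_integral:
  assumes "h > 0"
  shows "(\<integral>x. exp_weight P Q x \<partial>Pi\<^sub>M UNIV (mixed h {})) = h ^ q * theta (h ^ d)"
proof -
  have "mixed h ({} :: 'n set) = (\<lambda>_. count_space (grid h))" by (simp add: fun_eq_iff mixed_def)
  then have "Pi\<^sub>M UNIV (mixed h ({} :: 'n set)) = count_space (UNIV \<rightarrow>\<^sub>E grid h)"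
    using count_space_PiM_finite[of "UNIV :: 'n set" "\<lambda>_. grid h"] by (simp add: grid_def)
  then have "(\<integral>x. exp_weight P Q x \<partial>Pi\<^sub>M UNIV (mixed h {})) =
    (\<integral>m. exp_weight P Q (\<lambda>i. h * real (m i)) \<partial>count_space {m. \<forall>i. m i \<ge> 1})"
    using integral_bij_count_space[OF bij_betw_grid_vectors[OF assms], of "exp_weight P Q"] by simp
  also have "\<dots> = (\<integral>m. h ^ q * (mp_fun Q (\<lambda>i. real (m i)) * exp (- (h ^ d * mp_fun P (\<lambda>i. real (m i))))) \<partial>count_space {m. \<forall>i. m i \<ge> 1})"
    by (simp add: exp_weight_def homogeneous_scale[OF P] homogeneous_scale[OF Q] mult.assoc)
  finally show ?thesis by (simp add: theta_def)
qed

text \<open>The orthant expansion with h = t^(1/d), divided by h^(n + q): n powers come from the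
  grid normalization and q from the homogeneity of \<open>Q\<close>.\<close>

lemma theta_asymptotics:
  assumes "K \<ge> 1"
  shows "\<exists>C. \<forall>t. 0 < t \<longrightarrow> t \<le> 1 \<longrightarrow>
    \<bar>theta t - (\<Sum>\<gamma> | \<forall>i. \<gamma> i < K. theta_coeff \<gamma> * t powr ((real (sum \<gamma> UNIV) - real (CARD('n) + q)) / real d))\<bar>
      \<le> C * t powr ((real K - real (CARD('n) + q)) / real d)"
proof -
  obtain C where C: "\<And>h. 0 < h \<Longrightarrow> h \<le> 1 \<Longrightarrow>
    \<bar>h ^ CARD('n) * (\<integral>x. exp_weight P Q x \<partial>Pi\<^sub>M UNIV (mixed h {})) -
     h ^ card (- (UNIV :: 'n set)) * (\<Sum>\<gamma> | \<forall>i. if i \<in> (UNIV :: 'n set) then \<gamma> i < K else \<gamma> i = 0.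
       (\<Prod>i\<in>UNIV. bernoulli_tilde (\<gamma> i) / fact (\<gamma> i)) * h ^ (sum \<gamma> UNIV) *
       (\<integral>x. exp_weight P (mder (exp_pderiv P) \<gamma> Q) x \<partial>Pi\<^sub>M UNIV (mixed h UNIV)))\<bar> \<le> C * h ^ K"
    using euler_maclaurin_mixed[OF P d pos assms finite[of UNIV], of Q] by blast
  show ?thesis
  proof (intro exI[of _ C] allI impI)
    fix t :: real assume t: "0 < t" "t \<le> 1"
    define h where "h = t powr (1 / real d)"
    let ?T = "\<lambda>t. \<Sum>\<gamma> | \<forall>i. \<gamma> i < K. theta_coeff \<gamma> * t powr ((real (sum \<gamma> UNIV) - real (CARD('n) + q)) / real d)"
    let ?N = "h ^ (CARD('n) + q)"
    have h: "0 < h" "h \<le> 1" using t by (auto simp: h_def powr_le1)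
    have pow: "h ^ k = t powr (real k / real d)" for k
      using t by (simp add: h_def powr_powr flip: powr_realpow)
    have hd: "h ^ d = t" using t d unfolding pow by simp
    have mix: "mixed h UNIV = (\<lambda>_ :: 'n. half_lborel)" by (simp add: fun_eq_iff mixed_def)
    let ?S = "\<Sum>\<gamma> | \<forall>i. \<gamma> i < K. theta_coeff \<gamma> * h ^ (sum \<gamma> UNIV)"
    have "\<bar>?N * theta t - ?S\<bar> \<le> C * h ^ K"
      using C[OF h] unfolding theta_eq_grid_integral[OF h(1)] hd mix
      by (simp add: theta_coeff_def mult_ac power_add)
    then have "\<bar>?N * theta t - ?S\<bar> / ?N \<le> C * h ^ K / ?N"
      using h by (intro divide_right_mono) auto
    also have "\<bar>?N * theta t - ?S\<bar> / ?N = \<bar>theta t - ?S / ?N\<bar>"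
    proof -
      have "\<bar>?N * theta t - ?S\<bar> / ?N = \<bar>(?N * theta t - ?S) / ?N\<bar>"
        using h by simp
      also have "(?N * theta t - ?S) / ?N = theta t - ?S / ?N"
        using h by (simp add: diff_divide_distrib)
      finally show ?thesis .
    qed
    also have "?S / ?N = (?T t)"
      unfolding pow sum_divide_distrib by (intro sum.cong refl) (simp only: times_divide_eq_right[symmetric] powr_diff[symmetric] diff_divide_distrib)
    also have "C * h ^ K / ?N = C * t powr ((real K - real (CARD('n) + q)) / real d)"
      unfolding pow by (simp only: times_divide_eq_right[symmetric] powr_diff[symmetric] diff_divide_distrib)
    finally show "\<bar>theta t - (?T t)\<bar>
      \<le> C * t powr ((real K - real (CARD('n) + q)) / real d)" .
  qed
qed

lemma zeta_value_eq_theta_coeffs: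
  assumes "zeta_continuation d q P Q Z"
  shows "\<not> is_pole Z (- of_nat N) \<and> Z (- of_nat N) =
    of_real ((- 1) ^ N * fact N * (\<Sum>\<gamma>\<in>Delta (d * N + q + CARD('n)). theta_coeff \<gamma>))"
proof -
  define M where "M = d * N + q + CARD('n)"
  let ?A = "{m :: 'n \<Rightarrow> nat. \<forall>i. m i \<ge> 1}"
  let ?w = "\<lambda>m :: 'n \<Rightarrow> nat. mp_fun Q (\<lambda>i. real (m i))" and ?p = "\<lambda>m :: 'n \<Rightarrow> nat. mp_fun P (\<lambda>i. real (m i))"
  let ?\<sigma> = "real (CARD('n) + q) / real d"
  have A: "countable ?A" by (rule countableI_type)
  have p: "?p m > 0" if "m \<in> ?A" for m
  proof -
    have "m undefined \<noteq> 0" using that by (auto simp: Suc_le_eq)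
    then have "(\<chi> i. real (m i)) \<noteq> (0 :: real ^ 'n)" by (auto simp: vec_eq_iff)
    from pos[OF this] show ?thesis by (simp add: mpoly_eval_eq_mp_fun)
  qed
  have zeta: "integrable (count_space ?A) (\<lambda>m. ?w m * ?p m powr (- s)) \<and>
     Z (of_real s) = of_real (\<integral>m. ?w m * ?p m powr (- s) \<partial>count_space ?A)" if s: "s > ?\<sigma>" for s :: real
  proof -
    let ?f = "\<lambda>m. ?w m * ?p m powr (- s)"
    have "((\<lambda>m. of_real (?w m) * of_real (?p m) powr (- of_real s)) has_sum Z (of_real s)) ?A"
      using assms s unfolding zeta_continuation_def by (simp add: mpoly_eval_eq_mp_fun)
    also have "?this \<longleftrightarrow> ((\<lambda>m. of_real (?f m) :: complex) has_sum Z (of_real s)) ?A"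
    proof (rule has_sum_cong)
      fix m assume "m \<in> ?A"
      from p[OF this] show "of_real (?w m) * of_real (?p m) powr (- of_real s) = (of_real (?f m) :: complex)"
        using powr_of_real[of "?p m" "- s"] by simp
    qed
    finally have hs: "((\<lambda>m. of_real (?f m) :: complex) has_sum Z (of_real s)) ?A" .
    from has_sum_Re[OF this] have re: "(?f has_sum Re (Z (of_real s))) ?A" by simp
    then have "?f summable_on ?A" by (auto simp: summable_on_def)
    \<comment> \<open>For real families unconditional summability is absolute summability, which
      turns the sum into an integral over the counting measure.\<close>
    then have abs: "Infinite_Set_Sum.abs_summable_on ?f ?A"
      by (rule summable_on_iff_abs_summable_on_real[THEN iffD1, THEN abs_summable_equivalent[THEN iffD1]])
    have "infsum ?f ?A = (\<integral>m. ?f m \<partial>count_space ?A)"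
      using infsetsum_infsum[OF abs] by (simp add: infsetsum_def)
    then have "((\<lambda>m. of_real (?f m) :: complex) has_sum of_real (\<integral>m. ?f m \<partial>count_space ?A)) ?A"
      using infsumI[OF re] re by (intro has_sum_of_real) simp
    then show ?thesis using abs hs has_sum_unique by (auto simp: abs_summable_on_def)
  qed
  have \<sigma>: "?\<sigma> > 0" using d by (intro divide_pos_pos) (auto simp: add_pos_nonneg)
  have mellin: "integrable lborel (\<lambda>t. indicator {0<..} t * (t powr (s - 1) * theta t))"
     "of_real (Gamma s) * Z (of_real s) = of_real (\<integral>t. indicator {0<..} t * (t powr (s - 1) * theta t) \<partial>lborel)"
     "theta \<in> borel_measurable borel"
    if s: "s > ?\<sigma>" for s
  proof -
    have s0: "s > 0" using s \<sigma> by linarith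
    have th: "theta = (\<lambda>t. \<integral>m. ?w m * exp (- (t * ?p m)) \<partial>count_space ?A)"
      by (simp add: fun_eq_iff theta_def)
    show "integrable lborel (\<lambda>t. indicator {0<..} t * (t powr (s - 1) * theta t))"
      unfolding th by (rule mellin_exp_sum(1)[OF A p s0 conjunct1[OF zeta[OF s]]])
    show "theta \<in> borel_measurable borel"
      unfolding th by (rule mellin_exp_sum(3)[OF A p s0 conjunct1[OF zeta[OF s]]])
    have "(\<integral>t. indicator {0<..} t * (t powr (s - 1) * theta t) \<partial>lborel) = Gamma s * (\<integral>m. ?w m * ?p m powr (- s) \<partial>count_space ?A)"
      unfolding th by (rule mellin_exp_sum(2)[OF A p s0 conjunct1[OF zeta[OF s]]])
    then show "of_real (Gamma s) * Z (of_real s) = of_real (\<integral>t. indicator {0<..} t * (t powr (s - 1) * theta t) \<partial>lborel)"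
      using conjunct2[OF zeta[OF s]] by (simp only: of_real_mult)
  qed
  have meas: "theta \<in> borel_measurable borel"
    by (rule mellin(3)[of "?\<sigma> + 1"]) simp
  \<comment> \<open>Order M + 1 is the first whose error exponent exceeds \<open>N\<close>. The box
    of entries at most \<open>M\<close> contains every \<gamma> with |\<gamma>| = M, and these are
    exactly the ones with exponent \<open>N\<close>.\<close>
  have K: "Suc M \<ge> 1" by simp
  obtain C where C: "\<And>t. 0 < t \<Longrightarrow> t \<le> 1 \<Longrightarrow>
    \<bar>theta t - (\<Sum>\<gamma> | \<forall>i. \<gamma> i < Suc M. theta_coeff \<gamma> * t powr ((real (sum \<gamma> UNIV) - real (CARD('n) + q)) / real d))\<bar>
      \<le> C * t powr ((real (Suc M) - real (CARD('n) + q)) / real d)"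
    using theta_asymptotics[OF K] by blast
  have fin: "finite {\<gamma> :: 'n \<Rightarrow> nat. \<forall>i. \<gamma> i < Suc M}"
  proof (rule finite_subset)
    show "{\<gamma> :: 'n \<Rightarrow> nat. \<forall>i. \<gamma> i < Suc M} \<subseteq> UNIV \<rightarrow>\<^sub>E {..M}" by (auto simp: PiE_iff less_Suc_eq_le)
  qed (intro finite_PiE; simp)
  have \<rho>: "(real (Suc M) - real (CARD('n) + q)) / real d > real N"
    using d by (simp add: M_def field_simps)
  let ?B = "{\<gamma> \<in> {\<gamma> :: 'n \<Rightarrow> nat. \<forall>i. \<gamma> i < Suc M}. (real (sum \<gamma> UNIV) - real (CARD('n) + q)) / real d = real N}"
  have "?B = Delta M"
  proof (intro equalityI subsetI)
    fix \<gamma> :: "'n \<Rightarrow> nat" assume "\<gamma> \<in> ?B"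
    then have "real (sum \<gamma> UNIV) = real M" using d by (simp add: M_def field_simps)
    then show "\<gamma> \<in> Delta M" unfolding of_nat_eq_iff by (simp add: Delta_def)
  next
    fix \<gamma> :: "'n \<Rightarrow> nat" assume "\<gamma> \<in> Delta M"
    then have s: "(sum \<gamma> UNIV) = M" by (simp add: Delta_def)
    then have "\<gamma> i \<le> M" for i using member_le_sum[of i UNIV \<gamma>] by simp
    moreover have "(real M - real (CARD('n) + q)) / real d = real N" using d by (simp add: M_def)
    ultimately show "\<gamma> \<in> ?B"
      unfolding mem_Collect_eq s by (simp add: less_Suc_eq_le)
  qed
  moreover have "Z nicely_meromorphic_on UNIV" using assms by (simp add: zeta_continuation_def)
  ultimately show ?thesis
    using mellin_continuation_value[OF meas fin C mellin(1) _ mellin(2) \<rho>] unfolding M_def by simp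
qed

section \<open>Integrals of the individual terms\<close>

text \<open>Exhibiting a polynomial makes the decay and integrability results for
  \<open>exp_weight\<close> applicable to each term of the expansion.\<close>

lemma P_coeff_poly: "\<exists>R. \<forall>x. P_coeff d P \<alpha> u (\<chi> i. x i) = mp_fun R x"
proof
  let ?R = "Poly_Mapping.single 0 ((\<Prod>k=1..d. fact (\<alpha> k)) / (\<Prod>k=1..d. \<Prod>\<gamma>\<in>Delta k. fact (u k \<gamma>))) *
    (\<Prod>k=1..d. \<Prod>\<gamma>\<in>Delta k. (Poly_Mapping.single 0 (1 / (\<Prod>i\<in>UNIV. fact (\<gamma> i))) * mder mpoly_pderiv \<gamma> P) ^ u k \<gamma>)"
  show "\<forall>x. P_coeff d P \<alpha> u (\<chi> i. x i) = mp_fun ?R x"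
    by (simp add: P_coeff_def mp_fun_mult mp_fun_prod mp_fun_power mp_fun_const mpoly_deriv_eq_mder mpoly_eval_eq_mp_fun)
qed

text \<open>A derivative of \<open>P\<close> of order k is homogeneous of degree d - k, and
  membership in \<open>V_set\<close> says that \<alpha>_k such factors occur.\<close>

lemma P_coeff_scale:
  assumes "u \<in> V_set d \<alpha>"
  shows "P_coeff d P \<alpha> u (\<chi> i. r * x i) = r ^ (\<Sum>k=1..d. (d - k) * \<alpha> k) * P_coeff d P \<alpha> u (\<chi> i. x i)"
proof -
  let ?c = "\<lambda>\<gamma> :: 'n \<Rightarrow> nat. (\<Prod>i\<in>UNIV. fact (\<gamma> i)) :: real"
  let ?p = "\<lambda>x k. \<Prod>\<gamma>\<in>Delta k. (mp_fun (mder mpoly_pderiv \<gamma> P) x / ?c \<gamma>) ^ u k \<gamma>"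
  have "?p (\<lambda>i. r * x i) k =
      r ^ ((d - k) * \<alpha> k) * ?p x k" if k: "k \<in> {1..d}" for k
  proof -
    have "(\<Sum>\<gamma>\<in>Delta k. u k \<gamma>) = \<alpha> k" using assms k by (auto simp: V_set_def PiE_iff)
    then have "r ^ ((d - k) * \<alpha> k) = (\<Prod>\<gamma>\<in>(Delta k :: ('n \<Rightarrow> nat) set). (r ^ (d - k)) ^ u k \<gamma>)"
      by (simp add: power_mult flip: power_sum)
    moreover have "mp_fun (mder mpoly_pderiv \<gamma> P) (\<lambda>i. r * x i) = r ^ (d - k) * mp_fun (mder mpoly_pderiv \<gamma> P) x"
      if "\<gamma> \<in> Delta k" for \<gamma>
      using mder_scale[OF P, of \<gamma> r x] that k by (simp add: Delta_def)
    ultimately show ?thesis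
      by (simp add: power_mult_distrib prod.distrib flip: times_divide_eq_right)
  qed
  then have "(\<Prod>k=1..d. \<Prod>\<gamma>\<in>Delta k. (mp_fun (mder mpoly_pderiv \<gamma> P) (\<lambda>i. r * x i) / ?c \<gamma>) ^ u k \<gamma>) =
     (\<Prod>k=1..d. r ^ ((d - k) * \<alpha> k)) * (\<Prod>k=1..d. \<Prod>\<gamma>\<in>Delta k. (mp_fun (mder mpoly_pderiv \<gamma> P) x / ?c \<gamma>) ^ u k \<gamma>)"
    by (simp add: prod.distrib)
  then show ?thesis
    by (simp add: P_coeff_def mpoly_deriv_eq_mder mpoly_eval_eq_mp_fun mult_ac flip: power_sum)
qed

text \<open>The polar formula with a = |\<alpha>| - N. On the faces the division by P^a is the power
  N - |\<alpha>| in \<open>K_integral\<close>, and (a - 1)! is the stated factorial.\<close>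

lemma integral_P_coeff:
  assumes \<beta>: "(sum \<beta> UNIV) \<le> q" and \<alpha>: "\<alpha> \<in> I_set d q N \<beta>" and u: "u \<in> V_set d \<alpha>"
  defines "H \<equiv> \<lambda>x. P_coeff d P \<alpha> u (\<chi> i. x i) * mp_fun (mder mpoly_pderiv \<beta> Q) x"
  shows "integrable (half_PiM) (\<lambda>x. H x * exp (- mp_fun P x))"
    and "(\<integral>x. H x * exp (- mp_fun P x) \<partial>half_PiM) =
      fact ((sum \<alpha> {1..d}) - 1 - N) / real d * (\<Sum>i\<in>UNIV. K_integral d i P Q N \<alpha> u \<beta>)"
proof -
  define a where "a = (sum \<alpha> {1..d}) - N"
  have a: "(sum \<alpha> {1..d}) = N + a" "a \<ge> 1" using I_set_size[OF \<alpha> \<beta>] by (auto simp: a_def)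
  obtain R where R: "\<And>x. P_coeff d P \<alpha> u (\<chi> i. x i) = mp_fun R x" using P_coeff_poly by blast
  have H_poly: "H = mp_fun (R * mder mpoly_pderiv \<beta> Q)" by (simp add: H_def fun_eq_iff R mp_fun_mult)
  have H_meas: "H \<in> borel_measurable (borel_PiM UNIV)"
    unfolding H_poly by (rule measurable_mp_fun) simp
  have "mixed 1 UNIV = (\<lambda>_ :: 'n. half_lborel)" by (simp add: fun_eq_iff mixed_def)
  then show int: "integrable (half_PiM) (\<lambda>x. H x * exp (- mp_fun P x))"
    using integrable_exp_weight_mixed[OF P d pos, of 1 UNIV "R * mder mpoly_pderiv \<beta> Q"]
    by (simp add: H_poly exp_weight_def[abs_def])
  \<comment> \<open>Degree count: the weights k and d - k of each \<alpha>_k add up to d |\<alpha>|,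
    and the equation defining \<open>I_set\<close> eliminates the sum of the k \<alpha>_k.\<close>
  have deg: "(\<Sum>k=1..d. (d - k) * \<alpha> k) + (q - sum \<beta> UNIV) + CARD('n) = d * a"
  proof -
    have "(\<Sum>k=1..d. (d - k) * \<alpha> k) + (\<Sum>k=1..d. k * \<alpha> k) = (\<Sum>k=1..d. d * \<alpha> k)"
      unfolding sum.distrib[symmetric] by (intro sum.cong) (auto simp flip: add_mult_distrib)
    also have "\<dots> = d * N + d * a" by (simp only: a(1) distrib_left sum_distrib_left[symmetric])
    finally have 1: "(\<Sum>k=1..d. (d - k) * \<alpha> k) + (\<Sum>k=1..d. k * \<alpha> k) = d * N + d * a" .
    have 2: "(\<Sum>k=1..d. k * \<alpha> k) + sum \<beta> UNIV = d * N + q + CARD('n)" using \<alpha> by (simp add: I_set_def)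
    have 3: "q - (sum \<beta> UNIV) + sum \<beta> UNIV = q" using \<beta> by simp
    from 1 2 3 show ?thesis by linarith
  qed
  have hom: "\<forall>r>0. \<forall>x. H (\<lambda>k. r * x k) * r ^ CARD('n) = r ^ (d * a) * H x"
    unfolding H_def P_coeff_scale[OF u] mder_scale[OF Q \<beta>] deg[symmetric] power_add by (simp add: mult_ac)
  have K: "K_integral d i P Q N \<alpha> u \<beta> = (\<integral>y. indicator (cube i) y *
        (H (hat i y) / mp_fun P (hat i y) ^ a) \<partial>face_lborel i)" for i
  proof -
    have "int N - int (sum \<alpha> {1..d}) = - int a" unfolding a(1) by simp
    then show ?thesis
      by (simp add: K_integral_def set_lebesgue_integral_def yhat_def H_def mpoly_eval_eq_mp_fun
          mpoly_deriv_eq_mder power_int_minus divide_inverse mult_ac)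
  qed
  have "(sum \<alpha> {1..d}) - 1 - N = a - 1" unfolding a(1) by simp
  then show "(\<integral>x. H x * exp (- mp_fun P x) \<partial>half_PiM) =
      fact ((sum \<alpha> {1..d}) - 1 - N) / real d * (\<Sum>i\<in>UNIV. K_integral d i P Q N \<alpha> u \<beta>)"
    unfolding K using integral_homogeneous_exp[OF P d pos H_meas a(2) hom int] by simp
qed

text \<open>The expansion is used pointwise under the integral with \<phi> =
  \<open>bernoulli_tilde\<close>; all sums are finite, so each term is then integrated
  separately.\<close>

lemma sum_theta_coeff:
  "(- 1) ^ N * fact N * (\<Sum>\<gamma>\<in>Delta (d * N + q + CARD('n)). theta_coeff \<gamma>) =
    (\<Sum>\<beta> | (\<Sum>i\<in>UNIV. \<beta> i) \<le> q. \<Sum>\<alpha>\<in>I_set d q N \<beta>. \<Sum>u\<in>V_set d \<alpha>.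
       (- 1) powi (int (\<Sum>k=1..d. \<alpha> k) - int N) * fact ((\<Sum>k=1..d. \<alpha> k) - 1 - N) * fact N /
       (real d * (\<Prod>k=1..d. fact (\<alpha> k)) * (\<Prod>i\<in>UNIV. fact (\<beta> i))) *
       (\<Sum>i\<in>UNIV. K_integral d i P Q N \<alpha> u \<beta>) *
       (\<Prod>i\<in>UNIV. bernoulli_tilde (g_index d u i + \<beta> i)))" (is "?m * _ = ?rhs")
proof -
  let ?D = "Delta (d * N + q + CARD('n)) :: ('n \<Rightarrow> nat) set"
  let ?\<mu> = "Pi\<^sub>M (UNIV :: 'n set) (\<lambda>_. half_lborel)"
  let ?H = "\<lambda>\<beta> \<alpha> u x. P_coeff d P \<alpha> u (\<chi> i. x i) * mp_fun (mder mpoly_pderiv \<beta> Q) x"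
  let ?c = "\<lambda>\<beta> \<alpha>. (- 1) ^ (sum \<alpha> {1..d}) / ((\<Prod>k=1..d. fact (\<alpha> k)) * (\<Prod>i\<in>UNIV. fact (\<beta> i))) :: real"
  let ?b = "\<lambda>\<beta> u. \<Prod>i\<in>UNIV. bernoulli_tilde (g_index d u i + \<beta> i)"
  let ?X = "\<lambda>x. \<Sum>\<gamma>\<in>?D. (\<Prod>i\<in>UNIV. bernoulli_tilde (\<gamma> i) / fact (\<gamma> i)) * exp_weight P (mder (exp_pderiv P) \<gamma> Q) x"
  let ?Y = "\<lambda>x. \<Sum>\<beta> | sum \<beta> UNIV \<le> q. \<Sum>\<alpha>\<in>I_set d q N \<beta>. \<Sum>u\<in>V_set d \<alpha>. ?c \<beta> \<alpha> * ?b \<beta> u * (?H \<beta> \<alpha> u x * exp (- mp_fun P x))"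
  have "mixed 1 UNIV = (\<lambda>_ :: 'n. half_lborel)" by (simp add: fun_eq_iff mixed_def)
  then have int: "integrable ?\<mu> (exp_weight P S)" for S
    using integrable_exp_weight_mixed[OF P d pos, of 1 UNIV S] by simp
  have "(\<Sum>\<gamma>\<in>?D. theta_coeff \<gamma>) = (\<integral>x. (?X x) \<partial>?\<mu>)"
    unfolding theta_coeff_def using int by (subst Bochner_Integration.integral_sum) auto
  also have "\<dots> = (\<integral>x. (?Y x) \<partial>?\<mu>)"
  proof (rule Bochner_Integration.integral_cong[OF refl])
    fix x
    have "(?X x) =
      exp (- mp_fun P x) * (\<Sum>\<gamma>\<in>?D. mp_fun (mder (exp_pderiv P) \<gamma> Q) x / (\<Prod>i\<in>UNIV. fact (\<gamma> i)) * (\<Prod>i\<in>UNIV. bernoulli_tilde (\<gamma> i)))"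
      by (simp add: exp_weight_def prod_dividef sum_distrib_left mult_ac)
    also have "\<dots> = (?Y x)"
      unfolding exp_pderiv_expansion[OF P Q, where N = N and x = x and \<phi> = "\<lambda>_. bernoulli_tilde"] sum_distrib_left
      by (intro sum.cong refl) (simp only: mult_ac)
    finally show "(?X x) =
      (?Y x)" .
  qed
  also have "\<dots> = (\<Sum>\<beta> | sum \<beta> UNIV \<le> q. \<Sum>\<alpha>\<in>I_set d q N \<beta>. \<Sum>u\<in>V_set d \<alpha>. ?c \<beta> \<alpha> * ?b \<beta> u * (\<integral>x. ?H \<beta> \<alpha> u x * exp (- mp_fun P x) \<partial>?\<mu>))"
  proof -
    have i1: "integrable ?\<mu> (\<lambda>x. ?c \<beta> \<alpha> * ?b \<beta> u * (?H \<beta> \<alpha> u x * exp (- mp_fun P x)))"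
      if "(sum \<beta> UNIV) \<le> q" "\<alpha> \<in> I_set d q N \<beta>" "u \<in> V_set d \<alpha>" for \<beta> \<alpha> u
      using integral_P_coeff(1)[OF that] by (rule integrable_mult_right)
    show ?thesis
      by (subst Bochner_Integration.integral_sum, (intro Bochner_Integration.integrable_sum i1; simp), intro sum.cong refl)
         (subst Bochner_Integration.integral_sum, (intro Bochner_Integration.integrable_sum i1; simp), intro sum.cong refl,
          subst Bochner_Integration.integral_sum, (intro i1; simp), intro sum.cong refl integral_mult_right_zero)
  qed
  finally have "?m * (\<Sum>\<gamma>\<in>?D. theta_coeff \<gamma>) = ?m * \<dots>" by (rule arg_cong)
  also have "\<dots> = ?rhs"
    unfolding triple_sum_distrib_left
  proof (intro sum.cong refl)
    fix \<beta> \<alpha> u assume "\<beta> \<in> {\<beta> :: 'n \<Rightarrow> nat. sum \<beta> UNIV \<le> q}" "\<alpha> \<in> I_set d q N \<beta>" "u \<in> (V_set d \<alpha> :: (nat \<Rightarrow> ('n \<Rightarrow> nat) \<Rightarrow> nat) set)"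
    then have eq: "(\<integral>x. ?H \<beta> \<alpha> u x * exp (- mp_fun P x) \<partial>?\<mu>) = fact (sum \<alpha> {1..d} - 1 - N) / real d * (\<Sum>i\<in>UNIV. K_integral d i P Q N \<alpha> u \<beta>)"
      by (intro integral_P_coeff(2)) auto
    \<comment> \<open>The sign (-1)^|\<alpha>| stems from the negative exponent in e^-P and (-1)^N
      from the derivative of 1/\<Gamma>; together they form the integer power with exponent
      |\<alpha>| - N.\<close>
    have sign: "(- 1 :: real) powi (int S - int N) = (- 1) ^ N * (- 1) ^ S" for S :: nat
      by (simp add: power_int_diff divide_inverse power_inverse[symmetric] mult.commute)
    show "?m * (?c \<beta> \<alpha> * ?b \<beta> u * (\<integral>x. ?H \<beta> \<alpha> u x * exp (- mp_fun P x) \<partial>?\<mu>)) =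
      (- 1) powi (int (sum \<alpha> {1..d}) - int N) * fact (sum \<alpha> {1..d} - 1 - N) * fact N /
       (real d * (\<Prod>k=1..d. fact (\<alpha> k)) * (\<Prod>i\<in>UNIV. fact (\<beta> i))) *
       (\<Sum>i\<in>UNIV. K_integral d i P Q N \<alpha> u \<beta>) * ?b \<beta> u"
      unfolding eq sign by (simp add: mult_ac)
  qed
  finally show ?thesis .
qed

end

theorem theorem4:
  fixes P Q :: "'n::finite mpoly" and d q N :: nat and Z :: "complex \<Rightarrow> complex"
  assumes "d \<ge> 1"
    and "homogeneous d P" and "elliptic P" and "\<And>x. x \<noteq> 0 \<Longrightarrow> mpoly_eval P x > 0"
    and "homogeneous q Q"
    and "zeta_continuation d q P Q Z"
  shows "\<not> is_pole Z (- of_nat N) \<and>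
    Z (- of_nat N) = complex_of_real
     (\<Sum>\<beta> | (\<Sum>i\<in>UNIV. \<beta> i) \<le> q. \<Sum>\<alpha>\<in>I_set d q N \<beta>. \<Sum>u\<in>V_set d \<alpha>.
        (- 1) powi (int (\<Sum>k=1..d. \<alpha> k) - int N) * fact ((\<Sum>k=1..d. \<alpha> k) - 1 - N) * fact N /
        (real d * (\<Prod>k=1..d. fact (\<alpha> k)) * (\<Prod>i\<in>UNIV. fact (\<beta> i))) *
        (\<Sum>i\<in>UNIV. K_integral d i P Q N \<alpha> u \<beta>) *
        (\<Prod>i\<in>UNIV. bernoulli_tilde (g_index d u i + \<beta> i)))"
  by (subst sum_theta_coeff[OF assms(2,1,4,5), symmetric]; (assumption | rule zeta_value_eq_theta_coeffs[OF assms(2,1,4,5,6)]))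

end
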